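(* Let the game tree, the loss function $\lambda:L\to[0,1]$, the functions $n,m,\beta$, and the algorithm DP-EFB be as in the context, with $T\ge 1$ trials and privacy parameter $\epsilon\in(0,1)$. Let $\mu_1,\dots,\mu_T$ be arbitrary environments fixed in advance. Then the regret $$R:=\mathbb{E}\Big[\sum_{t=1}^T \ell_t\Big]-\min_{\sigma\in\mathcal S}\sum_{t=1}^T\Lambda(\sigma,\mu_t)$$ satisfies $$R\le 1+2\sqrt{\left(\frac{6\ln T}{\epsilon}+\frac{9(e-2)}{\epsilon^2}\right)|\mathcal A|\,\ln(|\mathcal S|)\,T}\,.$$
   Context: Game tree: $V$ is the node set of a finite rooted tree with root $r$ and leaf set $L$; $C(v)$ denotes the set of children of $v$ and $p(v)$ the parent of $v\neq r$. The internal nodes $V\setminus L$ are partitioned into a set $N$ of infosets and a set $\mathcal A$ of actions such that $r\in N$, $C(v)\subseteq\mathcal A$ and $|C(v)|>1$ for every $v\in N$, and $C(a)\subseteq N\cup L$ for every $a\in\mathcal A$. A loss function $\lambda:L\to[0,1]$ is fixed. A (pure) strategy is a map $\sigma:N\to V$ with $\sigma(v)\in C(v)$ for all $v\in N$; an environment is a map $\mu:\mathcal A\to V$ with $\mu(a)\in C(a)$ for all $a\in\mathcal A$. For a strategy $\sigma$, $V(\sigma)$ is the smallest subset of $V$ containing $r$, containing $\sigma(v)$ for every $v\in N\cap V(\sigma)$, and containing $C(a)$ for every $a\in\mathcal A\cap V(\sigma)$. The reduced strategy of $\sigma$ is the restriction of $\sigma$ to $N\cap V(\sigma)$ (with $V$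 of it defined as $V(\sigma)$); $\mathcal S$ is the set of all reduced strategies. For $\sigma\in\mathcal S$ write $N(\sigma)=N\cap V(\sigma)$, $\mathcal A(\sigma)=\mathcal A\cap V(\sigma)$. Playing a pair $(\sigma,\mu)$, $\sigma\in\mathcal S$, $\mu$ an environment, traverses the root-to-leaf path starting at $r$, moving from $v\in N$ to $\sigma(v)$ and from $a\in\mathcal A$ to $\mu(a)$, stopping at a leaf $u$; the loss is $\Lambda(\sigma,\mu):=\lambda(u)$, and the last action on this path is called the last action encountered. Functions $n,m:N\cup\mathcal A\to\mathbb N$ are defined recursively from the bottom of the tree: for $a\in\mathcal A$, $n(a)=\prod_{v\in C(a)\cap N}n(v)$ and $m(a)=1+\sum_{v\in C(a)\cap N}m(v)$ (empty product $=1$, empty sum $=0$); for $v\in N$, $n(v)=\sum_{a\in C(v)}n(a)$ and $m(v)=\sum_{a\in C(v)}m(a)$. The function $\beta:N\cup\mathcal A\to\mathbb R$ is defined from the top: $\beta(r)=1$, $\beta(a)=m(a)\beta(p(a))$ for $a\in\mathcal A$, $\beta(v)=\beta(p(v))/m(v)$ for $v\in N\setminus\{r\}$. Algorithm DP-EFB (parameters $T$, $\epsilon\in(0,1)$): set $\eta:=\left(\left(\frac{6\ln T}{\epsilon}+\frac{9(e-2)}{\epsilon^2}\right)\frac{m(r)T}{\ln n(r)}\right)^{-1/2}$ and $\gamma:=6\ln(T)\eta/\epsilon$. A policy is a map $\pi:\mathcal A\to[0,1]$ with $\sum_{a\in C(v)}\pi(a)=1$ for all $v\in N$. Initially $\pi_1(a):=n(a)/n(p(a))$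 for all $a\in\mathcal A$. For $a\in\mathcal A$, let $q_t(a)$ be the product of $\pi_t(a')$ over all actions $a'$ on the path from $r$ to $a$ (including $a$). On each trial $t=1,\dots,T$: (i) the server samples $\sigma_t\in\mathcal S$ recursively: starting at $r$, at each visited infoset $v$ it draws $\sigma_t(v)\in C(v)$ with $\Pr[\sigma_t(v)=a]=\pi_t(a)$ independently, and then visits every $v'\in C(\sigma_t(v))\cap N$. (ii) $(\sigma_t,\mu_t)$ is played, giving loss $\ell_t:=\Lambda(\sigma_t,\mu_t)$; let $z_t$ be the last action encountered. (iii) For each $a\in\mathcal A(\sigma_t)$, independently draw $\phi_t(a)$ from the Laplace density $Q(x)=\frac{\epsilon}{4}\exp(-\frac{\epsilon}{2}|x|)$ and set $d_t(a):=[a=z_t]\,\ell_t+\phi_t(a)$ (where $[P]$ is $1$ if $P$ holds and $0$ otherwise); $d_t:\mathcal A(\sigma_t)\to\mathbb R$ is sent to the server. (iv) The server runs $\mathrm{Update}_t(r,1)$, where for $v\in N(\sigma_t)$ and $x>0$, $\mathrm{Update}_t(v,x)$ does: let $b:=\sigma_t(v)$; for each $v'\in C(b)\cap N$ run $\mathrm{Update}_t(v',\pi_t(b)x)$ and call its return value $\psi_t(v')$; set $\omega_t(v):=\exp\!\left(\frac{-\eta\, d_t(b)}{\gamma\beta(b)+\pi_t(b)x}\right)\prod_{v'\in C(b)\cap N}\psi_t(v')$; for all $a\in C(v)$ set $\pi_{t+1}(a):=\frac{[a=b]\,\omega_t(v)\pi_t(a)+[a\ne b]\,\pi_t(a)}{1-(1-\omega_t(v))\pi_t(b)}$;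 return $\psi_t(v):=1-(1-\omega_t(v))\pi_t(b)$. For every $v\in N\setminus N(\sigma_t)$, $\pi_{t+1}(a):=\pi_t(a)$ for all $a\in C(v)$. Expectations are over all randomness of the algorithm. *)

theory Defs
  imports "HOL-Probability.Probability"
begin

text \<open>A finite rooted tree with node set V, root r and parent function par
(the value par r is irrelevant).  The internal nodes are partitioned into the
infosets Nset and the actions Aset.\<close>

locale game_tree =
  fixes V :: "'v set" and r :: 'v and par :: "'v \<Rightarrow> 'v"
    and Nset :: "'v set" and Aset :: "'v set"
  assumes finite_V: "finite V"
    and root_in: "r \<in> V"
    and par_in: "\<And>u. u \<in> V \<Longrightarrow> u \<noteq> r \<Longrightarrow> par u \<in> V"
    and reaches_root: "\<And>u. u \<in> V \<Longrightarrow> \<exists>k. (par ^^ k) u = r"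
    and N_A_disjoint: "Nset \<inter> Aset = {}"
    and N_A_internal: "Nset \<union> Aset = V - {v \<in> V. {u \<in> V. u \<noteq> r \<and> par u = v} = {}}"
    and root_infoset: "r \<in> Nset"
    and infoset_children: "\<And>v. v \<in> Nset \<Longrightarrow>
          {u \<in> V. u \<noteq> r \<and> par u = v} \<subseteq> Aset \<and> card {u \<in> V. u \<noteq> r \<and> par u = v} > 1"
    and action_children: "\<And>a. a \<in> Aset \<Longrightarrow>
          {u \<in> V. u \<noteq> r \<and> par u = a} \<subseteq> Nset \<union> {v \<in> V. {u \<in> V. u \<noteq> r \<and> par u = v} = {}}"
begin

definition C :: "'v \<Rightarrow> 'v set" where
  "C v = {u \<in> V. u \<noteq> r \<and> par u = v}"

definition leaves :: "'v set" where
  "leaves = {v \<in> V. C v = {}}"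

definition childR :: "('v \<times> 'v) set" where
  "childR = {(u, v). u \<in> V \<and> u \<noteq> r \<and> par u = v}"

definition n :: "'v \<Rightarrow> nat" where
  "n = wfrec childR (\<lambda>f v. if v \<in> Aset then (\<Prod>u \<in> C v \<inter> Nset. f u) else (\<Sum>a \<in> C v. f a))"

definition m :: "'v \<Rightarrow> nat" where
  "m = wfrec childR (\<lambda>f v. if v \<in> Aset then 1 + (\<Sum>u \<in> C v \<inter> Nset. f u) else (\<Sum>a \<in> C v. f a))"

definition beta :: "'v \<Rightarrow> real" where
  "beta = wfrec (childR\<inverse>) (\<lambda>f v. if v = r then 1
            else if v \<in> Aset then real (m v) * f (par v) else f (par v) / real (m v))"

definition strategy :: "('v \<Rightarrow> 'v) \<Rightarrow> bool" where
  "strategy \<sigma> \<longleftrightarrow> (\<forall>v \<in> Nset. \<sigma> v \<in> C v)"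

definition environment :: "('v \<Rightarrow> 'v) \<Rightarrow> bool" where
  "environment \<mu> \<longleftrightarrow> (\<forall>a \<in> Aset. \<mu> a \<in> C a)"

definition RV :: "('v \<rightharpoonup> 'v) \<Rightarrow> 'v set" where
  "RV \<rho> = \<Inter>{X. r \<in> X \<and> (\<forall>v \<in> Nset \<inter> X. \<forall>w. \<rho> v = Some w \<longrightarrow> w \<in> X)
                   \<and> (\<forall>a \<in> Aset \<inter> X. C a \<subseteq> X)}"

definition reduce :: "('v \<Rightarrow> 'v) \<Rightarrow> ('v \<rightharpoonup> 'v)" where
  "reduce \<sigma> = (Some \<circ> \<sigma>) |` (Nset \<inter> RV (Some \<circ> \<sigma>))"

definition RS :: "('v \<rightharpoonup> 'v) set" where
  "RS = reduce ` {\<sigma>. strategy \<sigma>}"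

definition Nof :: "('v \<rightharpoonup> 'v) \<Rightarrow> 'v set" where
  "Nof \<rho> = Nset \<inter> RV \<rho>"

definition Aof :: "('v \<rightharpoonup> 'v) \<Rightarrow> 'v set" where
  "Aof \<rho> = Aset \<inter> RV \<rho>"

definition play_path :: "('v \<rightharpoonup> 'v) \<Rightarrow> ('v \<Rightarrow> 'v) \<Rightarrow> 'v set" where
  "play_path \<rho> \<mu> = \<Inter>{X. r \<in> X \<and> (\<forall>v \<in> Nset \<inter> X. \<forall>w. \<rho> v = Some w \<longrightarrow> w \<in> X)
                           \<and> (\<forall>a \<in> Aset \<inter> X. \<mu> a \<in> X)}"

definition leaf_reached :: "('v \<rightharpoonup> 'v) \<Rightarrow> ('v \<Rightarrow> 'v) \<Rightarrow> 'v" where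
  "leaf_reached \<rho> \<mu> = (THE u. u \<in> leaves \<and> u \<in> play_path \<rho> \<mu>)"

definition Loss :: "('v \<Rightarrow> real) \<Rightarrow> ('v \<rightharpoonup> 'v) \<Rightarrow> ('v \<Rightarrow> 'v) \<Rightarrow> real" where
  "Loss lam \<rho> \<mu> = lam (leaf_reached \<rho> \<mu>)"

definition last_action :: "('v \<rightharpoonup> 'v) \<Rightarrow> ('v \<Rightarrow> 'v) \<Rightarrow> 'v" where
  "last_action \<rho> \<mu> = par (leaf_reached \<rho> \<mu>)"

definition eta :: "nat \<Rightarrow> real \<Rightarrow> real" where
  "eta T eps = 1 / sqrt ((6 * ln (real T) / eps + 9 * (exp 1 - 2) / eps\<^sup>2)
                          * real (m r) * real T / ln (real (n r)))"

definition gamma :: "nat \<Rightarrow> real \<Rightarrow> real" where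
  "gamma T eps = 6 * ln (real T) * eta T eps / eps"

text \<open>policies are represented as extensional functions on Aset\<close>
definition pi1 :: "'v \<Rightarrow> real" where
  "pi1 = (\<lambda>a \<in> Aset. real (n a) / real (n (par a)))"

text \<open>the argument x with which Update_t(v, x) is called: the product of pi_t over
the actions on the path from r to v\<close>
definition xarg :: "('v \<Rightarrow> real) \<Rightarrow> 'v \<Rightarrow> real" where
  "xarg \<pi> v = (\<Prod>a \<in> {a \<in> Aset. (v, a) \<in> childR\<^sup>+}. \<pi> a)"

definition omega_core :: "nat \<Rightarrow> real \<Rightarrow> ('v \<Rightarrow> real) \<Rightarrow> ('v \<rightharpoonup> 'v) \<Rightarrow> ('v \<Rightarrow> real)
                           \<Rightarrow> ('v \<Rightarrow> real) \<Rightarrow> 'v \<Rightarrow> real" where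
  "omega_core T eps \<pi> \<rho> d f v =
     (let b = the (\<rho> v) in
      exp (- eta T eps * d b / (gamma T eps * beta b + \<pi> b * xarg \<pi> v))
      * (\<Prod>v' \<in> C b \<inter> Nset. f v'))"

text \<open>return value psi_t(v) of Update_t(v, x), computed bottom-up\<close>
definition psi :: "nat \<Rightarrow> real \<Rightarrow> ('v \<Rightarrow> real) \<Rightarrow> ('v \<rightharpoonup> 'v) \<Rightarrow> ('v \<Rightarrow> real) \<Rightarrow> 'v \<Rightarrow> real" where
  "psi T eps \<pi> \<rho> d = wfrec (childR\<^sup>+)
      (\<lambda>f v. 1 - (1 - omega_core T eps \<pi> \<rho> d f v) * \<pi> (the (\<rho> v)))"

definition omega :: "nat \<Rightarrow> real \<Rightarrow> ('v \<Rightarrow> real) \<Rightarrow> ('v \<rightharpoonup> 'v) \<Rightarrow> ('v \<Rightarrow> real) \<Rightarrow> 'v \<Rightarrow> real" where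
  "omega T eps \<pi> \<rho> d v = omega_core T eps \<pi> \<rho> d (psi T eps \<pi> \<rho> d) v"

definition update :: "nat \<Rightarrow> real \<Rightarrow> ('v \<Rightarrow> real) \<Rightarrow> ('v \<rightharpoonup> 'v) \<Rightarrow> ('v \<Rightarrow> real) \<Rightarrow> ('v \<Rightarrow> real)" where
  "update T eps \<pi> \<rho> d = (\<lambda>a \<in> Aset.
      if par a \<in> Nof \<rho> then
        (if a = the (\<rho> (par a)) then omega T eps \<pi> \<rho> d (par a) * \<pi> a else \<pi> a)
          / psi T eps \<pi> \<rho> d (par a)
      else \<pi> a)"

text \<open>distribution of the reduced strategy sampled by the server from policy pi:
independent draws at each visited infoset\<close>
definition sample_strategy :: "('v \<Rightarrow> real) \<Rightarrow> ('v \<rightharpoonup> 'v) measure" where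
  "sample_strategy \<pi> = density (count_space RS)
      (\<lambda>\<rho>. ennreal (\<Prod>v \<in> Nof \<rho>. \<pi> (the (\<rho> v))))"

definition laplace :: "real \<Rightarrow> real measure" where
  "laplace eps = density lborel (\<lambda>x. ennreal (eps / 4 * exp (- (eps / 2) * \<bar>x\<bar>)))"

definition dvec :: "('v \<Rightarrow> real) \<Rightarrow> ('v \<rightharpoonup> 'v) \<Rightarrow> ('v \<Rightarrow> 'v) \<Rightarrow> ('v \<Rightarrow> real) \<Rightarrow> 'v \<Rightarrow> real" where
  "dvec lam \<rho> \<mu> \<phi> a = (if a = last_action \<rho> \<mu> then Loss lam \<rho> \<mu> else 0) + \<phi> a"

text \<open>state of the process: (accumulated loss so far, current policy)\<close>
definition state_space :: "(real \<times> ('v \<Rightarrow> real)) measure" where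
  "state_space = borel \<Otimes>\<^sub>M (\<Pi>\<^sub>M a \<in> Aset. borel)"

definition trial :: "('v \<Rightarrow> real) \<Rightarrow> nat \<Rightarrow> real \<Rightarrow> ('v \<Rightarrow> 'v)
                      \<Rightarrow> real \<times> ('v \<Rightarrow> real) \<Rightarrow> (real \<times> ('v \<Rightarrow> real)) measure" where
  "trial lam T eps \<mu> s = (case s of (L, \<pi>) \<Rightarrow>
      sample_strategy \<pi> \<bind> (\<lambda>\<rho>.
      (\<Pi>\<^sub>M a \<in> Aof \<rho>. laplace eps) \<bind> (\<lambda>\<phi>.
      return state_space (L + Loss lam \<rho> \<mu>, update T eps \<pi> \<rho> (dvec lam \<rho> \<mu> \<phi>)))))"

primrec run :: "('v \<Rightarrow> real) \<Rightarrow> nat \<Rightarrow> real \<Rightarrow> (nat \<Rightarrow> 'v \<Rightarrow> 'v) \<Rightarrow> nat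
                 \<Rightarrow> (real \<times> ('v \<Rightarrow> real)) measure" where
  "run lam T eps \<mu> 0 = return state_space (0, pi1)"
| "run lam T eps \<mu> (Suc k) = run lam T eps \<mu> k \<bind> trial lam T eps (\<mu> (Suc k))"

definition expected_total_loss :: "('v \<Rightarrow> real) \<Rightarrow> nat \<Rightarrow> real \<Rightarrow> (nat \<Rightarrow> 'v \<Rightarrow> 'v) \<Rightarrow> real" where
  "expected_total_loss lam T eps \<mu> = (\<integral>s. fst s \<partial>(run lam T eps \<mu> T))"

end

end

theory Submission
  imports Defs
begin

text \<open>
  A policy induces a product-form distribution over the reduced strategies, and the local updates
  multiply the weight of a strategy \<open>\<sigma>\<close> by \<open>exp (- \<eta> X(\<sigma>))\<close> up to normalisation, where \<open>X(\<sigma>)\<close> sums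
  the biased estimates \<open>d(a) / (\<gamma> \<beta>(a) + q(a))\<close> over the sampled actions of \<open>\<sigma>\<close>. The initial policy is
  uniform on the \<open>n(r)\<close> reduced strategies. For a fixed comparator \<open>\<sigma>\<close>, the potential
  accumulated loss minus \<open>ln w(\<sigma>) / \<eta>\<close> is nonnegative, and one trial increases its expectation by at
  most \<open>\<Lambda>(\<sigma>,\<mu>) + \<gamma> |A| + 9 (e - 2) \<eta> |A| / \<epsilon>\<^sup>2\<close>. The bias term uses that \<open>\<beta>\<close> sums to
  \<open>m(r) = |A|\<close> over the actions that an environment can end on; the second-order term uses that
  \<open>1 / \<beta>\<close> sums to 1 over the actions of any reduced strategy, so that \<open>\<gamma>\<close> keeps the total noise
  scale in the exponent below 1/2 once \<open>T \<ge> 2\<close>. For \<open>T = 1\<close> the regret is at most 1.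
\<close>

text \<open>The noise is unbounded, so the exponents cannot be bounded path by path; the potential
  avoids this. In one trial it changes by the loss played plus X(sigma) + ln Z / eta, where Z is the
  normaliser, which \<open>psi\<close> returns at the root. Replacing ln Z by Z - 1 leaves a finite
  sum of exponentials whose exponents are linear in independent Laplace variables, and these have
  exact expectations. Since all weights are at most 1, the potential is at least the accumulated
  loss, so whole runs can be handled in \<open>ennreal\<close>, without integrability proofs for the
  updated policies. Two averages are taken: over the sampled strategy and over the strategies inside
  Z. Each puts a factor q(a) on the action a. At second order this leaves q(a)^2 / den(a)^2 <= 1,
  one unit per action, which is where the factor |A| comes from. At first order the played loss q(a)
  l(a) is cancelled by q(a)^2 l(a) / den(a) up to gamma beta(a) l(a).\<close>

context game_tree
begin

section \<open>The game tree\<close>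

lemma C_iff: "u \<in> C v \<longleftrightarrow> u \<in> V \<and> u \<noteq> r \<and> par u = v"
  by (auto simp: C_def)

lemma childR_iff: "(u, v) \<in> childR \<longleftrightarrow> u \<in> C v"
  by (auto simp: C_def childR_def)

lemma finite_C: "finite (C v)"
  by (rule finite_subset[OF _ finite_V]) (auto simp: C_def)

lemma internal_nodes: "Nset \<union> Aset = V - leaves"
  using N_A_internal by (simp add: leaves_def C_def)

lemma Nset_subset: "Nset \<subseteq> V" and Aset_subset: "Aset \<subseteq> V"
  using internal_nodes by auto

lemma finite_Nset: "finite Nset" and finite_Aset: "finite Aset"
  using Nset_subset Aset_subset finite_V finite_subset by auto

lemma children_of_infoset: "v \<in> Nset \<Longrightarrow> C v \<subseteq> Aset"
  and card_children_of_infoset: "v \<in> Nset \<Longrightarrow> card (C v) > 1"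
  using infoset_children by (auto simp: C_def)

lemma children_of_action: "a \<in> Aset \<Longrightarrow> C a \<subseteq> Nset \<union> leaves"
  using action_children by (auto simp: C_def leaves_def)

lemma parent_of_action:
  assumes "a \<in> Aset" shows "a \<noteq> r" "par a \<in> Nset" "a \<in> C (par a)"
proof -
  show 1: "a \<noteq> r" using assms root_infoset N_A_disjoint by auto
  then show 2: "a \<in> C (par a)" using assms Aset_subset by (auto simp: C_iff)
  have "par a \<in> V" using par_in assms 1 Aset_subset by auto
  then have "par a \<in> Nset \<union> Aset" using 2 internal_nodes by (auto simp: leaves_def)
  moreover have "par a \<notin> Aset"
    using children_of_action[of "par a"] 2 assms N_A_disjoint internal_nodes by auto
  ultimately show "par a \<in> Nset" by auto
qed

lemma parent_of_non_action:
  assumes "u \<in> V" "u \<notin> Aset" "u \<noteq> r" shows "par u \<in> Aset" "u \<in> C (par u)"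
proof -
  show 1: "u \<in> C (par u)" using assms by (auto simp: C_iff)
  have "par u \<in> V" using par_in assms by auto
  then have "par u \<in> Nset \<union> Aset" using 1 internal_nodes by (auto simp: leaves_def)
  then show "par u \<in> Aset" using children_of_infoset[of "par u"] 1 assms by auto
qed

text \<open>Induction from the root downwards, for facts inherited from the parent, such as those
  about \<open>beta\<close> and about paths. Well-founded induction along \<open>childR\<close> runs
  in the opposite direction.\<close>

lemma tree_induct [consumes 1, case_names root step]:
  assumes "u \<in> V" and "P r" and "\<And>u. u \<in> V \<Longrightarrow> u \<noteq> r \<Longrightarrow> P (par u) \<Longrightarrow> P u"
  shows "P u"
proof -
  obtain k where "(par ^^ k) u = r" using reaches_root assms(1) by blast
  then show ?thesis using assms(1)
  proof (induction k arbitrary: u)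
    case 0
    then show ?case using assms(2) by simp
  next
    case (Suc k)
    show ?case
    proof (cases "u = r")
      case False
      have "(par ^^ k) (par u) = r" using Suc.prems by (simp add: funpow_swap1)
      then show ?thesis using Suc.IH[of "par u"] Suc.prems par_in False assms(3) by blast
    qed (use assms(2) in simp)
  qed
qed

text \<open>That every node reaches the root is the assumption that excludes cycles: the least
  number of parent steps to \<open>r\<close> drops when passing to the parent. Well-foundedness in
  the other direction then comes from finiteness.\<close>

lemma wf_childR_converse: "wf (childR\<inverse>)"
proof -
  define depth where "depth u = (LEAST k. (par ^^ k) u = r)" for u
  have "depth (par u) < depth u" if "u \<in> V" "u \<noteq> r" for u
  proof -
    have *: "(par ^^ depth u) u = r"
      unfolding depth_def by (rule LeastI_ex) (use reaches_root that in blast)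
    with that obtain e where e: "depth u = Suc e" by (cases "depth u") auto
    with * have "(par ^^ e) (par u) = r" by (simp add: funpow_swap1)
    then have "depth (par u) \<le> e" unfolding depth_def by (rule Least_le)
    then show ?thesis using e by simp
  qed
  then have "childR\<inverse> \<subseteq> Wellfounded.measure depth" by (auto simp: childR_def)
  then show ?thesis using wf_measure wf_subset by blast
qed

lemma acyclic_childR: "acyclic childR"
  using wf_acyclic[OF wf_childR_converse] by (simp add: acyclic_converse)

lemma wf_childR: "wf childR"
proof (rule finite_acyclic_wf[OF _ acyclic_childR])
  have "childR \<subseteq> V \<times> V" using par_in by (auto simp: childR_def)
  then show "finite childR" using finite_V by (meson finite_SigmaI finite_subset)
qed

section \<open>The recursions for \<open>n\<close>, \<open>m\<close> and \<open>beta\<close>\<close>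

lemma n_action: "a \<in> Aset \<Longrightarrow> n a = (\<Prod>u \<in> C a \<inter> Nset. n u)"
  unfolding n_def by (subst wfrec[OF wf_childR]) (auto intro!: prod.cong simp: cut_apply childR_iff)

lemma n_infoset: "v \<in> Nset \<Longrightarrow> n v = (\<Sum>a \<in> C v. n a)"
  using N_A_disjoint unfolding n_def
  by (subst wfrec[OF wf_childR]) (auto intro!: sum.cong simp: cut_apply childR_iff)

lemma m_action: "a \<in> Aset \<Longrightarrow> m a = 1 + (\<Sum>u \<in> C a \<inter> Nset. m u)"
  unfolding m_def by (subst wfrec[OF wf_childR]) (auto intro!: sum.cong simp: cut_apply childR_iff)

lemma m_infoset: "v \<in> Nset \<Longrightarrow> m v = (\<Sum>a \<in> C v. m a)"
  using N_A_disjoint unfolding m_def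
  by (subst wfrec[OF wf_childR]) (auto intro!: sum.cong simp: cut_apply childR_iff)

lemma beta_root: "beta r = 1"
  unfolding beta_def by (subst wfrec[OF wf_childR_converse]) simp

lemma beta_action: "a \<in> Aset \<Longrightarrow> beta a = real (m a) * beta (par a)"
  using parent_of_action[of a] unfolding beta_def
  by (subst wfrec[OF wf_childR_converse]) (auto simp: cut_apply childR_iff)

lemma beta_infoset: "v \<in> Nset \<Longrightarrow> v \<noteq> r \<Longrightarrow> beta v = beta (par v) / real (m v)"
  using parent_of_non_action[of v] Nset_subset N_A_disjoint unfolding beta_def
  by (subst wfrec[OF wf_childR_converse]) (auto simp: cut_apply childR_iff)

lemma children_of_infoset_ne: "v \<in> Nset \<Longrightarrow> C v \<noteq> {}"
  using card_children_of_infoset[of v] by force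

lemma n_pos: "u \<in> Nset \<union> Aset \<Longrightarrow> n u > 0"
proof (induction u rule: wf_induct_rule[OF wf_childR])
  case (1 u)
  show ?case
  proof (cases "u \<in> Aset")
    case True
    then show ?thesis using 1 by (auto simp: n_action childR_iff intro!: prod_pos)
  next
    case False
    then have u: "u \<in> Nset" using 1 by auto
    have "n a > 0" if "a \<in> C u" for a
      using 1 that children_of_infoset[OF u] by (auto simp: childR_iff)
    then show ?thesis
      using children_of_infoset_ne[OF u] finite_C by (auto simp: n_infoset[OF u] intro!: sum_pos)
  qed
qed

lemma m_pos: "u \<in> Nset \<union> Aset \<Longrightarrow> m u > 0"
proof (induction u rule: wf_induct_rule[OF wf_childR])
  case (1 u)
  show ?case
  proof (cases "u \<in> Aset")
    case False
    then have u: "u \<in> Nset" using 1 by auto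
    have "m a > 0" if "a \<in> C u" for a
      using 1 that children_of_infoset[OF u] by (auto simp: childR_iff)
    then show ?thesis
      using children_of_infoset_ne[OF u] finite_C by (auto simp: m_infoset[OF u] intro!: sum_pos)
  qed (simp add: m_action)
qed

lemma beta_pos: "u \<in> Nset \<union> Aset \<Longrightarrow> beta u > 0"
proof -
  assume u: "u \<in> Nset \<union> Aset"
  then have "u \<in> V" using Nset_subset Aset_subset by auto
  then show ?thesis using u
  proof (induction u rule: tree_induct)
    case root
    then show ?case by (simp add: beta_root)
  next
    case (step u)
    show ?case
    proof (cases "u \<in> Aset")
      case True
      then show ?thesis using step.IH parent_of_action[OF True] m_pos[of u] by (auto simp: beta_action)
    next
      case False
      then show ?thesis using step parent_of_non_action[of u] m_pos[of u] by (auto simp: beta_infoset)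
    qed
  qed
qed

lemma n_root_ge_2: "n r \<ge> 2"
proof -
  have "card (C r) \<le> (\<Sum>a\<in>C r. n a)"
    using sum_mono[of "C r" "\<lambda>_. 1" n] n_pos children_of_infoset[OF root_infoset]
    by (force simp: Suc_le_eq)
  then show ?thesis using card_children_of_infoset[OF root_infoset] n_infoset[OF root_infoset] by simp
qed

lemma Aset_children: "Aset = (\<Union>v\<in>Nset. C v)"
  using parent_of_action children_of_infoset by blast

lemma Nset_children: "Nset - {r} = (\<Union>a\<in>Aset. C a \<inter> Nset)"
proof
  show "Nset - {r} \<subseteq> (\<Union>a\<in>Aset. C a \<inter> Nset)"
    using parent_of_non_action N_A_disjoint Nset_subset by blast
qed (auto simp: C_iff)

lemma C_disjoint: "u \<noteq> v \<Longrightarrow> C u \<inter> C v = {}"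
  by (auto simp: C_iff)

text \<open>Double counting: every action is a child of exactly one infoset, and every infoset
  except the root is a child of exactly one action. So the totals of \<open>m\<close> over infosets
  and over actions agree up to \<open>m r\<close> on one side and the summand 1 of each action on
  the other.\<close>

lemma m_root: "m r = card Aset"
proof -
  have "(\<Sum>v\<in>Nset. m v) = (\<Sum>v\<in>Nset. \<Sum>a\<in>C v. m a)"
    by (simp add: m_infoset)
  also have "\<dots> = (\<Sum>a\<in>Aset. m a)"
    unfolding Aset_children using finite_Nset finite_C C_disjoint
    by (subst sum.UNION_disjoint) auto
  also have "\<dots> = card Aset + (\<Sum>a\<in>Aset. \<Sum>u\<in>C a \<inter> Nset. m u)"
    by (simp add: m_action sum_Suc)
  also have "(\<Sum>a\<in>Aset. \<Sum>u\<in>C a \<inter> Nset. m u) = (\<Sum>u\<in>Nset - {r}. m u)"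
    unfolding Nset_children using finite_Aset finite_C C_disjoint
    by (subst sum.UNION_disjoint) auto
  also have "(\<Sum>v\<in>Nset. m v) = m r + (\<Sum>u\<in>Nset - {r}. m u)"
    using finite_Nset root_infoset by (simp add: sum.remove)
  finally show ?thesis by simp
qed


section \<open>Reduced strategies\<close>

lemma RV_root: "r \<in> RV \<rho>"
  and RV_infoset: "v \<in> Nset \<Longrightarrow> v \<in> RV \<rho> \<Longrightarrow> \<rho> v = Some w \<Longrightarrow> w \<in> RV \<rho>"
  and RV_action: "a \<in> Aset \<Longrightarrow> a \<in> RV \<rho> \<Longrightarrow> C a \<subseteq> RV \<rho>"
  unfolding RV_def by blast+

lemma RV_induct [consumes 1, case_names root infoset action]:
  assumes "u \<in> RV \<rho>" and "P r"
    and "\<And>v w. v \<in> Nset \<Longrightarrow> v \<in> RV \<rho> \<Longrightarrow> P v \<Longrightarrow> \<rho> v = Some w \<Longrightarrow> P w"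
    and "\<And>a u. a \<in> Aset \<Longrightarrow> a \<in> RV \<rho> \<Longrightarrow> P a \<Longrightarrow> u \<in> C a \<Longrightarrow> P u"
  shows "P u"
proof -
  have "RV \<rho> \<subseteq> {u \<in> RV \<rho>. P u}"
    by (subst (1) RV_def, rule Inter_lower)
       (use assms(2-) RV_root RV_infoset RV_action in blast)
  then show ?thesis using assms(1) by auto
qed

text \<open>The closure queries a choice only at infosets that it has already reached, so choices
  elsewhere can be changed freely. This is why a strategy and its reduction visit the same
  nodes.\<close>

lemma RV_agree:
  assumes "\<And>v. v \<in> Nset \<Longrightarrow> v \<in> RV \<rho> \<Longrightarrow> \<rho> v = \<rho>' v"
  shows "RV \<rho>' = RV \<rho>"
proof (intro equalityI subsetI)
  fix u assume "u \<in> RV \<rho>'" then show "u \<in> RV \<rho>"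
    by (induction u rule: RV_induct) (use RV_root RV_infoset RV_action assms in fastforce)+
next
  fix u assume "u \<in> RV \<rho>" then show "u \<in> RV \<rho>'"
    by (induction u rule: RV_induct) (use RV_root RV_infoset RV_action assms in fastforce)+
qed

text \<open>When the choices made inside the closure are children, a node can enter only through its
  unique parent. Membership thus becomes a recursion along the path to the root.\<close>

lemma RV_iff:
  assumes ch: "\<And>v w. v \<in> Nset \<Longrightarrow> v \<in> RV \<rho> \<Longrightarrow> \<rho> v = Some w \<Longrightarrow> w \<in> C v"
    and u: "u \<in> V" "u \<noteq> r"
  shows "u \<in> RV \<rho> \<longleftrightarrow> par u \<in> RV \<rho> \<and> (par u \<in> Nset \<longrightarrow> \<rho> (par u) = Some u)"
proof
  assume "u \<in> RV \<rho>"
  then have "u = r \<or> par u \<in> RV \<rho> \<and> (par u \<in> Nset \<longrightarrow> \<rho> (par u) = Some u)"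
  proof (induction u rule: RV_induct)
    case (infoset v w)
    then show ?case using ch[of v w] by (auto simp: C_iff)
  next
    case (action a u)
    then show ?case using N_A_disjoint by (auto simp: C_iff)
  qed simp
  then show "par u \<in> RV \<rho> \<and> (par u \<in> Nset \<longrightarrow> \<rho> (par u) = Some u)" using u by simp
next
  assume a: "par u \<in> RV \<rho> \<and> (par u \<in> Nset \<longrightarrow> \<rho> (par u) = Some u)"
  show "u \<in> RV \<rho>"
  proof (cases "par u \<in> Nset")
    case True then show ?thesis using a RV_infoset by blast
  next
    case False
    then have "u \<notin> Aset" using parent_of_action by auto
    then show ?thesis using parent_of_non_action[of u] u a RV_action by blast
  qed
qed

lemma RV_reduce: "RV (reduce \<sigma>) = RV (Some \<circ> \<sigma>)"
  by (rule RV_agree) (simp add: reduce_def)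

lemma RS_cases:
  assumes "\<rho> \<in> RS"
  obtains \<sigma> where "strategy \<sigma>" "\<rho> = reduce \<sigma>" "RV \<rho> = RV (Some \<circ> \<sigma>)"
    "\<And>v. \<rho> v = (if v \<in> Nof \<rho> then Some (\<sigma> v) else None)"
proof -
  obtain \<sigma> where "strategy \<sigma>" "\<rho> = reduce \<sigma>" using assms by (auto simp: RS_def)
  moreover have "reduce \<sigma> v = (if v \<in> Nof (reduce \<sigma>) then Some (\<sigma> v) else None)" for v
    by (simp add: Nof_def RV_reduce) (simp add: reduce_def)
  ultimately show ?thesis using that RV_reduce by blast
qed

lemma RS_choice:
  assumes "\<rho> \<in> RS" "v \<in> Nof \<rho>"
  shows "\<rho> v = Some (the (\<rho> v))" "the (\<rho> v) \<in> C v"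
proof -
  obtain \<sigma> where \<sigma>: "strategy \<sigma>" "\<And>v. \<rho> v = (if v \<in> Nof \<rho> then Some (\<sigma> v) else None)"
    using RS_cases[OF assms(1)] by metis
  then show "\<rho> v = Some (the (\<rho> v))" using assms(2) by (metis option.sel)
  show "the (\<rho> v) \<in> C v"
    using \<sigma> assms(2) by (metis IntD1 Nof_def option.sel strategy_def)
qed

lemma RS_undefined: "\<rho> \<in> RS \<Longrightarrow> v \<notin> Nof \<rho> \<Longrightarrow> \<rho> v = None"
  by (metis RS_cases)

lemma RS_RV_iff:
  assumes "\<rho> \<in> RS" "u \<in> V" "u \<noteq> r"
  shows "u \<in> RV \<rho> \<longleftrightarrow> par u \<in> RV \<rho> \<and> (par u \<in> Nset \<longrightarrow> \<rho> (par u) = Some u)"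
proof (rule RV_iff[OF _ assms(2,3)])
  fix v w assume "v \<in> Nset" "v \<in> RV \<rho>" "\<rho> v = Some w"
  then show "w \<in> C v" using RS_choice(2)[OF assms(1), of v] by (auto simp: Nof_def)
qed

lemma Nof_subset: "Nof \<rho> \<subseteq> Nset" and Aof_subset: "Aof \<rho> \<subseteq> Aset"
  by (auto simp: Nof_def Aof_def)

lemma finite_Aof: "finite (Aof \<rho>)"
  using finite_subset[OF Aof_subset finite_Aset] .

lemma root_in_Nof: "r \<in> Nof \<rho>"
  using RV_root root_infoset by (simp add: Nof_def)

lemma Aof_iff:
  assumes "\<rho> \<in> RS"
  shows "a \<in> Aof \<rho> \<longleftrightarrow> a \<in> Aset \<and> par a \<in> Nof \<rho> \<and> \<rho> (par a) = Some a"
  using RS_RV_iff[OF assms, of a] parent_of_action[of a] Aset_subset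
  by (auto simp: Aof_def Nof_def)

lemma Nof_iff:
  assumes "\<rho> \<in> RS" "v \<noteq> r"
  shows "v \<in> Nof \<rho> \<longleftrightarrow> v \<in> Nset \<and> par v \<in> Aof \<rho>"
  using RS_RV_iff[OF assms(1), of v] parent_of_non_action[of v] assms(2) Nset_subset N_A_disjoint
  by (auto simp: Aof_def Nof_def)

lemma choice_in_Aof: "\<rho> \<in> RS \<Longrightarrow> v \<in> Nof \<rho> \<Longrightarrow> the (\<rho> v) \<in> Aof \<rho>"
  using RS_choice[of \<rho> v] Nof_subset[of \<rho>] children_of_infoset[of v] Aof_iff[of \<rho> "the (\<rho> v)"]
  by (auto simp: C_iff subset_iff)

section \<open>The sampling distribution on reduced strategies\<close>

definition full_strategies :: "('v \<Rightarrow> 'v) set" where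
  "full_strategies = PiE Nset C"

lemma finite_full_strategies: "finite full_strategies"
  unfolding full_strategies_def using finite_Nset finite_C by (rule finite_PiE)

text \<open>\<open>strategy\<close> constrains only the values on \<open>Nset\<close>, so there may
  be infinitely many strategies. The extensional ones form a finite product set and have the same
  reductions.\<close>

lemma RS_eq_image: "RS = reduce ` full_strategies"
proof (intro equalityI subsetI)
  fix \<rho> assume "\<rho> \<in> RS"
  then obtain \<sigma> where \<sigma>: "strategy \<sigma>" "\<rho> = reduce \<sigma>" by (rule RS_cases)
  have "RV (Some \<circ> restrict \<sigma> Nset) = RV (Some \<circ> \<sigma>)" by (rule RV_agree) simp
  then have "reduce (restrict \<sigma> Nset) = \<rho>"
    unfolding \<sigma> by (auto simp: reduce_def restrict_map_def fun_eq_iff)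
  moreover have "restrict \<sigma> Nset \<in> full_strategies"
    using \<sigma>(1) by (auto simp: full_strategies_def strategy_def)
  ultimately show "\<rho> \<in> reduce ` full_strategies" by blast
next
  fix \<rho> assume "\<rho> \<in> reduce ` full_strategies"
  then show "\<rho> \<in> RS"
    by (auto simp: full_strategies_def RS_def strategy_def PiE_def Pi_def)
qed

lemma finite_RS: "finite RS"
  unfolding RS_eq_image using finite_full_strategies by simp

lemma RS_nonempty: "RS \<noteq> {}"
  unfolding RS_eq_image full_strategies_def using children_of_infoset_ne by (auto simp: PiE_eq_empty_iff)

text \<open>This makes each fibre of \<open>reduce\<close> a box: the choices are forced at the
  infosets of the reduced strategy and free at all others.\<close>

lemma reduce_eq_iff:
  assumes "\<rho> \<in> RS"
  shows "reduce \<sigma> = \<rho> \<longleftrightarrow> (\<forall>v\<in>Nof \<rho>. \<sigma> v = the (\<rho> v))"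
proof
  assume "reduce \<sigma> = \<rho>"
  then show "\<forall>v\<in>Nof \<rho>. \<sigma> v = the (\<rho> v)"
    by (auto simp: Nof_def RV_reduce) (simp add: reduce_def)
next
  assume a: "\<forall>v\<in>Nof \<rho>. \<sigma> v = the (\<rho> v)"
  have "RV (Some \<circ> \<sigma>) = RV \<rho>"
    by (rule RV_agree) (use a RS_choice(1)[OF assms] in \<open>auto simp: Nof_def\<close>)
  then show "reduce \<sigma> = \<rho>"
    using a RS_choice(1)[OF assms] RS_undefined[OF assms]
    by (auto simp: reduce_def restrict_map_def fun_eq_iff Nof_def)
qed

text \<open>Strict positivity keeps the logarithms of weights finite and the normalisers nonzero. It
  holds for the initial policy and survives every update.\<close>

definition policy :: "('v \<Rightarrow> real) \<Rightarrow> bool" where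
  "policy \<pi> \<longleftrightarrow> (\<forall>v\<in>Nset. (\<Sum>a\<in>C v. \<pi> a) = 1) \<and> (\<forall>a\<in>Aset. 0 < \<pi> a)"

definition weight :: "('v \<Rightarrow> real) \<Rightarrow> ('v \<rightharpoonup> 'v) \<Rightarrow> real" where
  "weight \<pi> \<rho> = (\<Prod>v\<in>Nof \<rho>. \<pi> (the (\<rho> v)))"

lemma weight_pos:
  assumes "policy \<pi>" "\<rho> \<in> RS" shows "0 < weight \<pi> \<rho>"
  unfolding weight_def using assms(1) choice_in_Aof[OF assms(2)] Aof_subset
  by (intro prod_pos ballI) (meson policy_def subsetD)

text \<open>A random reduced strategy can be obtained by reducing a full strategy all of whose
  choices are drawn independently, which turns sums over reduced strategies into sums over a
  product set.\<close>

lemma sum_RS_eq_sum_full: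
  assumes "policy \<pi>"
  shows "(\<Sum>\<rho>\<in>RS. weight \<pi> \<rho> * F \<rho>)
    = (\<Sum>\<sigma>\<in>full_strategies. (\<Prod>v\<in>Nset. \<pi> (\<sigma> v)) * F (reduce \<sigma>))"
proof -
  have "(\<Sum>\<sigma>\<in>{\<sigma>\<in>full_strategies. reduce \<sigma> = \<rho>}. (\<Prod>v\<in>Nset. \<pi> (\<sigma> v)) * F (reduce \<sigma>))
      = weight \<pi> \<rho> * F \<rho>" if \<rho>: "\<rho> \<in> RS" for \<rho>
  proof -
    let ?B = "\<lambda>v. if v \<in> Nof \<rho> then {the (\<rho> v)} else C v"
    have "{\<sigma>\<in>full_strategies. reduce \<sigma> = \<rho>} = PiE Nset ?B"
    proof (rule set_eqI)
      fix \<sigma>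
      have "(\<forall>v\<in>Nset. \<sigma> v \<in> C v) \<and> (\<forall>v\<in>Nof \<rho>. \<sigma> v = the (\<rho> v)) \<longleftrightarrow> (\<forall>v\<in>Nset. \<sigma> v \<in> ?B v)"
      proof (intro iffI conjI ballI; (elim conjE)?)
        fix v assume "\<forall>v\<in>Nset. \<sigma> v \<in> ?B v" "v \<in> Nset"
        then show "\<sigma> v \<in> C v" using RS_choice(2)[OF \<rho>, of v] by (cases "v \<in> Nof \<rho>") auto
      next
        fix v assume "\<forall>v\<in>Nset. \<sigma> v \<in> ?B v" "v \<in> Nof \<rho>"
        moreover from this(2) have "v \<in> Nset" using Nof_subset by blast
        ultimately show "\<sigma> v = the (\<rho> v)" by auto
      qed auto
      then show "\<sigma> \<in> {\<sigma>\<in>full_strategies. reduce \<sigma> = \<rho>} \<longleftrightarrow> \<sigma> \<in> PiE Nset ?B"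
        unfolding full_strategies_def PiE_iff mem_Collect_eq reduce_eq_iff[OF \<rho>] by blast
    qed
    then have "(\<Sum>\<sigma>\<in>{\<sigma>\<in>full_strategies. reduce \<sigma> = \<rho>}. (\<Prod>v\<in>Nset. \<pi> (\<sigma> v)))
        = (\<Prod>v\<in>Nset. \<Sum>a\<in>?B v. \<pi> a)"
      using finite_Nset finite_C by (subst prod_sum_PiE) auto
    also have "\<dots> = (\<Prod>v\<in>Nset. if v \<in> Nof \<rho> then \<pi> (the (\<rho> v)) else 1)"
      using assms by (intro prod.cong) (auto simp: policy_def)
    also have "\<dots> = weight \<pi> \<rho>"
      unfolding weight_def using finite_Nset Nof_subset[of \<rho>]
      by (simp add: prod.If_cases Int_absorb1 Int_def[symmetric])
    finally show ?thesis by (simp add: sum_distrib_right[symmetric])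
  qed
  then have "(\<Sum>\<rho>\<in>RS. weight \<pi> \<rho> * F \<rho>) = (\<Sum>\<rho>\<in>reduce ` full_strategies.
      \<Sum>\<sigma>\<in>{\<sigma>\<in>full_strategies. reduce \<sigma> = \<rho>}. (\<Prod>v\<in>Nset. \<pi> (\<sigma> v)) * F (reduce \<sigma>))"
    by (intro sum.cong) (auto simp: RS_eq_image)
  also have "\<dots> = (\<Sum>\<sigma>\<in>full_strategies. (\<Prod>v\<in>Nset. \<pi> (\<sigma> v)) * F (reduce \<sigma>))"
    using finite_full_strategies by (subst sum.image_gen[where g = reduce]) auto
  finally show ?thesis .
qed

lemma sum_weight:
  assumes "policy \<pi>" shows "(\<Sum>\<rho>\<in>RS. weight \<pi> \<rho>) = 1"
proof -
  have "(\<Sum>\<rho>\<in>RS. weight \<pi> \<rho>) = (\<Prod>v\<in>Nset. \<Sum>a\<in>C v. \<pi> a)"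
    using sum_RS_eq_sum_full[OF assms, of "\<lambda>_. 1"] finite_Nset finite_C
    by (simp add: full_strategies_def prod_sum_PiE)
  also have "\<dots> = 1" using assms by (simp add: policy_def)
  finally show ?thesis .
qed

section \<open>The probability of reaching an action\<close>

definition ancestor_actions :: "'v \<Rightarrow> 'v set" where
  "ancestor_actions u = {a \<in> Aset. (u, a) \<in> childR\<^sup>*}"

text \<open>The quantity q(a) of the algorithm, written as it occurs in the denominator of
  \<open>omega_core\<close>.\<close>

definition reach :: "('v \<Rightarrow> real) \<Rightarrow> 'v \<Rightarrow> real" where
  "reach \<pi> a = \<pi> a * xarg \<pi> (par a)"

lemma childR_rtrancl_step:
  assumes "u \<in> V" "u \<noteq> r" shows "(u, w) \<in> childR\<^sup>* \<longleftrightarrow> w = u \<or> (par u, w) \<in> childR\<^sup>*"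
proof -
  have "(u, par u) \<in> childR" using assms by (simp add: childR_def)
  moreover have "z = par u" if "(u, z) \<in> childR" for z using that by (simp add: childR_def)
  ultimately show ?thesis by (metis converse_rtranclE converse_rtrancl_into_rtrancl rtrancl.rtrancl_refl)
qed

text \<open>Below an action every child is visited, so only the infosets on the path to the node can
  block it. Reaching a node is therefore a conjunction of conditions on single coordinates of the
  strategy.\<close>

lemma RV_iff_ancestor_actions:
  assumes "strategy \<sigma>" "u \<in> V"
  shows "u \<in> RV (Some \<circ> \<sigma>) \<longleftrightarrow> (\<forall>a\<in>ancestor_actions u. \<sigma> (par a) = a)"
  using assms(2)
proof (induction u rule: tree_induct)
  case root
  have "(r, a) \<in> childR\<^sup>* \<Longrightarrow> a = r" for a
    by (erule converse_rtranclE) (auto simp: childR_def)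
  then show ?case
    using RV_root root_infoset N_A_disjoint by (auto simp: ancestor_actions_def)
next
  case (step u)
  have 1: "u \<in> RV (Some \<circ> \<sigma>) \<longleftrightarrow> par u \<in> RV (Some \<circ> \<sigma>) \<and> (par u \<in> Nset \<longrightarrow> \<sigma> (par u) = u)"
    using assms(1) step by (subst RV_iff) (auto simp: strategy_def)
  have 2: "ancestor_actions u = (if par u \<in> Nset then {u} else {}) \<union> ancestor_actions (par u)"
    using childR_rtrancl_step[OF step(1,2)] parent_of_action parent_of_non_action[of u] step N_A_disjoint
    by (auto simp: ancestor_actions_def)
  show ?case unfolding 1 step.IH 2 by auto
qed

lemma childR_cycle: "(u, v) \<in> childR\<^sup>* \<Longrightarrow> (v, u) \<in> childR \<Longrightarrow> False"
  using acyclic_childR by (meson acyclic_def rtrancl_into_trancl1)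

text \<open>Ancestors of a node form a chain. If two different actions in it had the same parent,
  the parent of the lower one would lie weakly below the upper one, which is a child of that parent:
  a cycle. Hence the conditions for reaching a node concern pairwise different infosets.\<close>

lemma inj_on_par_ancestor_actions: "inj_on par (ancestor_actions u)"
proof (rule inj_onI)
  have *: False if "(a, b) \<in> childR\<^sup>*" "a \<noteq> b" "par a = par b" "a \<in> Aset" "b \<in> Aset" for a b
  proof -
    have "(par a, b) \<in> childR\<^sup>*"
      using that childR_rtrancl_step[of a b] parent_of_action[of a] Aset_subset by auto
    then show False using childR_cycle parent_of_action[of b] that by (metis childR_iff)
  qed
  fix a b assume ab: "a \<in> ancestor_actions u" "b \<in> ancestor_actions u" "par a = par b"
  have "single_valued childR" by (auto simp: single_valued_def childR_def)
  then have "(a, b) \<in> childR\<^sup>* \<or> (b, a) \<in> childR\<^sup>*"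
    using single_valued_confluent[of childR u a b] ab by (auto simp: ancestor_actions_def)
  then show "a = b" using *[of a b] *[of b a] ab by (auto simp: ancestor_actions_def)
qed

lemma reach_eq_prod:
  assumes "a \<in> Aset" shows "reach \<pi> a = (\<Prod>b\<in>ancestor_actions a. \<pi> b)"
proof -
  note pa = parent_of_action[OF assms]
  have tr: "(par a, b) \<in> childR\<^sup>+ \<longleftrightarrow> (par a, b) \<in> childR\<^sup>*" if "b \<in> Aset" for b
    using that pa N_A_disjoint by (auto simp: rtrancl_eq_or_trancl)
  have "ancestor_actions a = insert a {b \<in> Aset. (par a, b) \<in> childR\<^sup>+}"
    using childR_rtrancl_step[of a] assms Aset_subset pa tr by (auto simp: ancestor_actions_def)
  moreover have "a \<notin> {b \<in> Aset. (par a, b) \<in> childR\<^sup>+}"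
    using childR_cycle[of "par a" a] pa by (auto simp: tr childR_iff)
  ultimately show ?thesis using finite_Aset by (simp add: reach_def xarg_def)
qed

text \<open>The full strategies that reach \<open>a\<close> form a box: the choice is fixed at each
  infoset above \<open>a\<close> and free elsewhere. Free coordinates sum to 1, and each fixed one
  contributes its own policy value.\<close>

lemma sum_weight_Aof:
  assumes \<pi>: "policy \<pi>" and a: "a \<in> Aset"
  shows "(\<Sum>\<rho>\<in>RS. weight \<pi> \<rho> * (if a \<in> Aof \<rho> then 1 else 0)) = reach \<pi> a"
proof -
  let ?P = "ancestor_actions a"
  let ?B = "\<lambda>v. {c \<in> C v. \<forall>b\<in>?P. par b = v \<longrightarrow> c = b}"
  have P: "b \<in> Aset" "par b \<in> Nset" "b \<in> C (par b)" if "b \<in> ?P" for b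
    using that parent_of_action by (auto simp: ancestor_actions_def)
  have finP: "finite ?P" using finite_Aset by (auto simp: ancestor_actions_def)
  have "(\<Sum>\<rho>\<in>RS. weight \<pi> \<rho> * (if a \<in> Aof \<rho> then 1 else 0))
      = (\<Sum>\<sigma>\<in>full_strategies. (\<Prod>v\<in>Nset. \<pi> (\<sigma> v)) * (if a \<in> Aof (reduce \<sigma>) then 1 else 0))"
    by (rule sum_RS_eq_sum_full[OF \<pi>])
  also have "\<dots> = (\<Sum>\<sigma>\<in>{\<sigma>\<in>full_strategies. \<forall>b\<in>?P. \<sigma> (par b) = b}. \<Prod>v\<in>Nset. \<pi> (\<sigma> v))"
  proof -
    have "a \<in> Aof (reduce \<sigma>) \<longleftrightarrow> (\<forall>b\<in>?P. \<sigma> (par b) = b)" if "\<sigma> \<in> full_strategies" for \<sigma>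
      using that RV_iff_ancestor_actions[of \<sigma> a] a Aset_subset
      by (auto simp: Aof_def RV_reduce full_strategies_def strategy_def PiE_def Pi_def)
    then show ?thesis using finite_full_strategies
      by (auto simp: sum.inter_filter intro!: sum.cong)
  qed
  also have "{\<sigma>\<in>full_strategies. \<forall>b\<in>?P. \<sigma> (par b) = b} = PiE Nset ?B"
    using P by (auto simp: full_strategies_def PiE_iff extensional_def)
  also have "(\<Sum>\<sigma>\<in>\<dots>. \<Prod>v\<in>Nset. \<pi> (\<sigma> v)) = (\<Prod>v\<in>Nset. \<Sum>c\<in>?B v. \<pi> c)"
    using finite_Nset finite_C by (subst prod_sum_PiE) auto
  also have "\<dots> = (\<Prod>v\<in>par ` ?P. \<Sum>c\<in>?B v. \<pi> c)"
  proof (rule prod.mono_neutral_right)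
    show "\<forall>v\<in>Nset - par ` ?P. (\<Sum>c\<in>?B v. \<pi> c) = 1"
    proof
      fix v assume v: "v \<in> Nset - par ` ?P"
      then have "?B v = C v" by auto
      then show "(\<Sum>c\<in>?B v. \<pi> c) = 1" using v \<pi> by (auto simp: policy_def)
    qed
  qed (use P finite_Nset in auto)
  also have "\<dots> = (\<Prod>b\<in>?P. \<Sum>c\<in>?B (par b). \<pi> c)"
    by (simp add: prod.reindex[OF inj_on_par_ancestor_actions])
  also have "\<dots> = (\<Prod>b\<in>?P. \<pi> b)"
  proof (rule prod.cong)
    fix b assume b: "b \<in> ?P"
    have "?B (par b) = {b}"
      using P[OF b] b inj_onD[OF inj_on_par_ancestor_actions] by auto
    then show "(\<Sum>c\<in>?B (par b). \<pi> c) = \<pi> b" by simp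
  qed simp
  finally show ?thesis using reach_eq_prod[OF a] by simp
qed

text \<open>Linearity of expectation. It is used with \<open>B\<close> the set of all actions and
  with \<open>B\<close> the actions of one reduced strategy.\<close>

lemma sum_weight_sum_Aof:
  assumes \<pi>: "policy \<pi>" and B: "B \<subseteq> Aset"
  shows "(\<Sum>\<rho>\<in>RS. weight \<pi> \<rho> * (\<Sum>a\<in>Aof \<rho> \<inter> B. f a)) = (\<Sum>a\<in>B. reach \<pi> a * f a)"
proof -
  have fin: "finite B" using B finite_Aset finite_subset by blast
  have "(\<Sum>a\<in>Aof \<rho> \<inter> B. f a) = (\<Sum>a\<in>B. (if a \<in> Aof \<rho> then 1 else 0) * f a)" for \<rho>
    using fin by (subst Int_commute) (auto simp: sum.inter_restrict intro!: sum.cong)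
  then have "(\<Sum>\<rho>\<in>RS. weight \<pi> \<rho> * (\<Sum>a\<in>Aof \<rho> \<inter> B. f a))
      = (\<Sum>\<rho>\<in>RS. \<Sum>a\<in>B. weight \<pi> \<rho> * (if a \<in> Aof \<rho> then 1 else 0) * f a)"
    by (simp add: sum_distrib_left mult.assoc)
  also have "\<dots> = (\<Sum>a\<in>B. (\<Sum>\<rho>\<in>RS. weight \<pi> \<rho> * (if a \<in> Aof \<rho> then 1 else 0)) * f a)"
    by (subst sum.swap) (simp add: sum_distrib_right)
  also have "\<dots> = (\<Sum>a\<in>B. reach \<pi> a * f a)"
    using B by (intro sum.cong) (auto simp: sum_weight_Aof[OF \<pi>])
  finally show ?thesis .
qed

lemma reach_pos: "policy \<pi> \<Longrightarrow> a \<in> Aset \<Longrightarrow> 0 < reach \<pi> a"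
  unfolding reach_eq_prod by (rule prod_pos) (auto simp: ancestor_actions_def policy_def)


section \<open>The policy update\<close>

lemma inj_on_par_Aof: "\<rho> \<in> RS \<Longrightarrow> inj_on par (Aof \<rho>)"
  by (rule inj_onI) (auto simp: Aof_iff)

lemma par_image_Aof:
  assumes "\<rho> \<in> RS" shows "par ` Aof \<rho> = Nof \<rho>"
proof
  show "Nof \<rho> \<subseteq> par ` Aof \<rho>"
  proof
    fix v assume v: "v \<in> Nof \<rho>"
    have "v = par (the (\<rho> v))" using RS_choice(2)[OF assms v] by (simp add: C_iff)
    then show "v \<in> par ` Aof \<rho>" using choice_in_Aof[OF assms v] by blast
  qed
qed (auto simp: Aof_iff[OF assms])

lemma choice_par: "\<rho> \<in> RS \<Longrightarrow> a \<in> Aof \<rho> \<Longrightarrow> the (\<rho> (par a)) = a"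
  by (simp add: Aof_iff)

lemma weight_eq_prod_Aof:
  assumes "\<rho> \<in> RS" shows "weight \<pi> \<rho> = (\<Prod>a\<in>Aof \<rho>. \<pi> a)"
  unfolding weight_def par_image_Aof[OF assms, symmetric] prod.reindex[OF inj_on_par_Aof[OF assms]]
  using choice_par[OF assms] by (intro prod.cong) auto

text \<open>An infoset other than the root belongs to a reduced strategy exactly when its parent
  action does, so the common infosets hang below the common actions. The case of equal strategies
  describes the infosets of a single one.\<close>

lemma overlap_infosets:
  assumes "\<rho> \<in> RS" "\<rho>' \<in> RS"
  shows "Nof \<rho> \<inter> Nof \<rho>' = insert r (\<Union>a\<in>Aof \<rho> \<inter> Aof \<rho>'. C a \<inter> Nset)"
proof (rule set_eqI)
  fix v
  show "v \<in> Nof \<rho> \<inter> Nof \<rho>' \<longleftrightarrow> v \<in> insert r (\<Union>a\<in>Aof \<rho> \<inter> Aof \<rho>'. C a \<inter> Nset)"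
    using Nof_iff[OF assms(1), of v] Nof_iff[OF assms(2), of v] root_in_Nof Nset_subset
    by (cases "v = r") (auto simp: C_iff)
qed

lemma prod_overlap_infosets:
  assumes "\<rho> \<in> RS" "\<rho>' \<in> RS"
  shows "(\<Prod>v\<in>Nof \<rho> \<inter> Nof \<rho>'. g v) = g r * (\<Prod>a\<in>Aof \<rho> \<inter> Aof \<rho>'. \<Prod>u\<in>C a \<inter> Nset. g u)"
proof -
  have "r \<notin> (\<Union>a\<in>Aof \<rho> \<inter> Aof \<rho>'. C a \<inter> Nset)" by (auto simp: C_iff)
  moreover have "(\<Prod>v\<in>(\<Union>a\<in>Aof \<rho> \<inter> Aof \<rho>'. C a \<inter> Nset). g v)
      = (\<Prod>a\<in>Aof \<rho> \<inter> Aof \<rho>'. \<Prod>u\<in>C a \<inter> Nset. g u)"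
    using finite_Aof finite_C by (subst prod.UNION_disjoint) (auto simp: C_iff)
  ultimately show ?thesis
    unfolding overlap_infosets[OF assms] using finite_Aof finite_C by (subst prod.insert) auto
qed

lemma sum_infosets:
  assumes "\<rho> \<in> RS"
  shows "(\<Sum>v\<in>Nof \<rho>. g v) = g r + (\<Sum>a\<in>Aof \<rho>. \<Sum>u\<in>C a \<inter> Nset. g u)"
proof -
  have "r \<notin> (\<Union>a\<in>Aof \<rho>. C a \<inter> Nset)" by (auto simp: C_iff)
  moreover have "(\<Sum>v\<in>(\<Union>a\<in>Aof \<rho>. C a \<inter> Nset). g v) = (\<Sum>a\<in>Aof \<rho>. \<Sum>u\<in>C a \<inter> Nset. g u)"
    using finite_Aof finite_C by (subst sum.UNION_disjoint) (auto simp: C_iff)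
  moreover have "Nof \<rho> = insert r (\<Union>a\<in>Aof \<rho>. C a \<inter> Nset)"
    using overlap_infosets[OF assms assms] by simp
  ultimately show ?thesis using finite_Aof finite_C by (simp add: sum.insert)
qed

text \<open>A conserved flow with one unit entering at the root. The action \<open>a\<close>
  receives 1 / beta (par a) = m a / beta a, keeps 1 / beta a, and passes m u / beta a = 1 / beta u
  to each infoset \<open>u\<close> below it, which exhausts the rest. The amounts kept add up to the
  unit.\<close>

lemma sum_inverse_beta:
  assumes "\<rho> \<in> RS" shows "(\<Sum>a\<in>Aof \<rho>. 1 / beta a) = 1"
proof -
  have "(\<Sum>a\<in>Aof \<rho>. real (m a) / beta a) = (\<Sum>a\<in>Aof \<rho>. 1 / beta (par a))"
    using beta_pos m_pos Aof_subset by (intro sum.cong) (force simp: beta_action)+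
  also have "\<dots> = (\<Sum>v\<in>Nof \<rho>. 1 / beta v)"
    unfolding par_image_Aof[OF assms, symmetric] by (simp add: sum.reindex[OF inj_on_par_Aof[OF assms]])
  also have "\<dots> = 1 + (\<Sum>a\<in>Aof \<rho>. \<Sum>u\<in>C a \<inter> Nset. 1 / beta u)"
    using sum_infosets[OF assms, of "\<lambda>v. 1 / beta v"] by (simp add: beta_root)
  also have "(\<Sum>a\<in>Aof \<rho>. \<Sum>u\<in>C a \<inter> Nset. 1 / beta u) = (\<Sum>a\<in>Aof \<rho>. (real (m a) - 1) / beta a)"
  proof (rule sum.cong)
    fix a assume a: "a \<in> Aof \<rho>"
    have "(\<Sum>u\<in>C a \<inter> Nset. 1 / beta u) = (\<Sum>u\<in>C a \<inter> Nset. real (m u) / beta a)"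
      by (intro sum.cong) (auto simp: beta_infoset C_iff)
    also have "\<dots> = (real (m a) - 1) / beta a"
      using a Aof_subset by (subst m_action) (auto simp: sum_divide_distrib)
    finally show "(\<Sum>u\<in>C a \<inter> Nset. 1 / beta u) = (real (m a) - 1) / beta a" .
  qed simp
  finally show ?thesis by (simp add: diff_divide_distrib sum_subtractf)
qed

lemma policy_pi1: "policy pi1"
  unfolding policy_def
proof (intro conjI ballI)
  fix v assume v: "v \<in> Nset"
  have "(\<Sum>a\<in>C v. pi1 a) = (\<Sum>a\<in>C v. real (n a) / real (n v))"
    using children_of_infoset[OF v] by (intro sum.cong) (auto simp: pi1_def C_iff)
  also have "\<dots> = real (n v) / real (n v)"
    unfolding sum_divide_distrib[symmetric] by (simp add: n_infoset[OF v])
  finally show "(\<Sum>a\<in>C v. pi1 a) = 1" using n_pos[of v] v by simp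
next
  fix a assume "a \<in> Aset"
  then show "0 < pi1 a" using n_pos parent_of_action[of a] by (simp add: pi1_def)
qed

text \<open>The product telescopes: the numerator \<open>n a\<close> is the product of
  \<open>n u\<close> over the infosets below \<open>a\<close>, and these are the denominators at all
  infosets except the root.\<close>

lemma weight_pi1:
  assumes "\<rho> \<in> RS" shows "weight pi1 \<rho> = 1 / real (n r)"
proof -
  have "weight pi1 \<rho> = (\<Prod>a\<in>Aof \<rho>. real (n a)) / (\<Prod>a\<in>Aof \<rho>. real (n (par a)))"
    unfolding weight_eq_prod_Aof[OF assms] prod_dividef[symmetric] using Aof_subset
    by (intro prod.cong) (auto simp: pi1_def)
  also have "(\<Prod>a\<in>Aof \<rho>. real (n (par a))) = (\<Prod>v\<in>Nof \<rho>. real (n v))"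
    unfolding par_image_Aof[OF assms, symmetric] by (simp add: prod.reindex[OF inj_on_par_Aof[OF assms]])
  also have "\<dots> = real (n r) * (\<Prod>a\<in>Aof \<rho>. \<Prod>u\<in>C a \<inter> Nset. real (n u))"
    using prod_overlap_infosets[OF assms assms, of "\<lambda>v. real (n v)"] by simp
  also have "(\<Prod>a\<in>Aof \<rho>. \<Prod>u\<in>C a \<inter> Nset. real (n u)) = (\<Prod>a\<in>Aof \<rho>. real (n a))"
    using Aof_subset by (intro prod.cong) (auto simp: n_action subset_iff)
  finally show ?thesis
    using n_pos Aof_subset finite_Aof by (force simp: prod_zero_iff)
qed

text \<open>Counting through the distribution: equal weights \<open>1 / n r\<close> that sum to
  1.\<close>

lemma card_RS: "card RS = n r"
proof -
  have "1 = real (card RS) / real (n r)"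
    using sum_weight[OF policy_pi1] by (simp add: weight_pi1)
  then show ?thesis using n_root_ge_2 by (simp add: field_simps)
qed

section \<open>The update as a multiplicative-weights step\<close>

definition den :: "nat \<Rightarrow> real \<Rightarrow> ('v \<Rightarrow> real) \<Rightarrow> 'v \<Rightarrow> real" where
  "den T eps \<pi> a = gamma T eps * beta a + reach \<pi> a"

text \<open>Recursive calls go two levels down, from an infoset to the infosets below its chosen
  action, hence the transitive closure of \<open>childR\<close> as recursion relation. That these
  arguments really lie below \<open>v\<close> holds because a strategy in \<open>RS\<close> chooses
  children.\<close>

lemma psi_rec:
  assumes "\<rho> \<in> RS" "v \<in> Nof \<rho>"
  shows "psi T eps \<pi> \<rho> d v = 1 - (1 - omega T eps \<pi> \<rho> d v) * \<pi> (the (\<rho> v))"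
proof -
  let ?H = "\<lambda>f v. 1 - (1 - omega_core T eps \<pi> \<rho> d f v) * \<pi> (the (\<rho> v))"
  have "psi T eps \<pi> \<rho> d v = ?H (cut (psi T eps \<pi> \<rho> d) (childR\<^sup>+) v) v"
    unfolding psi_def by (subst wfrec[OF wf_trancl[OF wf_childR]]) simp
  also have "omega_core T eps \<pi> \<rho> d (cut (psi T eps \<pi> \<rho> d) (childR\<^sup>+) v) v = omega T eps \<pi> \<rho> d v"
    unfolding omega_def omega_core_def Let_def
  proof (intro arg_cong2[of _ _ _ _ "(*)"] prod.cong refl)
    fix u assume "u \<in> C (the (\<rho> v)) \<inter> Nset"
    then have "(u, v) \<in> childR\<^sup>+"
      using RS_choice(2)[OF assms] by (meson IntD1 childR_iff trancl.r_into_trancl trancl.trancl_into_trancl)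
    then show "cut (psi T eps \<pi> \<rho> d) (childR\<^sup>+) v u = psi T eps \<pi> \<rho> d u" by (rule cut_apply)
  qed
  finally show ?thesis .
qed

lemma omega_par:
  assumes "\<rho> \<in> RS" "a \<in> Aof \<rho>"
  shows "omega T eps \<pi> \<rho> d (par a)
    = exp (- (eta T eps * d a / den T eps \<pi> a)) * (\<Prod>u\<in>C a \<inter> Nset. psi T eps \<pi> \<rho> d u)"
  unfolding omega_def omega_core_def Let_def choice_par[OF assms] den_def reach_def by simp

lemma omega_choice:
  assumes "\<rho> \<in> RS" "v \<in> Nof \<rho>"
  shows "omega T eps \<pi> \<rho> d v = exp (- (eta T eps * d (the (\<rho> v)) / den T eps \<pi> (the (\<rho> v))))
    * (\<Prod>u\<in>C (the (\<rho> v)) \<inter> Nset. psi T eps \<pi> \<rho> d u)"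
  using omega_par[OF assms(1) choice_in_Aof[OF assms], of T eps \<pi> d] RS_choice(2)[OF assms]
  by (simp add: C_iff)

lemma policy_le_1:
  assumes "policy \<pi>" "a \<in> Aset" shows "\<pi> a \<le> 1"
proof -
  note pa = parent_of_action[OF assms(2)]
  have "\<pi> a \<le> (\<Sum>b\<in>C (par a). \<pi> b)"
    using assms(1) pa children_of_infoset[OF pa(2)] finite_C
    by (intro member_le_sum) (auto simp: policy_def intro: less_imp_le)
  then show ?thesis using assms(1) pa by (auto simp: policy_def)
qed

lemma weight_le_1:
  assumes "policy \<pi>" "\<rho> \<in> RS" shows "weight \<pi> \<rho> \<le> 1"
  unfolding weight_eq_prod_Aof[OF assms(2)] using assms(1) Aof_subset policy_le_1
  by (intro prod_le_1) (auto simp: policy_def subset_iff intro: less_imp_le)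

text \<open>\<open>psi\<close> is a convex combination of 1 and \<open>omega\<close> with
  coefficient at most 1 on \<open>omega\<close>, and \<open>omega\<close> is an exponential times
  values of \<open>psi\<close> further down.\<close>

lemma psi_pos:
  assumes \<pi>: "policy \<pi>" and \<rho>: "\<rho> \<in> RS"
  shows "v \<in> Nof \<rho> \<Longrightarrow> 0 < psi T eps \<pi> \<rho> d v \<and> 0 < omega T eps \<pi> \<rho> d v"
proof (induction v rule: wf_induct_rule[OF wf_trancl[OF wf_childR]])
  case (1 v)
  let ?b = "the (\<rho> v)"
  note b = choice_in_Aof[OF \<rho> 1(2)] and bC = RS_choice(2)[OF \<rho> 1(2)]
  have bA: "?b \<in> Aset" using b Aof_subset by auto
  have "0 < psi T eps \<pi> \<rho> d u" if "u \<in> C ?b \<inter> Nset" for u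
  proof -
    have "(u, v) \<in> childR\<^sup>+"
      using that bC by (meson IntD1 childR_iff trancl.r_into_trancl trancl.trancl_into_trancl)
    moreover have "u \<in> Nof \<rho>" using that b Nof_iff[OF \<rho>, of u] by (auto simp: C_iff)
    ultimately show ?thesis using 1 by auto
  qed
  then have om: "0 < omega T eps \<pi> \<rho> d v"
    unfolding omega_choice[OF \<rho> 1(2)] by (intro mult_pos_pos prod_pos) auto
  have "psi T eps \<pi> \<rho> d v = (1 - \<pi> ?b) + omega T eps \<pi> \<rho> d v * \<pi> ?b"
    unfolding psi_rec[OF \<rho> 1(2)] by (simp add: algebra_simps)
  also have "\<dots> > 0"
    using om \<pi> policy_le_1[OF \<pi> bA] bA by (intro add_nonneg_pos) (auto simp: policy_def)
  finally show ?case using om by simp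
qed

lemma policy_update:
  assumes \<pi>: "policy \<pi>" and \<rho>: "\<rho> \<in> RS"
  shows "policy (update T eps \<pi> \<rho> d)"
  unfolding policy_def
proof (intro conjI ballI)
  fix a assume "a \<in> Aset"
  then show "0 < update T eps \<pi> \<rho> d a"
    using \<pi> psi_pos[OF \<pi> \<rho>] by (auto simp: update_def policy_def)
next
  fix v assume v: "v \<in> Nset"
  have upd: "update T eps \<pi> \<rho> d a = (if v \<in> Nof \<rho> then
        (if a = the (\<rho> v) then omega T eps \<pi> \<rho> d v * \<pi> a else \<pi> a) / psi T eps \<pi> \<rho> d v else \<pi> a)"
    if "a \<in> C v" for a
    using that children_of_infoset[OF v] by (auto simp: update_def C_iff)
  have sum1: "(\<Sum>a\<in>C v. \<pi> a) = 1" using \<pi> v by (simp add: policy_def)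
  show "(\<Sum>a\<in>C v. update T eps \<pi> \<rho> d a) = 1"
  proof (cases "v \<in> Nof \<rho>")
    case True
    let ?b = "the (\<rho> v)"
    note bC = RS_choice(2)[OF \<rho> True]
    have "(\<Sum>a\<in>C v. if a = ?b then omega T eps \<pi> \<rho> d v * \<pi> a else \<pi> a)
        = omega T eps \<pi> \<rho> d v * \<pi> ?b + (\<Sum>a\<in>C v - {?b}. \<pi> a)"
      using bC finite_C by (subst sum.remove[OF _ bC]) (auto intro!: sum.cong)
    also have "(\<Sum>a\<in>C v - {?b}. \<pi> a) = 1 - \<pi> ?b"
      using bC finite_C sum1 by (simp add: sum_diff1)
    also have "omega T eps \<pi> \<rho> d v * \<pi> ?b + (1 - \<pi> ?b) = psi T eps \<pi> \<rho> d v"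
      unfolding psi_rec[OF \<rho> True] by (simp add: algebra_simps)
    finally have "(\<Sum>a\<in>C v. update T eps \<pi> \<rho> d a) = psi T eps \<pi> \<rho> d v / psi T eps \<pi> \<rho> d v"
      using True by (simp add: upd sum_divide_distrib[symmetric])
    then show ?thesis using psi_pos[OF \<pi> \<rho> True, of T eps d] by simp
  qed (simp add: upd sum1)
qed

text \<open>X of the overview: an importance-weighted loss estimate for the second strategy, with
  the enlarged \<open>den\<close> in place of q(a). Actions outside the sampled strategy count as
  0.\<close>

definition est :: "nat \<Rightarrow> real \<Rightarrow> ('v \<Rightarrow> real) \<Rightarrow> ('v \<rightharpoonup> 'v) \<Rightarrow> ('v \<Rightarrow> real) \<Rightarrow> ('v \<rightharpoonup> 'v) \<Rightarrow> real" where
  "est T eps \<pi> \<rho> d \<rho>' = (\<Sum>a\<in>Aof \<rho> \<inter> Aof \<rho>'. d a / den T eps \<pi> a)"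

text \<open>On reduced strategies the local updates amount to one multiplicative-weights step.\<close>

lemma weight_update:
  assumes \<pi>: "policy \<pi>" and \<rho>: "\<rho> \<in> RS" and \<rho>': "\<rho>' \<in> RS"
  shows "weight (update T eps \<pi> \<rho> d) \<rho>'
    = weight \<pi> \<rho>' * exp (- eta T eps * est T eps \<pi> \<rho> d \<rho>') / psi T eps \<pi> \<rho> d r"
proof -
  let ?om = "omega T eps \<pi> \<rho> d" and ?ps = "psi T eps \<pi> \<rho> d"
  let ?B = "{a \<in> Aof \<rho>'. par a \<in> Nof \<rho>}" and ?A = "Aof \<rho> \<inter> Aof \<rho>'"
  let ?F = "\<lambda>a. if par a \<in> Nof \<rho> then (if a \<in> Aof \<rho> then ?om (par a) else 1) / ?ps (par a) else 1"
  have A: "?A = {a \<in> ?B. a \<in> Aof \<rho>}" using Aof_iff[OF \<rho>] by auto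
  have "update T eps \<pi> \<rho> d a = \<pi> a * ?F a" if a: "a \<in> Aof \<rho>'" for a
  proof -
    have aA: "a \<in> Aset" using a Aof_subset by auto
    have "a \<in> Aof \<rho> \<longleftrightarrow> a = the (\<rho> (par a))" if "par a \<in> Nof \<rho>"
      using that Aof_iff[OF \<rho>, of a] RS_choice(1)[OF \<rho> that] aA by (metis option.sel)
    then show ?thesis using aA by (auto simp: update_def)
  qed
  then have "weight (update T eps \<pi> \<rho> d) \<rho>' = weight \<pi> \<rho>' * (\<Prod>a\<in>Aof \<rho>'. ?F a)"
    unfolding weight_eq_prod_Aof[OF \<rho>'] by (simp add: prod.distrib[symmetric])
  \<comment> \<open>Only infosets visited by both strategies matter: each contributes a division by
    \<open>psi\<close>, and a factor \<open>omega\<close> if both strategies choose the same action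
    there.\<close>
  also have "(\<Prod>a\<in>Aof \<rho>'. ?F a) = (\<Prod>a\<in>?B. (if a \<in> Aof \<rho> then ?om (par a) else 1) / ?ps (par a))"
    using finite_Aof by (subst prod.inter_filter) auto
  also have "\<dots> = (\<Prod>a\<in>?A. ?om (par a)) / (\<Prod>a\<in>?B. ?ps (par a))"
    unfolding prod_dividef A using finite_Aof by (subst prod.inter_filter) auto
  also have "(\<Prod>a\<in>?B. ?ps (par a)) = (\<Prod>v\<in>par ` ?B. ?ps v)"
    using inj_on_subset[OF inj_on_par_Aof[OF \<rho>'], of ?B] by (subst prod.reindex) auto
  also have "par ` ?B = Nof \<rho> \<inter> Nof \<rho>'"
    unfolding par_image_Aof[OF \<rho>', symmetric] by auto
  also have "(\<Prod>v\<in>Nof \<rho> \<inter> Nof \<rho>'. ?ps v) = ?ps r * (\<Prod>a\<in>?A. \<Prod>u\<in>C a \<inter> Nset. ?ps u)"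
    by (rule prod_overlap_infosets[OF \<rho> \<rho>'])
  \<comment> \<open>The \<open>psi\<close> factors inside \<open>omega\<close> belong to the
    infosets below common actions. They cancel every denominator except \<open>psi\<close> at the
    root.\<close>
  also have "(\<Prod>a\<in>?A. ?om (par a))
      = exp (- eta T eps * est T eps \<pi> \<rho> d \<rho>') * (\<Prod>a\<in>?A. \<Prod>u\<in>C a \<inter> Nset. ?ps u)"
  proof -
    have "exp (- eta T eps * est T eps \<pi> \<rho> d \<rho>') = (\<Prod>a\<in>?A. exp (- (eta T eps * d a / den T eps \<pi> a)))"
      using finite_Aof by (simp add: est_def sum_distrib_left exp_sum sum_negf[symmetric])
    moreover have "(\<Prod>a\<in>?A. ?om (par a)) = (\<Prod>a\<in>?A. exp (- (eta T eps * d a / den T eps \<pi> a))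
        * (\<Prod>u\<in>C a \<inter> Nset. ?ps u))"
      by (intro prod.cong) (auto simp: omega_par[OF \<rho>])
    ultimately show ?thesis by (simp add: prod.distrib)
  qed
  moreover have "(\<Prod>a\<in>?A. \<Prod>u\<in>C a \<inter> Nset. ?ps u) \<noteq> 0"
  proof -
    have "?ps u > 0" if "a \<in> ?A" "u \<in> C a \<inter> Nset" for a u
      using that Nof_iff[OF \<rho>, of u] by (intro conjunct1[OF psi_pos[OF \<pi> \<rho>]]) (auto simp: C_iff)
    then show ?thesis using finite_Aof finite_C by (force simp: prod_zero_iff)
  qed
  ultimately show ?thesis by simp
qed

text \<open>The updated policy is again a policy, so its weights sum to 1; this forces the one
  remaining denominator to be the normaliser of the multiplicative-weights step.\<close>

lemma psi_root:
  assumes \<pi>: "policy \<pi>" and \<rho>: "\<rho> \<in> RS"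
  shows "psi T eps \<pi> \<rho> d r = (\<Sum>\<rho>'\<in>RS. weight \<pi> \<rho>' * exp (- eta T eps * est T eps \<pi> \<rho> d \<rho>'))"
proof -
  have "1 = (\<Sum>\<rho>'\<in>RS. weight \<pi> \<rho>' * exp (- eta T eps * est T eps \<pi> \<rho> d \<rho>')) / psi T eps \<pi> \<rho> d r"
    using sum_weight[OF policy_update[OF \<pi> \<rho>, of T eps d]] weight_update[OF \<pi> \<rho>, of _ T eps d]
    by (simp add: sum_divide_distrib)
  then show ?thesis using psi_pos[OF \<pi> \<rho> root_in_Nof, of T eps d] by (simp add: field_simps)
qed

section \<open>Plays\<close>

text \<open>The environment's counterpart of \<open>RV\<close>: the nodes that \<open>\<mu>\<close>
  allows when all choices at infosets are left open. It lets the path of play be separated into a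
  condition on the strategy and a condition on the environment.\<close>

definition consistent :: "('v \<Rightarrow> 'v) \<Rightarrow> 'v set" where
  "consistent \<mu> = {u \<in> V. \<forall>w. (u, w) \<in> childR\<^sup>* \<longrightarrow> w \<noteq> r \<longrightarrow> par w \<in> Aset \<longrightarrow> \<mu> (par w) = w}"

lemma root_consistent: "r \<in> consistent \<mu>"
proof -
  have "(r, a) \<in> childR\<^sup>* \<Longrightarrow> a = r" for a
    by (erule converse_rtranclE) (auto simp: childR_def)
  then show ?thesis using root_in by (auto simp: consistent_def)
qed

lemma consistent_iff:
  assumes "u \<in> V" "u \<noteq> r"
  shows "u \<in> consistent \<mu> \<longleftrightarrow> par u \<in> consistent \<mu> \<and> (par u \<in> Aset \<longrightarrow> \<mu> (par u) = u)"
  using childR_rtrancl_step[OF assms] par_in[OF assms] assms by (auto simp: consistent_def)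

lemma consistent_action: "a \<in> Aset \<Longrightarrow> a \<in> consistent \<mu> \<longleftrightarrow> par a \<in> consistent \<mu>"
  using consistent_iff[of a \<mu>] parent_of_action[of a] Aset_subset N_A_disjoint by auto

lemma play_path_eq:
  assumes \<rho>: "\<rho> \<in> RS" and \<mu>: "environment \<mu>"
  shows "play_path \<rho> \<mu> = RV \<rho> \<inter> consistent \<mu>"
proof
  show "play_path \<rho> \<mu> \<subseteq> RV \<rho> \<inter> consistent \<mu>"
    unfolding play_path_def
  proof (rule Inter_lower, safe)
    show "r \<in> RV \<rho>" "r \<in> consistent \<mu>" by (rule RV_root root_consistent)+
  next
    fix v w assume v: "v \<in> Nset" "v \<in> RV \<rho>" "v \<in> consistent \<mu>" "\<rho> v = Some w"
    then show "w \<in> RV \<rho>" by (meson RV_infoset)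
    have "w \<in> C v" using RS_choice(2)[OF \<rho>, of v] v by (simp add: Nof_def)
    then show "w \<in> consistent \<mu>"
      using v consistent_iff[of w \<mu>] N_A_disjoint by (auto simp: C_iff)
  next
    fix a assume a: "a \<in> Aset" "a \<in> RV \<rho>" "a \<in> consistent \<mu>"
    have "\<mu> a \<in> C a" using a \<mu> by (simp add: environment_def)
    then show "\<mu> a \<in> RV \<rho>" "\<mu> a \<in> consistent \<mu>"
      using a RV_action[of a \<rho>] consistent_iff[of "\<mu> a" \<mu>] by (blast, auto simp: C_iff)
  qed
  show "RV \<rho> \<inter> consistent \<mu> \<subseteq> play_path \<rho> \<mu>"
    unfolding play_path_def
  proof (intro subsetI InterI)
    fix u X assume u: "u \<in> RV \<rho> \<inter> consistent \<mu>"
      and X: "X \<in> {X. r \<in> X \<and> (\<forall>v\<in>Nset \<inter> X. \<forall>w. \<rho> v = Some w \<longrightarrow> w \<in> X) \<and> (\<forall>a\<in>Aset \<inter> X. \<mu> a \<in> X)}"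
    have "u \<in> V" using u by (simp add: consistent_def)
    then show "u \<in> X" using u
    proof (induction u rule: tree_induct)
      case root
      then show ?case using X by simp
    next
      case (step u)
      have *: "par u \<in> RV \<rho>" "par u \<in> Nset \<longrightarrow> \<rho> (par u) = Some u"
        "par u \<in> consistent \<mu>" "par u \<in> Aset \<longrightarrow> \<mu> (par u) = u"
        using RS_RV_iff[OF \<rho>, of u] consistent_iff[of u \<mu>] step by auto
      then have "par u \<in> X" using step by simp
      moreover have "par u \<in> Nset \<union> Aset"
        using parent_of_action[of u] parent_of_non_action[of u] step by auto
      moreover have "u \<in> X" if "par u \<in> Nset" "par u \<in> X"
        using X that *(2) by blast
      moreover have "u \<in> X" if "par u \<in> Aset" "par u \<in> X"
      proof -
        have "\<mu> (par u) \<in> X" using X that by blast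
        then show ?thesis using *(4) that by simp
      qed
      ultimately show ?case by blast
    qed
  qed
qed

text \<open>Existence: every internal node of the path has a child on the path, so a descent ends in
  a leaf. Uniqueness: every path node turns out to be an ancestor of each leaf on the path, and a
  leaf is an ancestor of nothing but itself.\<close>

lemma ex1_leaf_on_path:
  assumes \<rho>: "\<rho> \<in> RS" and \<mu>: "environment \<mu>"
  shows "\<exists>!u. u \<in> leaves \<and> u \<in> play_path \<rho> \<mu>"
proof -
  let ?Q = "play_path \<rho> \<mu>"
  have QV: "?Q \<subseteq> V" unfolding play_path_eq[OF assms] by (auto simp: consistent_def)
  have rQ: "r \<in> ?Q" by (auto simp: play_path_def)
  have QN: "the (\<rho> v) \<in> ?Q \<and> the (\<rho> v) \<in> C v" if "v \<in> ?Q" "v \<in> Nset" for v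
  proof -
    have "v \<in> Nof \<rho>" using that unfolding play_path_eq[OF assms] by (simp add: Nof_def)
    from RS_choice[OF \<rho> this] show ?thesis using that by (auto simp: play_path_def)
  qed
  have QA: "\<mu> a \<in> ?Q \<and> \<mu> a \<in> C a" if "a \<in> ?Q" "a \<in> Aset" for a
    using that \<mu> by (auto simp: play_path_def environment_def)
  have Qpar: "par u \<in> ?Q" "par u \<in> Nset \<Longrightarrow> \<rho> (par u) = Some u" "par u \<in> Aset \<Longrightarrow> \<mu> (par u) = u"
    if "u \<in> ?Q" "u \<noteq> r" for u
    using that QV RS_RV_iff[OF \<rho>, of u] consistent_iff[of u \<mu>] unfolding play_path_eq[OF assms] by auto
  have "\<exists>w. w \<in> leaves \<and> w \<in> ?Q" if "u \<in> ?Q" for u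
    using that
  proof (induction u rule: wf_induct_rule[OF wf_childR])
    case (1 u)
    then show ?case using QN[of u] QA[of u] QV internal_nodes by (auto simp: childR_iff)
  qed
  then obtain u where u: "u \<in> leaves" "u \<in> ?Q" using rQ by blast
  have anc: "(x, y) \<in> childR\<^sup>*" if x: "x \<in> leaves" "x \<in> ?Q" and y: "y \<in> ?Q" for x y
  proof -
    have "y \<in> V" using QV y by auto
    then show ?thesis using y
    proof (induction y rule: tree_induct)
      case root
      have "x \<in> V" using x by (auto simp: leaves_def)
      then show ?case
      proof (induction x rule: tree_induct)
        case (step x)
        then show ?case using childR_rtrancl_step by blast
      qed simp
    next
      case (step y)
      note py = Qpar[OF step.prems step(2)]
      have "(x, par y) \<in> childR\<^sup>*" using step py by auto
      moreover have "x \<noteq> par y"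
        using x step by (auto simp: leaves_def C_def)
      \<comment> \<open>\<open>c\<close> is the child of \<open>par y\<close> in the direction of
        \<open>x\<close>. It lies on the path like \<open>y\<close>, and the strategy or the
        environment allows only one child of \<open>par y\<close> there.\<close>
      ultimately obtain c where c: "(x, c) \<in> childR\<^sup>*" "(c, par y) \<in> childR"
        by (meson rtranclE)
      have cQ: "c \<in> ?Q" using c(1) x(2)
      proof (induction rule: converse_rtrancl_induct)
        case (step a b)
        then show ?case using Qpar(1)[of a] by (auto simp: childR_def)
      qed
      have "par c = par y" "c \<noteq> r" using c by (auto simp: childR_def)
      moreover have "par y \<in> Nset \<union> Aset"
        using parent_of_action[of y] parent_of_non_action[of y] step by auto
      ultimately have "c = y" using Qpar[OF cQ] py by auto
      then show ?case using c by simp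
    qed
  qed
  have "x = y" if "x \<in> leaves \<and> x \<in> ?Q" "y \<in> leaves \<and> y \<in> ?Q" for x y
  proof (rule ccontr)
    assume "x \<noteq> y"
    moreover have "(x, y) \<in> childR\<^sup>*" using anc that by blast
    ultimately obtain c where "(c, y) \<in> childR" by (meson rtranclE)
    then show False using that by (auto simp: childR_iff leaves_def)
  qed
  then show ?thesis using u by blast
qed

section \<open>The leaf reached, and losses as sums over actions\<close>

lemma leaf_reached:
  assumes "\<rho> \<in> RS" "environment \<mu>"
  shows "leaf_reached \<rho> \<mu> \<in> leaves" "leaf_reached \<rho> \<mu> \<in> RV \<rho> \<inter> consistent \<mu>"
    "\<And>u. u \<in> leaves \<Longrightarrow> u \<in> RV \<rho> \<inter> consistent \<mu> \<Longrightarrow> u = leaf_reached \<rho> \<mu>"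
  using theI'[OF ex1_leaf_on_path[OF assms]] ex1_leaf_on_path[OF assms]
  unfolding leaf_reached_def play_path_eq[OF assms] by auto

text \<open>A per-action loss that depends on the environment alone: an action can end a play only
  if it is consistent and \<open>\<mu>\<close> sends it to a leaf. This independence of the sampled
  strategy is what allows averaging over strategies action by action.\<close>

definition leaf_loss :: "('v \<Rightarrow> real) \<Rightarrow> ('v \<Rightarrow> 'v) \<Rightarrow> 'v \<Rightarrow> real" where
  "leaf_loss lam \<mu> a = (if a \<in> consistent \<mu> \<and> \<mu> a \<in> leaves then lam (\<mu> a) else 0)"

lemma last_action_in_Aof:
  assumes \<rho>: "\<rho> \<in> RS" and \<mu>: "environment \<mu>"
  shows "last_action \<rho> \<mu> \<in> Aof \<rho>"
    and "last_action \<rho> \<mu> \<in> consistent \<mu>" "\<mu> (last_action \<rho> \<mu>) = leaf_reached \<rho> \<mu>"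
proof -
  note l = leaf_reached[OF assms]
  have lV: "leaf_reached \<rho> \<mu> \<in> V" "leaf_reached \<rho> \<mu> \<notin> Aset" "leaf_reached \<rho> \<mu> \<noteq> r"
    using l(1) internal_nodes root_infoset by (auto simp: leaves_def)
  then show "last_action \<rho> \<mu> \<in> Aof \<rho>" "last_action \<rho> \<mu> \<in> consistent \<mu>"
    "\<mu> (last_action \<rho> \<mu>) = leaf_reached \<rho> \<mu>"
    using parent_of_non_action[OF lV] RS_RV_iff[OF \<rho> lV(1,3)] consistent_iff[OF lV(1,3), of \<mu>] l(2)
    by (auto simp: last_action_def Aof_def)
qed

lemma leaf_loss_eq:
  assumes \<rho>: "\<rho> \<in> RS" and \<mu>: "environment \<mu>" and a: "a \<in> Aof \<rho>"
  shows "leaf_loss lam \<mu> a = (if a = last_action \<rho> \<mu> then Loss lam \<rho> \<mu> else 0)"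
proof (cases "a = last_action \<rho> \<mu>")
  case True
  then show ?thesis using last_action_in_Aof[OF \<rho> \<mu>] leaf_reached(1)[OF \<rho> \<mu>]
    by (simp add: leaf_loss_def Loss_def)
next
  case False
  have "a = last_action \<rho> \<mu>" if "a \<in> consistent \<mu>" "\<mu> a \<in> leaves"
  proof -
    have aA: "a \<in> Aset" "a \<in> RV \<rho>" using a by (auto simp: Aof_def)
    have c: "\<mu> a \<in> C a" using \<mu> aA by (simp add: environment_def)
    then have "\<mu> a \<in> RV \<rho> \<inter> consistent \<mu>"
      using RV_action[OF aA] consistent_iff[of "\<mu> a" \<mu>] that by (auto simp: C_iff)
    then have "\<mu> a = leaf_reached \<rho> \<mu>" using leaf_reached(3)[OF \<rho> \<mu>] that by blast
    then show ?thesis using c by (auto simp: last_action_def C_iff)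
  qed
  then show ?thesis using False by (auto simp: leaf_loss_def)
qed

lemma Loss_eq_sum:
  assumes \<rho>: "\<rho> \<in> RS" and \<mu>: "environment \<mu>"
  shows "Loss lam \<rho> \<mu> = (\<Sum>a\<in>Aof \<rho>. leaf_loss lam \<mu> a)"
  using last_action_in_Aof(1)[OF \<rho> \<mu>] finite_Aof by (simp add: leaf_loss_eq[OF \<rho> \<mu>])

text \<open>A flow dual to that of \<open>sum_inverse_beta\<close>. The infoset \<open>v\<close>
  carries m v * beta v, which is the sum of \<open>beta\<close> over all its actions. An action
  hands its whole amount to the single infoset chosen by \<open>\<mu>\<close>, or releases it at a
  leaf. The total released is the amount \<open>m r\<close> that starts at the root.\<close>

lemma sum_beta_consistent:
  assumes \<mu>: "environment \<mu>"
  shows "(\<Sum>a | a \<in> Aset \<inter> consistent \<mu> \<and> \<mu> a \<in> leaves. beta a) = real (m r)"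
proof -
  let ?EA = "Aset \<inter> consistent \<mu>" and ?EN = "Nset \<inter> consistent \<mu>"
  have fin: "finite ?EA" "finite ?EN" using finite_Aset finite_Nset by auto
  have EA: "?EA = (\<Union>v\<in>?EN. C v)"
  proof (intro equalityI subsetI)
    fix a assume "a \<in> ?EA"
    then show "a \<in> (\<Union>v\<in>?EN. C v)"
      using consistent_action parent_of_action by (intro UN_I[of "par a"]) auto
  next
    fix a assume "a \<in> (\<Union>v\<in>?EN. C v)"
    then obtain v where v: "v \<in> ?EN" "a \<in> C v" by blast
    then have "a \<in> Aset" using children_of_infoset by blast
    then show "a \<in> ?EA" using v consistent_action[of a \<mu>] by (auto simp: C_iff)
  qed
  have \<mu>C: "\<mu> a \<in> C a" if "a \<in> Aset" for a using \<mu> that by (simp add: environment_def)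
  have EN: "?EN - {r} = \<mu> ` {a \<in> ?EA. \<mu> a \<in> Nset}"
  proof (intro equalityI subsetI)
    fix v assume v: "v \<in> ?EN - {r}"
    then have p: "par v \<in> Aset" using parent_of_non_action[of v] Nset_subset N_A_disjoint by auto
    then have "par v \<in> consistent \<mu> \<and> \<mu> (par v) = v"
      using v consistent_iff[of v \<mu>] Nset_subset by auto
    then show "v \<in> \<mu> ` {a \<in> ?EA. \<mu> a \<in> Nset}" using p v by (intro image_eqI[of _ _ "par v"]) auto
  next
    fix v assume "v \<in> \<mu> ` {a \<in> ?EA. \<mu> a \<in> Nset}"
    then show "v \<in> ?EN - {r}" using \<mu>C consistent_iff[of v \<mu>] by (auto simp: C_iff)
  qed
  have inj: "inj_on \<mu> {a \<in> ?EA. \<mu> a \<in> Nset}"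
    by (rule inj_onI) (metis (no_types, lifting) C_iff IntD1 \<mu>C mem_Collect_eq)
  have "(\<Sum>v\<in>?EN. real (m v) * beta v) = (\<Sum>v\<in>?EN. \<Sum>a\<in>C v. beta a)"
  proof (rule sum.cong)
    fix v assume v: "v \<in> ?EN"
    then have "(\<Sum>a\<in>C v. beta a) = (\<Sum>a\<in>C v. real (m a) * beta v)"
      using children_of_infoset[of v] by (intro sum.cong) (auto simp: beta_action C_iff)
    then show "real (m v) * beta v = (\<Sum>a\<in>C v. beta a)"
      using v by (simp add: m_infoset sum_distrib_right)
  qed simp
  also have "\<dots> = (\<Sum>a\<in>?EA. beta a)"
    unfolding EA using fin finite_C by (subst sum.UNION_disjoint) (auto simp: C_iff)
  also have "\<dots> = (\<Sum>a | a \<in> ?EA \<and> \<mu> a \<in> leaves. beta a) + (\<Sum>a\<in>{a \<in> ?EA. \<mu> a \<in> Nset}. beta a)"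
  proof -
    have "?EA = {a \<in> ?EA. \<mu> a \<in> leaves} \<union> {a \<in> ?EA. \<mu> a \<in> Nset}"
      using \<mu>C children_of_action by blast
    moreover have "{a \<in> ?EA. \<mu> a \<in> leaves} \<inter> {a \<in> ?EA. \<mu> a \<in> Nset} = {}"
      using internal_nodes by auto
    ultimately show ?thesis using fin(1) by (metis (no_types, lifting) finite_Un sum.union_disjoint)
  qed
  also have "(\<Sum>a\<in>{a \<in> ?EA. \<mu> a \<in> Nset}. beta a)
      = (\<Sum>a\<in>{a \<in> ?EA. \<mu> a \<in> Nset}. real (m (\<mu> a)) * beta (\<mu> a))"
  proof (rule sum.cong)
    fix a assume a: "a \<in> {a \<in> ?EA. \<mu> a \<in> Nset}"
    then have "\<mu> a \<noteq> r" "par (\<mu> a) = a" using \<mu>C by (auto simp: C_iff)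
    then show "beta a = real (m (\<mu> a)) * beta (\<mu> a)"
      using a beta_infoset[of "\<mu> a"] m_pos[of "\<mu> a"] by auto
  qed simp
  also have "\<dots> = (\<Sum>v\<in>?EN - {r}. real (m v) * beta v)"
    unfolding EN sum.reindex[OF inj] by simp
  also have "(\<Sum>v\<in>?EN. real (m v) * beta v) = real (m r) + (\<Sum>v\<in>?EN - {r}. real (m v) * beta v)"
    using fin root_infoset root_consistent[of \<mu>] by (subst sum.remove[of _ r]) (auto simp: beta_root)
  finally show ?thesis by simp
qed

context
  fixes lam :: "'v \<Rightarrow> real" and \<mu> :: "'v \<Rightarrow> 'v"
  assumes lam: "\<forall>u\<in>leaves. 0 \<le> lam u \<and> lam u \<le> 1" and \<mu>: "environment \<mu>"
begin

lemma leaf_loss_bounds: "0 \<le> leaf_loss lam \<mu> a" "leaf_loss lam \<mu> a \<le> 1"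
  using lam by (auto simp: leaf_loss_def)

lemma Loss_bounds: "\<rho> \<in> RS \<Longrightarrow> 0 \<le> Loss lam \<rho> \<mu>" "\<rho> \<in> RS \<Longrightarrow> Loss lam \<rho> \<mu> \<le> 1"
  using leaf_reached(1)[OF _ \<mu>] lam by (auto simp: Loss_def)

lemma sum_beta_leaf_loss: "(\<Sum>a\<in>Aset. beta a * leaf_loss lam \<mu> a) \<le> real (m r)"
proof -
  have "(\<Sum>a\<in>Aset. beta a * leaf_loss lam \<mu> a)
      \<le> (\<Sum>a\<in>Aset. if a \<in> consistent \<mu> \<and> \<mu> a \<in> leaves then beta a else 0)"
    using leaf_loss_bounds beta_pos
    by (intro sum_mono) (auto simp: leaf_loss_def intro!: mult_left_le less_imp_le lam[rule_format, THEN conjunct2])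
  also have "\<dots> = (\<Sum>a | a \<in> Aset \<inter> consistent \<mu> \<and> \<mu> a \<in> leaves. beta a)"
    using finite_Aset by (subst sum.inter_filter[symmetric]) (auto intro!: sum.cong)
  finally show ?thesis using sum_beta_consistent[OF \<mu>] by simp
qed

end

end

section \<open>Laplace noise\<close>

lemma has_bochner_integral_exponential_density:
  assumes "0 < l" shows "has_bochner_integral lborel (exponential_density l) 1"
proof (rule has_bochner_integral_nn_integral)
  interpret prob_space "density lborel (exponential_density l)"
    by (rule prob_space_exponential_density[OF assms])
  show "(\<integral>\<^sup>+x. ennreal (exponential_density l x) \<partial>lborel) = ennreal 1"
    using emeasure_space_1 by (simp add: emeasure_density)
qed (use assms in \<open>auto simp: exponential_density_nonneg\<close>)

text \<open>Split at 0: the integrand is a multiple of an exponential density of rate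
  \<open>eps / 2 + s\<close> on the right and a multiple of a mirrored one of rate
  \<open>eps / 2 - s\<close> on the left.\<close>

lemma has_bochner_integral_laplace_density_exp:
  fixes eps s :: real
  assumes "0 < eps" "\<bar>s\<bar> < eps / 2"
  shows "has_bochner_integral lborel (\<lambda>x. eps / 4 * exp (- (eps / 2) * \<bar>x\<bar>) * exp (- (s * x)))
    (1 / (1 - (2 * s / eps)\<^sup>2))"
proof -
  define p q where "p = eps / 2 + s" and "q = eps / 2 - s"
  note pq_defs = this
  have pm: "0 < p" "0 < q" using assms unfolding pq_defs by linarith+
  have "has_bochner_integral lborel (\<lambda>x. exponential_density q (0 + -1 * x)) (1 /\<^sub>R \<bar>-1\<bar>)"
    using has_bochner_integral_exponential_density[OF pm(2)]
    by (subst (asm) lborel_has_bochner_integral_real_affine_iff[of "-1" _ _ 0]) auto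
  then have m: "has_bochner_integral lborel (\<lambda>x. exponential_density q (- x)) 1" by simp
  have "has_bochner_integral lborel (\<lambda>x. eps / 4 / p * exponential_density p x
      + eps / 4 / q * exponential_density q (- x)) (eps / 4 / p * 1 + eps / 4 / q * 1)"
    by (intro has_bochner_integral_add has_bochner_integral_mult_right impI
        has_bochner_integral_exponential_density pm m)
  moreover have "eps / 4 / p * 1 + eps / 4 / q * 1 = 1 / (1 - (2 * s / eps)\<^sup>2)"
  proof -
    have "(1 - (2 * s / eps)\<^sup>2) = p * q / (eps / 2)\<^sup>2"
      using assms(1) by (simp add: pq_defs field_simps power2_eq_square)
    moreover have "eps / 4 / p * 1 + eps / 4 / q * 1 = (eps / 2)\<^sup>2 / (p * q)"
    proof -
      have "eps / 4 / p + eps / 4 / q = (eps / 4 * q + eps / 4 * p) / (p * q)"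
        using pm by (simp add: field_simps)
      also have "eps / 4 * q + eps / 4 * p = (eps / 2)\<^sup>2"
        by (simp add: pq_defs field_simps power2_eq_square)
      finally show ?thesis by simp
    qed
    ultimately show ?thesis by simp
  qed
  \<comment> \<open>At 0 both densities are nonzero and the identity fails, but a single point is a
    null set.\<close>
  moreover have "AE x in lborel. eps / 4 / p * exponential_density p x
      + eps / 4 / q * exponential_density q (- x) = eps / 4 * exp (- (eps / 2) * \<bar>x\<bar>) * exp (- (s * x))"
    using AE_lborel_singleton[of 0]
  proof eventually_elim
    case (elim x)
    have "exp (- (eps / 2) * \<bar>x\<bar>) * exp (- (s * x)) = (if x < 0 then exp (x * q) else exp (- x * p))"
      by (auto simp: pq_defs exp_add[symmetric] algebra_simps)
    then show ?case using elim pm by (auto simp: exponential_density_def mult.assoc)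
  qed
  ultimately show ?thesis
    by (subst (asm) has_bochner_integral_cong_AE) auto
qed

context game_tree
begin

lemma sets_laplace [measurable_cong, simp]: "sets (laplace eps) = sets borel"
  and space_laplace [simp]: "space (laplace eps) = UNIV"
  by (simp_all add: laplace_def)

lemma has_bochner_integral_laplace_exp:
  assumes "0 < eps" "\<bar>s\<bar> < eps / 2"
  shows "has_bochner_integral (laplace eps) (\<lambda>x. exp (- (s * x))) (1 / (1 - (2 * s / eps)\<^sup>2))"
  unfolding laplace_def using has_bochner_integral_laplace_density_exp[OF assms] assms
  by (intro has_bochner_integral_density) auto

lemma prob_space_laplace:
  assumes "0 < eps" shows "prob_space (laplace eps)"
proof
  have "has_bochner_integral lborel (\<lambda>x. eps / 4 * exp (- (eps / 2) * \<bar>x\<bar>)) 1"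
    using has_bochner_integral_laplace_density_exp[of eps 0] assms by simp
  then have "(\<integral>\<^sup>+x. ennreal (eps / 4 * exp (- (eps / 2) * \<bar>x\<bar>)) \<partial>lborel) = 1"
    using assms by (subst nn_integral_eq_integral) (auto simp: has_bochner_integral_iff)
  then show "emeasure (laplace eps) (space (laplace eps)) = 1"
    by (simp add: laplace_def emeasure_density)
qed

text \<open>Integrability comes from domination by two exponentials with parameters
  \<open>eps / 4\<close> and \<open>- eps / 4\<close>, inside the admissible range; the value 0
  comes from the reflection of x to -x.\<close>

lemma has_bochner_integral_laplace_ident:
  assumes "0 < eps" shows "has_bochner_integral (laplace eps) (\<lambda>x. x) 0"
proof -
  have "integrable (laplace eps) (\<lambda>x. 4 / eps * (exp (- (eps / 4 * x)) + exp (- (- eps / 4 * x))))"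
    using has_bochner_integral_laplace_exp[OF assms, of "eps / 4"]
      has_bochner_integral_laplace_exp[OF assms, of "- eps / 4"] assms
    by (intro integrable_mult_right Bochner_Integration.integrable_add impI) (auto simp: has_bochner_integral_iff)
  then have int: "integrable (laplace eps) (\<lambda>x. x)"
  proof (rule Bochner_Integration.integrable_bound)
    show "AE x in laplace eps. norm x \<le> norm (4 / eps * (exp (- (eps / 4 * x)) + exp (- (- eps / 4 * x))))"
    proof (rule AE_I2)
      fix x :: real
      let ?y = "eps / 4 * x"
      have "\<bar>?y\<bar> \<le> exp (- ?y) + exp ?y"
        using exp_ge_add_one_self[of ?y] exp_ge_add_one_self[of "- ?y"] exp_gt_zero[of ?y] exp_gt_zero[of "- ?y"]
        by linarith
      then have "4 / eps * \<bar>?y\<bar> \<le> 4 / eps * (exp (- ?y) + exp ?y)"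
        using assms by (intro mult_left_mono) auto
      moreover have "4 / eps * \<bar>?y\<bar> = \<bar>x\<bar>" using assms by (simp add: abs_mult)
      ultimately have "\<bar>x\<bar> \<le> 4 / eps * (exp (- ?y) + exp ?y)" by simp
      also have "\<dots> \<le> \<bar>4 / eps * (exp (- ?y) + exp ?y)\<bar>" by (rule abs_ge_self)
      finally show "norm x \<le> norm (4 / eps * (exp (- (eps / 4 * x)) + exp (- (- eps / 4 * x))))"
        by simp
    qed
  qed simp
  let ?g = "\<lambda>x. eps / 4 * exp (- (eps / 2) * \<bar>x\<bar>) * x"
  have *: "integral\<^sup>L (laplace eps) (\<lambda>x. x) = (\<integral>x. ?g x \<partial>lborel)"
    unfolding laplace_def using assms by (subst integral_density) auto
  also have "(\<integral>x. ?g x \<partial>lborel) = (\<integral>x. ?g (0 + -1 * x) \<partial>lborel)"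
    using lborel_integral_real_affine[of "-1" ?g 0] by simp
  also have "\<dots> = - (\<integral>x. ?g x \<partial>lborel)" by simp
  finally have "integral\<^sup>L (laplace eps) (\<lambda>x. x) = 0" unfolding * by linarith
  with int show ?thesis by (simp add: has_bochner_integral_iff)
qed

abbreviation noise :: "real \<Rightarrow> 'v set \<Rightarrow> ('v \<Rightarrow> real) measure" where
  "noise eps I \<equiv> (\<Pi>\<^sub>M a\<in>I. laplace eps)"

lemma prob_space_noise: "0 < eps \<Longrightarrow> prob_space (noise eps I)"
  by (intro prob_space_PiM prob_space_laplace)

lemma has_bochner_integral_noise_component:
  assumes "0 < eps" "a \<in> I"
  shows "has_bochner_integral (noise eps I) (\<lambda>\<phi>. \<phi> a) 0"
proof -
  have "distr (noise eps I) (laplace eps) (\<lambda>\<phi>. \<phi> a) = laplace eps"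
    using assms by (intro distr_PiM_component prob_space_laplace)
  then have "has_bochner_integral (distr (noise eps I) (laplace eps) (\<lambda>\<phi>. \<phi> a)) (\<lambda>x. x) 0"
    using has_bochner_integral_laplace_ident[OF assms(1)] by simp
  then show ?thesis using assms(2)
    by (auto simp: has_bochner_integral_iff integrable_distr_eq integral_distr)
qed

lemma has_bochner_integral_noise_exp:
  assumes "0 < eps" "finite I" "B \<subseteq> I" "\<And>a. a \<in> B \<Longrightarrow> \<bar>s a\<bar> < eps / 2"
  shows "has_bochner_integral (noise eps I) (\<lambda>\<phi>. exp (- (\<Sum>a\<in>B. s a * (l a + \<phi> a))))
    (exp (- (\<Sum>a\<in>B. s a * l a)) * (\<Prod>a\<in>B. 1 / (1 - (2 * s a / eps)\<^sup>2)))"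
proof -
  \<comment> \<open>Extending the scales by 0 makes the integrand a product over all coordinates in
    \<open>I\<close>; the factors outside \<open>B\<close> integrate to 1.\<close>
  let ?s = "\<lambda>a. if a \<in> B then s a else 0"
  interpret product_sigma_finite "\<lambda>_::'v. laplace eps"
    by (intro product_sigma_finite.intro prob_space_imp_sigma_finite prob_space_laplace assms)
  have one: "has_bochner_integral (laplace eps) (\<lambda>x. exp (- (?s a * x))) (1 / (1 - (2 * ?s a / eps)\<^sup>2))" for a
    using assms(1) assms(4)[of a] by (intro has_bochner_integral_laplace_exp) auto
  have "has_bochner_integral (noise eps I) (\<lambda>\<phi>. \<Prod>a\<in>I. exp (- (?s a * \<phi> a)))
      (\<Prod>a\<in>I. 1 / (1 - (2 * ?s a / eps)\<^sup>2))"
    unfolding has_bochner_integral_iff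
    using one assms(2) product_integrable_prod[where I = I and f = "\<lambda>a x. exp (- (?s a * x))"]
      product_integral_prod[where I = I and f = "\<lambda>a x. exp (- (?s a * x))"]
    by (auto simp: has_bochner_integral_iff)
  also have "(\<Prod>a\<in>I. 1 / (1 - (2 * ?s a / eps)\<^sup>2)) = (\<Prod>a\<in>B. 1 / (1 - (2 * s a / eps)\<^sup>2))"
    using assms(2,3) by (intro prod.mono_neutral_cong_right) auto
  also have "(\<lambda>\<phi>. \<Prod>a\<in>I. exp (- (?s a * \<phi> a))) = (\<lambda>\<phi>. \<Prod>a\<in>B. exp (- (s a * \<phi> a)))"
    using assms(2,3) by (intro ext prod.mono_neutral_cong_right) auto
  finally have "has_bochner_integral (noise eps I)
      (\<lambda>\<phi>. exp (- (\<Sum>a\<in>B. s a * l a)) * (\<Prod>a\<in>B. exp (- (s a * \<phi> a))))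
      (exp (- (\<Sum>a\<in>B. s a * l a)) * (\<Prod>a\<in>B. 1 / (1 - (2 * s a / eps)\<^sup>2)))"
    by (rule has_bochner_integral_mult_right)
  moreover have "exp (- (\<Sum>a\<in>B. s a * l a)) * (\<Prod>a\<in>B. exp (- (s a * \<phi> a)))
      = exp (- (\<Sum>a\<in>B. s a * (l a + \<phi> a)))" for \<phi> :: "'v \<Rightarrow> real"
    using finite_subset[OF assms(3,2)]
    by (simp add: exp_sum[symmetric] exp_add[symmetric] sum_negf sum.distrib distrib_left)
  ultimately show ?thesis by simp
qed

end

section \<open>Elementary inequalities for the moment bound\<close>

lemma one_minus_sum_le_prod:
  fixes x :: "'a \<Rightarrow> real"
  assumes "finite B" "\<And>a. a \<in> B \<Longrightarrow> 0 \<le> x a" "\<And>a. a \<in> B \<Longrightarrow> x a \<le> 1"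
  shows "1 - (\<Sum>a\<in>B. x a) \<le> (\<Prod>a\<in>B. 1 - x a)"
  using assms
proof (induction B rule: finite_induct)
  case (insert b B)
  have "(\<Prod>a\<in>B. 1 - x a) \<le> 1" using insert by (intro prod_le_1) auto
  then have "x b * (\<Prod>a\<in>B. 1 - x a) \<le> x b * 1" using insert by (intro mult_left_mono) auto
  then show ?case using insert by (simp add: algebra_simps)
qed simp

lemma exp_minus_le_quadratic:
  fixes x :: real assumes "0 \<le> x" shows "exp (- x) \<le> 1 - x + x\<^sup>2 / 2"
proof -
  \<comment> \<open>The product equals 1 + x^4 / 4.\<close>
  have "1 \<le> (1 - x + x\<^sup>2 / 2) * (1 + x + x\<^sup>2 / 2)"
    using zero_le_even_power[of 4 x] by (simp add: algebra_simps power2_eq_square power4_eq_xxxx)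
  also have "\<dots> \<le> (1 - x + x\<^sup>2 / 2) * exp x"
  proof (rule mult_left_mono[OF exp_lower_Taylor_quadratic[OF assms]])
    have "1 - x + x\<^sup>2 / 2 = ((1 - x)\<^sup>2 + 1) / 2" by (simp add: power2_eq_square field_simps)
    moreover have "0 \<le> ((1 - x)\<^sup>2 + 1) / 2" by simp
    ultimately show "0 \<le> 1 - x + x\<^sup>2 / 2" by (simp only:)
  qed
  finally show ?thesis by (simp add: exp_minus field_simps)
qed

text \<open>The constant is set by \<open>laplace_moment_bound\<close>, where
  \<open>exp 1 - 2\<close> has to exceed (4/3 + 1/8) / (9/4), about 0.648. The quadratic Taylor
  bound at 1/4, raised to the fourth power, gives about 2.69.\<close>

lemma exp_1_lower: "(2.65 :: real) \<le> exp 1"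
proof -
  have "(1.28125 :: real) \<le> exp (1/4)"
    using exp_lower_Taylor_quadratic[of "1/4"] by (simp add: power2_eq_square)
  then have "(1.28125 :: real) ^ 4 \<le> exp (1/4) ^ 4" by (rule power_mono) simp
  also have "exp (1/4) ^ 4 = exp (1::real)" by (simp add: exp_of_nat_mult[symmetric])
  finally show ?thesis by (simp add: power4_eq_xxxx)
qed

text \<open>The second-order bound that bounded losses would satisfy also holds for the moment generating
  function of the Laplace noise, as long as the scales sum to at most 1/2 (which needs T at least 2).
  Hence no event of large noise has to be excluded.\<close>

lemma laplace_moment_bound:
  fixes c :: "'a \<Rightarrow> real"
  assumes fin: "finite B" and c: "\<And>a. a \<in> B \<Longrightarrow> 0 \<le> c a" and sum: "(\<Sum>a\<in>B. c a) \<le> 1/2"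
    and S: "0 \<le> S" "S\<^sup>2 \<le> (\<Sum>a\<in>B. (c a)\<^sup>2) / 4"
  shows "exp (- S) * (\<Prod>a\<in>B. 1 / (1 - (c a)\<^sup>2)) \<le> 1 - S + (exp 1 - 2) * (9/4) * (\<Sum>a\<in>B. (c a)\<^sup>2)"
proof -
  define y where "y = (\<Sum>a\<in>B. (c a)\<^sup>2)"
  have c_half: "c a \<le> 1/2" if "a \<in> B" for a
    using member_le_sum[OF that, of c] c fin sum by force
  have "y \<le> (\<Sum>a\<in>B. 1/2 * c a)"
    unfolding y_def power2_eq_square using c c_half by (intro sum_mono mult_right_mono) auto
  also have "\<dots> \<le> 1/4" using sum by (simp add: sum_distrib_left[symmetric] sum_divide_distrib[symmetric])
  finally have y: "0 \<le> y" "y \<le> 1/4" by (auto simp: y_def intro: sum_nonneg)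
  have "1 - y \<le> (\<Prod>a\<in>B. 1 - (c a)\<^sup>2)"
    unfolding y_def using fin c c_half by (intro one_minus_sum_le_prod) (force simp: power_le_one)+
  then have "(\<Prod>a\<in>B. 1 / (1 - (c a)\<^sup>2)) \<le> 1 / (1 - y)"
    using y by (simp add: prod_dividef frac_le)
  \<comment> \<open>After clearing the denominator this says 4 y^2 <= y, that is, y <= 1/4.\<close>
  also have "\<dots> \<le> 1 + 4/3 * y"
    using y mult_mono[of "4 * y" 1 y y] by (simp add: field_simps)
  finally have P: "(\<Prod>a\<in>B. 1 / (1 - (c a)\<^sup>2)) \<le> 1 + 4/3 * y" .
  have "exp (- S) * (\<Prod>a\<in>B. 1 / (1 - (c a)\<^sup>2)) \<le> exp (- S) * (1 + 4/3 * y)"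
    using P by (intro mult_left_mono) auto
  also have "\<dots> = exp (- S) + exp (- S) * (4/3 * y)" by (simp add: algebra_simps)
  also have "\<dots> \<le> (1 - S + S\<^sup>2 / 2) + 1 * (4/3 * y)"
    using y S exp_minus_le_quadratic[OF S(1)] by (intro add_mono mult_right_mono) auto
  \<comment> \<open>S^2 / 2 is at most y / 8, and 1/8 + 4/3 lies just below 0.65 * 9/4.\<close>
  also have "\<dots> \<le> 1 - S + 0.65 * (9/4) * y" using S(2) y by (simp add: y_def[symmetric])
  also have "\<dots> \<le> 1 - S + (exp 1 - 2) * (9/4) * y"
    using y exp_1_lower by (intro add_left_mono mult_right_mono) auto
  finally show ?thesis by (simp add: y_def)
qed

context game_tree
begin

section \<open>Expected progress of one trial\<close>

lemma ln_n_root_pos: "0 < ln (real (n r))"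
  using n_root_ge_2 by simp

lemma card_Aset_pos: "0 < card Aset"
  using m_pos[of r] root_infoset by (simp add: m_root)

lemma exp_1_gt_2: "(2 :: real) < exp 1"
  using exp_1_lower by simp

lemma eta_pos:
  assumes "1 \<le> T" "0 < eps" shows "0 < eta T eps"
proof -
  have "0 < 6 * ln (real T) / eps + 9 * (exp 1 - 2) / eps\<^sup>2"
    using assms exp_1_gt_2 by (intro add_nonneg_pos) auto
  then show ?thesis
    using assms ln_n_root_pos card_Aset_pos by (auto simp: eta_def m_root)
qed

lemma gamma_nonneg: "1 \<le> T \<Longrightarrow> 0 < eps \<Longrightarrow> 0 \<le> gamma T eps"
  using eta_pos[of T eps] by (simp add: gamma_def)

lemma den_ge_reach: "1 \<le> T \<Longrightarrow> 0 < eps \<Longrightarrow> a \<in> Aset \<Longrightarrow> reach \<pi> a \<le> den T eps \<pi> a"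
  using gamma_nonneg[of T eps] beta_pos[of a] by (simp add: den_def)

context
  fixes lam :: "'v \<Rightarrow> real" and \<mu> :: "'v \<Rightarrow> 'v" and T :: nat and eps :: real and \<pi> :: "'v \<Rightarrow> real"
  assumes lam: "\<forall>u\<in>leaves. 0 \<le> lam u \<and> lam u \<le> 1" and \<mu>: "environment \<mu>"
    and T: "2 \<le> T" and eps: "0 < eps" "eps < 1" and \<pi>: "policy \<pi>"
begin

lemma den_pos: "a \<in> Aset \<Longrightarrow> 0 < den T eps \<pi> a"
  using den_ge_reach[of T eps a \<pi>] reach_pos[OF \<pi>] T eps by force

text \<open>\<open>den\<close> is at least \<open>gamma * beta\<close>, and
  \<open>gamma = 6 ln T * eta / eps\<close>, so each term is at most 1 / (3 ln T * beta a). Here T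
  >= 2 enters, through ln T >= 2/3, and the sum of 1 / beta over a reduced strategy is 1.\<close>

lemma noise_scale_sum:
  assumes "\<rho> \<in> RS" "B \<subseteq> Aof \<rho>"
  shows "(\<Sum>a\<in>B. 2 * (eta T eps / den T eps \<pi> a) / eps) \<le> 1/2"
proof -
  have eta: "0 < eta T eps" using eta_pos T eps by simp
  have "2/3 \<le> ln (2::real)" by (rule ln2_ge_two_thirds)
  also have "\<dots> \<le> ln (real T)" using T by simp
  finally have lnT: "2/3 \<le> ln (real T)" .
  have "(\<Sum>a\<in>B. 2 * (eta T eps / den T eps \<pi> a) / eps) \<le> (\<Sum>a\<in>B. 1/2 * (1 / beta a))"
  proof (rule sum_mono)
    fix a assume "a \<in> B"
    then have a: "a \<in> Aset" using assms Aof_subset by blast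
    have b: "0 < beta a" using beta_pos a by simp
    have "4 * eta T eps * beta a \<le> 6 * ln (real T) * eta T eps * beta a"
      using lnT eta b by (intro mult_right_mono) auto
    also have "\<dots> = eps * (gamma T eps * beta a)" using eps by (simp add: gamma_def)
    also have "\<dots> \<le> eps * den T eps \<pi> a"
      using eps reach_pos[OF \<pi> a] by (intro mult_left_mono) (auto simp: den_def)
    finally show "2 * (eta T eps / den T eps \<pi> a) / eps \<le> 1/2 * (1 / beta a)"
      using b den_pos[OF a] eps by (simp add: field_simps)
  qed
  also have "\<dots> \<le> (\<Sum>a\<in>Aof \<rho>. 1/2 * (1 / beta a))"
    using assms finite_Aof beta_pos Aof_subset
    by (intro sum_mono2) (auto intro!: less_imp_le simp: subset_iff)
  also have "\<dots> = 1/2" unfolding sum_distrib_left[symmetric] by (simp add: sum_inverse_beta[OF assms(1)])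
  finally show ?thesis .
qed

lemma dvec_eq: "\<rho> \<in> RS \<Longrightarrow> a \<in> Aof \<rho> \<Longrightarrow> dvec lam \<rho> \<mu> \<phi> a = leaf_loss lam \<mu> a + \<phi> a"
  by (simp add: dvec_def leaf_loss_eq[OF _ \<mu>])

lemma has_bochner_integral_est:
  assumes "\<rho> \<in> RS"
  shows "has_bochner_integral (noise eps (Aof \<rho>)) (\<lambda>\<phi>. est T eps \<pi> \<rho> (dvec lam \<rho> \<mu> \<phi>) \<rho>')
    (\<Sum>a\<in>Aof \<rho> \<inter> Aof \<rho>'. leaf_loss lam \<mu> a / den T eps \<pi> a)"
proof -
  interpret prob_space "noise eps (Aof \<rho>)" by (rule prob_space_noise[OF eps(1)])
  have const: "has_bochner_integral (noise eps (Aof \<rho>)) (\<lambda>_. x) x" for x :: real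
    by (auto simp: has_bochner_integral_iff prob_space)
  have "has_bochner_integral (noise eps (Aof \<rho>))
      (\<lambda>\<phi>. \<Sum>a\<in>Aof \<rho> \<inter> Aof \<rho>'. (leaf_loss lam \<mu> a + \<phi> a) / den T eps \<pi> a)
      (\<Sum>a\<in>Aof \<rho> \<inter> Aof \<rho>'. (leaf_loss lam \<mu> a + 0) / den T eps \<pi> a)"
    by (intro has_bochner_integral_sum has_bochner_integral_divide_zero has_bochner_integral_add
        has_bochner_integral_noise_component eps const) auto
  then show ?thesis unfolding est_def using dvec_eq[OF assms] by simp
qed

text \<open>The exponent is a constant plus independent scaled Laplace variables, so the integral
  has a closed form, to which \<open>laplace_moment_bound\<close> applies. The witness hides the
  closed form; only its bound matters later.\<close>

lemma has_bochner_integral_exp_est: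
  assumes \<rho>: "\<rho> \<in> RS" and \<rho>': "\<rho>' \<in> RS"
  obtains I where
    "has_bochner_integral (noise eps (Aof \<rho>))
      (\<lambda>\<phi>. exp (- eta T eps * est T eps \<pi> \<rho> (dvec lam \<rho> \<mu> \<phi>) \<rho>')) I"
    "I \<le> 1 - eta T eps * (\<Sum>a\<in>Aof \<rho> \<inter> Aof \<rho>'. leaf_loss lam \<mu> a / den T eps \<pi> a)
      + (exp 1 - 2) * 9 / eps\<^sup>2 * (eta T eps)\<^sup>2 * (\<Sum>a\<in>Aof \<rho> \<inter> Aof \<rho>'. 1 / (den T eps \<pi> a)\<^sup>2)"
proof -
  let ?B = "Aof \<rho> \<inter> Aof \<rho>'" and ?l = "leaf_loss lam \<mu>"
  define s where "s a = eta T eps / den T eps \<pi> a" for a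
  define c where "c a = 2 * s a / eps" for a
  define S where "S = (\<Sum>a\<in>?B. s a * ?l a)"
  have BA: "a \<in> Aset" if "a \<in> ?B" for a using that Aof_subset by auto
  have eta: "0 < eta T eps" using eta_pos T eps by simp
  have s: "0 < s a" if "a \<in> ?B" for a using eta den_pos[OF BA[OF that]] by (simp add: s_def)
  have c: "0 \<le> c a" if "a \<in> ?B" for a using s[OF that] eps by (simp add: c_def)
  have csum: "(\<Sum>a\<in>?B. c a) \<le> 1/2" using noise_scale_sum[OF \<rho>, of ?B] by (simp add: c_def s_def)
  have fin: "finite ?B" using finite_Aof by auto
  have "\<bar>s a\<bar> < eps / 2" if "a \<in> ?B" for a
  proof -
    have "c a \<le> 1/2" using member_le_sum[OF that, of c] c fin csum by force
    then show ?thesis using s[OF that] eps by (simp add: c_def field_simps)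
  qed
  then have hb: "has_bochner_integral (noise eps (Aof \<rho>)) (\<lambda>\<phi>. exp (- (\<Sum>a\<in>?B. s a * (?l a + \<phi> a))))
    (exp (- S) * (\<Prod>a\<in>?B. 1 / (1 - (c a)\<^sup>2)))"
    unfolding S_def c_def by (intro has_bochner_integral_noise_exp eps finite_Aof) auto
  have "(\<Sum>a\<in>?B. s a * (?l a + \<phi> a)) = eta T eps * est T eps \<pi> \<rho> (dvec lam \<rho> \<mu> \<phi>) \<rho>'" for \<phi>
    unfolding est_def sum_distrib_left by (intro sum.cong) (auto simp: s_def dvec_eq[OF \<rho>])
  with hb have 1: "has_bochner_integral (noise eps (Aof \<rho>))
      (\<lambda>\<phi>. exp (- eta T eps * est T eps \<pi> \<rho> (dvec lam \<rho> \<mu> \<phi>) \<rho>'))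
      (exp (- S) * (\<Prod>a\<in>?B. 1 / (1 - (c a)\<^sup>2)))"
    by simp
  have S0: "0 \<le> S"
    unfolding S_def using s leaf_loss_bounds[OF lam \<mu>] by (intro sum_nonneg mult_nonneg_nonneg) (auto intro: less_imp_le)
  \<comment> \<open>At most one action, the last one played, has nonzero loss, so S is a single term
    s l <= s = eps c / 2 <= c / 2, by eps < 1.\<close>
  have S2: "S\<^sup>2 \<le> (\<Sum>a\<in>?B. (c a)\<^sup>2) / 4"
  proof (cases "last_action \<rho> \<mu> \<in> ?B")
    case True
    let ?z = "last_action \<rho> \<mu>"
    have "S = (\<Sum>a\<in>?B. if a = ?z then s ?z * ?l ?z else 0)"
      unfolding S_def using leaf_loss_eq[OF \<rho> \<mu>] by (intro sum.cong) auto
    then have "S = s ?z * ?l ?z" using True fin by simp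
    also have "\<dots> \<le> s ?z * 1"
      using s[OF True] leaf_loss_bounds[OF lam \<mu>] by (intro mult_left_mono) auto
    also have "\<dots> \<le> c ?z / 2" using s[OF True] eps by (simp add: c_def field_simps)
    finally have "S\<^sup>2 \<le> (c ?z / 2)\<^sup>2" using S0 by (intro power_mono) auto
    also have "\<dots> = (c ?z)\<^sup>2 / 4" by (simp add: power_divide)
    also have "(c ?z)\<^sup>2 \<le> (\<Sum>a\<in>?B. (c a)\<^sup>2)" using True fin by (intro member_le_sum) auto
    finally show ?thesis by simp
  next
    case False
    then have "S = 0" unfolding S_def using leaf_loss_eq[OF \<rho> \<mu>] by (intro sum.neutral) auto
    then show ?thesis by (auto intro!: sum_nonneg)
  qed
  have "exp (- S) * (\<Prod>a\<in>?B. 1 / (1 - (c a)\<^sup>2)) \<le> 1 - S + (exp 1 - 2) * (9/4) * (\<Sum>a\<in>?B. (c a)\<^sup>2)"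
    by (rule laplace_moment_bound[OF fin c csum S0 S2])
  \<comment> \<open>The factor 4 / eps^2 from the scale of the noise meets the 9/4 of the moment
    bound; this is the origin of 9 / eps^2 in the regret.\<close>
  also have "(\<Sum>a\<in>?B. (c a)\<^sup>2) = 4 / eps\<^sup>2 * (eta T eps)\<^sup>2 * (\<Sum>a\<in>?B. 1 / (den T eps \<pi> a)\<^sup>2)"
    unfolding sum_distrib_left by (intro sum.cong) (auto simp: c_def s_def power_divide power_mult_distrib)
  finally have "exp (- S) * (\<Prod>a\<in>?B. 1 / (1 - (c a)\<^sup>2))
    \<le> 1 - S + (exp 1 - 2) * 9 / eps\<^sup>2 * (eta T eps)\<^sup>2 * (\<Sum>a\<in>?B. 1 / (den T eps \<pi> a)\<^sup>2)"
    by (simp add: mult.assoc)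
  moreover have "S = eta T eps * (\<Sum>a\<in>?B. ?l a / den T eps \<pi> a)"
    unfolding S_def s_def sum_distrib_left by (intro sum.cong) auto
  ultimately have 2: "exp (- S) * (\<Prod>a\<in>?B. 1 / (1 - (c a)\<^sup>2))
    \<le> 1 - eta T eps * (\<Sum>a\<in>?B. ?l a / den T eps \<pi> a)
      + (exp 1 - 2) * 9 / eps\<^sup>2 * (eta T eps)\<^sup>2 * (\<Sum>a\<in>?B. 1 / (den T eps \<pi> a)\<^sup>2)"
    by simp
  from 1 2 show thesis by (rule that)
qed

text \<open>Bounds the expected new potential given the sampled strategy, with the noise averaged
  out. P is the old potential, the first sum is the expected estimate for the comparator, and the
  sum over \<open>RS\<close> bounds the expectation of (Z - 1) / eta.\<close>

definition step_bound :: "real \<Rightarrow> ('v \<rightharpoonup> 'v) \<Rightarrow> ('v \<rightharpoonup> 'v) \<Rightarrow> real" where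
  "step_bound P \<sigma> \<rho> = P + Loss lam \<rho> \<mu> + (\<Sum>a\<in>Aof \<rho> \<inter> Aof \<sigma>. leaf_loss lam \<mu> a / den T eps \<pi> a)
    + (\<Sum>\<rho>'\<in>RS. weight \<pi> \<rho>' * (- (\<Sum>a\<in>Aof \<rho>' \<inter> Aof \<rho>. leaf_loss lam \<mu> a / den T eps \<pi> a)
        + (exp 1 - 2) * 9 / eps\<^sup>2 * eta T eps * (\<Sum>a\<in>Aof \<rho>' \<inter> Aof \<rho>. 1 / (den T eps \<pi> a)\<^sup>2)))"

text \<open>The new potential is compared pointwise with an \<open>H\<close> of known integral, so
  the law of the new policy never has to be computed. The second claim lets the averages over
  \<open>RS\<close> pass through \<open>ennreal\<close>, which would cut negative numbers to
  0.\<close>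

lemma nn_integral_potential_noise:
  assumes \<rho>: "\<rho> \<in> RS" and \<sigma>: "\<sigma> \<in> RS" and L: "0 \<le> L"
  shows "(\<integral>\<^sup>+\<phi>. ennreal (L + Loss lam \<rho> \<mu> - ln (weight (update T eps \<pi> \<rho> (dvec lam \<rho> \<mu> \<phi>)) \<sigma>) / eta T eps)
      \<partial>noise eps (Aof \<rho>)) \<le> ennreal (step_bound (L - ln (weight \<pi> \<sigma>) / eta T eps) \<sigma> \<rho>)"
    and "0 \<le> step_bound (L - ln (weight \<pi> \<sigma>) / eta T eps) \<sigma> \<rho>"
proof -
  interpret prob_space "noise eps (Aof \<rho>)" by (rule prob_space_noise[OF eps(1)])
  have eta: "0 < eta T eps" using eta_pos T eps by simp
  let ?d = "dvec lam \<rho> \<mu>" and ?E = "\<lambda>\<phi>. est T eps \<pi> \<rho> (dvec lam \<rho> \<mu> \<phi>)"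
  let ?P = "L - ln (weight \<pi> \<sigma>) / eta T eps"
  let ?M = "\<lambda>\<rho>'. \<Sum>a\<in>Aof \<rho> \<inter> Aof \<rho>'. leaf_loss lam \<mu> a / den T eps \<pi> a"
  let ?Q = "\<lambda>\<rho>'. (exp 1 - 2) * 9 / eps\<^sup>2 * (eta T eps)\<^sup>2 * (\<Sum>a\<in>Aof \<rho> \<inter> Aof \<rho>'. 1 / (den T eps \<pi> a)\<^sup>2)"
  \<comment> \<open>The exact new potential with ln Z replaced by Z - 1, and Z expanded by
    \<open>psi_root\<close>.\<close>
  define H where "H \<phi> = ?P + Loss lam \<rho> \<mu> + ?E \<phi> \<sigma>
      + ((\<Sum>\<rho>'\<in>RS. weight \<pi> \<rho>' * exp (- eta T eps * ?E \<phi> \<rho>')) - 1) / eta T eps" for \<phi>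
  have le: "0 \<le> L + Loss lam \<rho> \<mu> - ln (weight (update T eps \<pi> \<rho> (?d \<phi>)) \<sigma>) / eta T eps
      \<and> L + Loss lam \<rho> \<mu> - ln (weight (update T eps \<pi> \<rho> (?d \<phi>)) \<sigma>) / eta T eps \<le> H \<phi>" for \<phi>
  proof
    have "ln (weight (update T eps \<pi> \<rho> (?d \<phi>)) \<sigma>) \<le> 0"
      using weight_le_1[OF policy_update[OF \<pi> \<rho>] \<sigma>] weight_pos[OF policy_update[OF \<pi> \<rho>] \<sigma>]
      by simp
    then have "ln (weight (update T eps \<pi> \<rho> (?d \<phi>)) \<sigma>) / eta T eps \<le> 0"
      using eta by (simp add: divide_nonpos_pos)
    then show "0 \<le> L + Loss lam \<rho> \<mu> - ln (weight (update T eps \<pi> \<rho> (?d \<phi>)) \<sigma>) / eta T eps"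
      using L Loss_bounds(1)[OF lam \<mu> \<rho>] by linarith
    let ?psi = "psi T eps \<pi> \<rho> (?d \<phi>) r"
    have psi: "0 < ?psi" using psi_pos[OF \<pi> \<rho> root_in_Nof] by blast
    have "ln (weight (update T eps \<pi> \<rho> (?d \<phi>)) \<sigma>)
        = ln (weight \<pi> \<sigma>) - eta T eps * ?E \<phi> \<sigma> - ln ?psi"
      unfolding weight_update[OF \<pi> \<rho> \<sigma>] using weight_pos[OF \<pi> \<sigma>] psi
      by (simp add: ln_div ln_mult)
    then have 1: "- (ln (weight (update T eps \<pi> \<rho> (?d \<phi>)) \<sigma>) / eta T eps)
        = - (ln (weight \<pi> \<sigma>) / eta T eps) + ?E \<phi> \<sigma> + ln ?psi / eta T eps"
      using eta by (simp add: field_simps)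
    have 2: "ln ?psi / eta T eps \<le> (?psi - 1) / eta T eps"
      using ln_le_minus_one[OF psi] eta by (intro divide_right_mono) auto
    show "L + Loss lam \<rho> \<mu> - ln (weight (update T eps \<pi> \<rho> (?d \<phi>)) \<sigma>) / eta T eps \<le> H \<phi>"
      unfolding H_def psi_root[OF \<pi> \<rho>, symmetric] using 1 2 by linarith
  qed
  have "\<forall>\<rho>'\<in>RS. \<exists>I. has_bochner_integral (noise eps (Aof \<rho>)) (\<lambda>\<phi>. exp (- eta T eps * ?E \<phi> \<rho>')) I
      \<and> I \<le> 1 - eta T eps * ?M \<rho>' + ?Q \<rho>'"
  proof
    fix \<rho>' assume "\<rho>' \<in> RS"
    from has_bochner_integral_exp_est[OF \<rho> this]
    show "\<exists>I. has_bochner_integral (noise eps (Aof \<rho>)) (\<lambda>\<phi>. exp (- eta T eps * ?E \<phi> \<rho>')) I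
      \<and> I \<le> 1 - eta T eps * ?M \<rho>' + ?Q \<rho>'" by blast
  qed
  from bchoice[OF this] obtain I where I: "\<And>\<rho>'. \<rho>' \<in> RS \<Longrightarrow> has_bochner_integral (noise eps (Aof \<rho>))
        (\<lambda>\<phi>. exp (- eta T eps * ?E \<phi> \<rho>')) (I \<rho>')"
      "\<And>\<rho>'. \<rho>' \<in> RS \<Longrightarrow> I \<rho>' \<le> 1 - eta T eps * ?M \<rho>' + ?Q \<rho>'"
    by blast
  define J where "J = ?P + Loss lam \<rho> \<mu> + ?M \<sigma> + ((\<Sum>\<rho>'\<in>RS. weight \<pi> \<rho>' * I \<rho>') - 1) / eta T eps"
  have const: "has_bochner_integral (noise eps (Aof \<rho>)) (\<lambda>_. x) x" for x :: real
    by (auto simp: has_bochner_integral_iff prob_space)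
  have hbH: "has_bochner_integral (noise eps (Aof \<rho>)) H J"
    unfolding H_def[abs_def] J_def
    by (intro has_bochner_integral_add has_bochner_integral_diff has_bochner_integral_divide_zero
        has_bochner_integral_sum has_bochner_integral_mult_right impI const I(1) has_bochner_integral_est \<rho>)
  have H0: "0 \<le> H \<phi>" for \<phi> using le[of \<phi>] by linarith
  then have J0: "0 \<le> J"
    using hbH integral_nonneg_AE[of H "noise eps (Aof \<rho>)"] by (auto simp: has_bochner_integral_iff)
  have "J \<le> step_bound ?P \<sigma> \<rho>"
  proof -
    have "(\<Sum>\<rho>'\<in>RS. weight \<pi> \<rho>' * I \<rho>') - 1 = (\<Sum>\<rho>'\<in>RS. weight \<pi> \<rho>' * (I \<rho>' - 1))"
      using sum_weight[OF \<pi>] by (simp add: algebra_simps sum_subtractf)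
    also have "\<dots> \<le> (\<Sum>\<rho>'\<in>RS. weight \<pi> \<rho>' * (- eta T eps * ?M \<rho>' + ?Q \<rho>'))"
      using I(2) weight_pos[OF \<pi>] by (intro sum_mono mult_left_mono) (force intro: less_imp_le)+
    finally have "((\<Sum>\<rho>'\<in>RS. weight \<pi> \<rho>' * I \<rho>') - 1) / eta T eps
        \<le> (\<Sum>\<rho>'\<in>RS. weight \<pi> \<rho>' * (- eta T eps * ?M \<rho>' + ?Q \<rho>')) / eta T eps"
      using eta by (intro divide_right_mono) auto
    also have "\<dots> = (\<Sum>\<rho>'\<in>RS. weight \<pi> \<rho>' * (- ?M \<rho>' + ?Q \<rho>' / eta T eps))"
      unfolding sum_divide_distrib using eta by (intro sum.cong) (auto simp: field_simps)
    also have "\<dots> = (\<Sum>\<rho>'\<in>RS. weight \<pi> \<rho>' * (- (\<Sum>a\<in>Aof \<rho>' \<inter> Aof \<rho>. leaf_loss lam \<mu> a / den T eps \<pi> a)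
        + (exp 1 - 2) * 9 / eps\<^sup>2 * eta T eps * (\<Sum>a\<in>Aof \<rho>' \<inter> Aof \<rho>. 1 / (den T eps \<pi> a)\<^sup>2)))"
      using eta by (simp add: power2_eq_square[of "eta T eps"] Int_commute[of "Aof \<rho>"] mult.assoc)
    finally show ?thesis by (simp add: J_def step_bound_def)
  qed
  then show "0 \<le> step_bound ?P \<sigma> \<rho>" using J0 by linarith
  have "(\<integral>\<^sup>+\<phi>. ennreal (L + Loss lam \<rho> \<mu> - ln (weight (update T eps \<pi> \<rho> (?d \<phi>)) \<sigma>) / eta T eps)
      \<partial>noise eps (Aof \<rho>)) \<le> (\<integral>\<^sup>+\<phi>. ennreal (H \<phi>) \<partial>noise eps (Aof \<rho>))"
    using le by (intro nn_integral_mono ennreal_leI) blast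
  also have "\<dots> = ennreal J"
    using hbH H0 by (subst nn_integral_eq_integral) (auto simp: has_bochner_integral_iff)
  also have "\<dots> \<le> ennreal (step_bound ?P \<sigma> \<rho>)" by (intro ennreal_leI) fact
  finally show "(\<integral>\<^sup>+\<phi>. ennreal (L + Loss lam \<rho> \<mu> - ln (weight (update T eps \<pi> \<rho> (?d \<phi>)) \<sigma>) / eta T eps)
      \<partial>noise eps (Aof \<rho>)) \<le> ennreal (step_bound ?P \<sigma> \<rho>)" .
qed

text \<open>Averaging replaces membership of \<open>a\<close> in the sampled strategy by q(a). Then
  q <= den shows that the comparator's estimated loss is at most its true loss on average and that
  each second-order term is at most k, while the played loss and the first-order term cancel up to
  the bias gamma beta(a) l(a).\<close>

lemma sum_step_bound:
  assumes \<sigma>: "\<sigma> \<in> RS"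
  shows "(\<Sum>\<rho>\<in>RS. weight \<pi> \<rho> * step_bound P \<sigma> \<rho>) \<le> P + Loss lam \<sigma> \<mu>
    + (gamma T eps + (exp 1 - 2) * 9 / eps\<^sup>2 * eta T eps) * real (card Aset)"
proof -
  let ?l = "leaf_loss lam \<mu>" and ?q = "reach \<pi>" and ?D = "den T eps \<pi>"
  define k where "k = (exp 1 - 2) * 9 / eps\<^sup>2 * eta T eps"
  have eta: "0 < eta T eps" using eta_pos T eps by simp
  have k: "0 \<le> k" using eta exp_1_gt_2 by (simp add: k_def)
  have fact_D: "0 < ?D a" "0 < ?q a" "?q a \<le> ?D a" if "a \<in> Aset" for a
    using den_pos reach_pos[OF \<pi>] den_ge_reach[of T eps a \<pi>] T eps that by auto
  \<comment> \<open>The first of the two averages, over the strategies inside Z; the second, over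
    the sampled strategy, follows below.\<close>
  have avg: "(\<Sum>\<rho>'\<in>RS. weight \<pi> \<rho>' * (- (\<Sum>a\<in>Aof \<rho>' \<inter> Aof \<rho>. ?l a / ?D a)
        + k * (\<Sum>a\<in>Aof \<rho>' \<inter> Aof \<rho>. 1 / (?D a)\<^sup>2)))
      = (\<Sum>a\<in>Aof \<rho> \<inter> Aset. ?q a * (- (?l a / ?D a) + k / (?D a)\<^sup>2))" for \<rho>
  proof -
    have "- (\<Sum>a\<in>Aof \<rho>' \<inter> Aof \<rho>. ?l a / ?D a) + k * (\<Sum>a\<in>Aof \<rho>' \<inter> Aof \<rho>. 1 / (?D a)\<^sup>2)
        = (\<Sum>a\<in>Aof \<rho>' \<inter> Aof \<rho>. - (?l a / ?D a) + k / (?D a)\<^sup>2)" for \<rho>'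
      by (simp add: sum_subtractf sum_distrib_left)
    then show ?thesis
      using sum_weight_sum_Aof[OF \<pi> Aof_subset, of "\<lambda>a. - (?l a / ?D a) + k / (?D a)\<^sup>2" \<rho>] Aof_subset[of \<rho>]
      by (simp add: Int_absorb2)
  qed
  have LossA: "Loss lam \<rho> \<mu> = (\<Sum>a\<in>Aof \<rho> \<inter> Aset. ?l a)" if "\<rho> \<in> RS" for \<rho>
    using Loss_eq_sum[OF that \<mu>] Aof_subset[of \<rho>] by (simp add: Int_absorb2)
  have "(\<Sum>\<rho>\<in>RS. weight \<pi> \<rho> * step_bound P \<sigma> \<rho>)
      = (\<Sum>\<rho>\<in>RS. weight \<pi> \<rho> * P + weight \<pi> \<rho> * (\<Sum>a\<in>Aof \<rho> \<inter> Aset. ?l a)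
        + weight \<pi> \<rho> * (\<Sum>a\<in>Aof \<rho> \<inter> Aof \<sigma>. ?l a / ?D a)
        + weight \<pi> \<rho> * (\<Sum>a\<in>Aof \<rho> \<inter> Aset. ?q a * (- (?l a / ?D a) + k / (?D a)\<^sup>2)))"
    unfolding step_bound_def k_def[symmetric] avg by (intro sum.cong) (auto simp: LossA algebra_simps)
  also have "\<dots> = P + (\<Sum>a\<in>Aset. ?q a * ?l a) + (\<Sum>a\<in>Aof \<sigma>. ?q a * (?l a / ?D a))
      + (\<Sum>a\<in>Aset. ?q a * (?q a * (- (?l a / ?D a) + k / (?D a)\<^sup>2)))"
    unfolding sum.distrib sum_weight_sum_Aof[OF \<pi> subset_refl] sum_weight_sum_Aof[OF \<pi> Aof_subset]
    using sum_weight[OF \<pi>] by (simp add: sum_distrib_right[symmetric])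
  finally have 1: "(\<Sum>\<rho>\<in>RS. weight \<pi> \<rho> * step_bound P \<sigma> \<rho>)
      = P + (\<Sum>a\<in>Aset. ?q a * ?l a) + (\<Sum>a\<in>Aof \<sigma>. ?q a * (?l a / ?D a))
      + (\<Sum>a\<in>Aset. ?q a * (?q a * (- (?l a / ?D a) + k / (?D a)\<^sup>2)))" .
  have 2: "(\<Sum>a\<in>Aof \<sigma>. ?q a * (?l a / ?D a)) \<le> Loss lam \<sigma> \<mu>"
    unfolding Loss_eq_sum[OF \<sigma> \<mu>]
  proof (rule sum_mono)
    fix a assume "a \<in> Aof \<sigma>"
    then have a: "a \<in> Aset" using Aof_subset by auto
    have "?q a * ?l a \<le> ?D a * ?l a"
      using fact_D[OF a] leaf_loss_bounds[OF lam \<mu>] by (intro mult_right_mono) auto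
    then show "?q a * (?l a / ?D a) \<le> ?l a" using fact_D[OF a] by (simp add: field_simps)
  qed
  have 3: "(\<Sum>a\<in>Aset. ?q a * (?q a * (- (?l a / ?D a) + k / (?D a)\<^sup>2)))
      \<le> (\<Sum>a\<in>Aset. - (?q a * ?l a) + gamma T eps * (beta a * ?l a) + k)"
  proof (rule sum_mono)
    fix a assume a: "a \<in> Aset"
    note f = fact_D[OF a]
    have g: "0 \<le> gamma T eps * (beta a * ?l a)"
      using gamma_nonneg[of T eps] T eps beta_pos[of a] a leaf_loss_bounds[OF lam \<mu>]
      by (intro mult_nonneg_nonneg) (auto intro: less_imp_le)
    have D: "gamma T eps * beta a = ?D a - ?q a" by (simp add: den_def)
    have "?q a / ?D a \<le> 1" using f by simp
    then have "?q a / ?D a * (gamma T eps * (beta a * ?l a)) \<le> gamma T eps * (beta a * ?l a)"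
      using g f by (intro mult_left_le_one_le) auto
    \<comment> \<open>With gamma beta = D - q, the gap between the played loss and its estimate is
      exactly the bias term damped by q / D <= 1.\<close>
    moreover have "?q a / ?D a * (gamma T eps * (beta a * ?l a)) = ?q a * ?l a - ?q a * (?q a * (?l a / ?D a))"
    proof -
      have "gamma T eps * (beta a * ?l a) = (?D a - ?q a) * ?l a" by (simp add: D[symmetric])
      then have "?q a / ?D a * (gamma T eps * (beta a * ?l a)) = ?q a / ?D a * ((?D a - ?q a) * ?l a)"
        by (simp only:)
      also have "\<dots> = ?q a * ?l a - ?q a * (?q a * (?l a / ?D a))" using f(1) by (simp add: field_simps)
      finally show ?thesis .
    qed
    moreover have "?q a * (?q a * (k / (?D a)\<^sup>2)) \<le> k"
    proof -
      have "(?q a / ?D a)\<^sup>2 * k \<le> 1 * k"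
        using f k by (intro mult_right_mono) (auto simp: power_le_one)
      then show ?thesis by (simp add: power2_eq_square)
    qed
    ultimately show "?q a * (?q a * (- (?l a / ?D a) + k / (?D a)\<^sup>2))
        \<le> - (?q a * ?l a) + gamma T eps * (beta a * ?l a) + k"
      unfolding distrib_left by linarith
  qed
  have 4: "(\<Sum>a\<in>Aset. - (?q a * ?l a) + gamma T eps * (beta a * ?l a) + k)
      = - (\<Sum>a\<in>Aset. ?q a * ?l a) + gamma T eps * (\<Sum>a\<in>Aset. beta a * ?l a) + k * real (card Aset)"
    by (simp add: sum.distrib sum_subtractf sum_distrib_left)
  have 5: "gamma T eps * (\<Sum>a\<in>Aset. beta a * ?l a) \<le> gamma T eps * real (card Aset)"
    using sum_beta_leaf_loss[OF lam \<mu>] gamma_nonneg[of T eps] T eps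
    by (intro mult_left_mono) (auto simp: m_root)
  show ?thesis unfolding k_def[symmetric] distrib_right using 1 2 3 4 5 by linarith
qed

lemma potential_step:
  assumes \<sigma>: "\<sigma> \<in> RS" and L: "0 \<le> L"
  shows "(\<Sum>\<rho>\<in>RS. ennreal (weight \<pi> \<rho>) * (\<integral>\<^sup>+\<phi>. ennreal (L + Loss lam \<rho> \<mu>
        - ln (weight (update T eps \<pi> \<rho> (dvec lam \<rho> \<mu> \<phi>)) \<sigma>) / eta T eps) \<partial>noise eps (Aof \<rho>)))
    \<le> ennreal (L - ln (weight \<pi> \<sigma>) / eta T eps + (Loss lam \<sigma> \<mu>
        + (gamma T eps + (exp 1 - 2) * 9 / eps\<^sup>2 * eta T eps) * real (card Aset)))"
    (is "?lhs \<le> _")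
proof -
  let ?U = "step_bound (L - ln (weight \<pi> \<sigma>) / eta T eps) \<sigma>"
  have "?lhs \<le> (\<Sum>\<rho>\<in>RS. ennreal (weight \<pi> \<rho>) * ennreal (?U \<rho>))"
    using nn_integral_potential_noise(1)[OF _ \<sigma> L] by (intro sum_mono mult_left_mono) auto
  also have "\<dots> = (\<Sum>\<rho>\<in>RS. ennreal (weight \<pi> \<rho> * ?U \<rho>))"
    using weight_pos[OF \<pi>] nn_integral_potential_noise(2)[OF _ \<sigma> L]
    by (intro sum.cong) (auto simp: ennreal_mult less_imp_le)
  also have "\<dots> = ennreal (\<Sum>\<rho>\<in>RS. weight \<pi> \<rho> * ?U \<rho>)"
    using weight_pos[OF \<pi>] nn_integral_potential_noise(2)[OF _ \<sigma> L]
    by (intro sum_ennreal) (auto simp: less_imp_le)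
  finally show ?thesis
    using sum_step_bound[OF \<sigma>, of "L - ln (weight \<pi> \<sigma>) / eta T eps"]
    by (elim order_trans) (auto intro!: ennreal_leI simp: add.assoc)
qed

end

end

section \<open>The process\<close>

text \<open>\<open>bind\<close> is defined through \<open>distr\<close>, which looks only at
  preimages of measurable sets. Since \<open>f\<close> sends \<open>E\<close> outside the target
  space, these preimages miss \<open>E\<close>, and so they agree with those of \<open>g\<close> up
  to a null set, although \<open>f\<close> itself may fail to be measurable.\<close>

lemma bind_cong_null_set:
  assumes g: "g \<in> measurable M (subprob_algebra N)" and E: "E \<in> null_sets M"
    and eq: "\<And>x. x \<in> space M - E \<Longrightarrow> f x = g x"
    and out: "\<And>x. x \<in> E \<Longrightarrow> f x \<notin> space (subprob_algebra N)"
    and sets: "\<And>x. x \<in> space M \<Longrightarrow> sets (f x) = sets N"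
  shows "bind M f = bind M g"
proof (cases "space M = {}")
  case False
  \<comment> \<open>The definition of \<open>bind\<close> reads its target algebra off an arbitrary
    point, which may lie in \<open>E\<close>. The hypothesis on \<open>sets\<close> makes the
    algebra the same at every point.\<close>
  define x where "x = (SOME x. x \<in> space M)"
  have x: "x \<in> space M" unfolding x_def using False by (simp add: some_in_eq)
  let ?K = "subprob_algebra N"
  have K: "subprob_algebra (f x) = ?K" "subprob_algebra (g x) = ?K"
    using sets[OF x] sets_kernel[OF g x] by (auto intro: subprob_algebra_cong)
  have "distr M ?K f = distr M ?K g"
    unfolding distr_def
  proof (rule measure_of_eq[OF sets.space_closed])
    fix X assume "X \<in> sigma_sets (space ?K) (sets ?K)"
    then have X: "X \<in> sets ?K" by (simp add: sets.sigma_sets_eq)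
    then have "f -` X \<inter> space M = (g -` X \<inter> space M) - E"
      using eq out sets.sets_into_space[OF X] null_setsD2[OF E] sets.sets_into_space by fastforce
    then show "emeasure M (f -` X \<inter> space M) = emeasure M (g -` X \<inter> space M)"
      using emeasure_Diff_null_set[OF E measurable_sets[OF g X]] by simp
  qed
  then show ?thesis using False by (simp add: bind_def x_def[symmetric] K)
qed (simp add: bind_def)

context game_tree
begin

section \<open>Measurability and integrals of one trial\<close>

lemma sets_noise: "sets (noise eps I) = sets (\<Pi>\<^sub>M a\<in>I. (borel :: real measure))"
  by (rule sets_PiM_cong) auto

text \<open>Outside \<open>I\<close> a coordinate is constantly \<open>undefined\<close> on the
  product space, so no membership condition on the coordinate arises.\<close>

lemma measurable_apply_PiM:
  "(\<lambda>f :: 'v \<Rightarrow> real. f a) \<in> borel_measurable (\<Pi>\<^sub>M a\<in>I. (borel :: real measure))"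
proof (cases "a \<in> I")
  case False
  then have "f a = undefined" if "f \<in> space (\<Pi>\<^sub>M a\<in>I. (borel :: real measure))" for f :: "'v \<Rightarrow> real"
    using that by (auto simp: space_PiM PiE_def extensional_def)
  then show ?thesis by (subst measurable_cong[where g = "\<lambda>_. undefined"]) auto
qed auto

lemma measurable_state_fst [measurable]: "fst \<in> borel_measurable state_space"
  unfolding state_space_def by simp

lemma measurable_state_snd:
  "f \<in> measurable M state_space \<Longrightarrow> (\<lambda>x. snd (f x) a) \<in> borel_measurable M"
  using measurable_compose[OF measurable_compose[OF _ measurable_snd] measurable_apply_PiM, of f M borel Aset a]
  by (simp add: state_space_def)

lemma measurable_weight [measurable]:
  "(\<lambda>s. weight (snd s) \<rho>) \<in> borel_measurable state_space"
  unfolding weight_def by (intro borel_measurable_prod measurable_state_snd measurable_ident_sets refl)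

definition step :: "('v \<Rightarrow> real) \<Rightarrow> nat \<Rightarrow> real \<Rightarrow> ('v \<Rightarrow> 'v) \<Rightarrow> ('v \<rightharpoonup> 'v)
    \<Rightarrow> real \<times> ('v \<Rightarrow> real) \<Rightarrow> ('v \<Rightarrow> real) \<Rightarrow> real \<times> ('v \<Rightarrow> real)" where
  "step lam T eps \<mu> \<rho> s \<phi> = (fst s + Loss lam \<rho> \<mu>, update T eps (snd s) \<rho> (dvec lam \<rho> \<mu> \<phi>))"

lemma measurable_psi:
  assumes \<rho>: "\<rho> \<in> RS" and \<pi>: "\<And>a. (\<lambda>x. \<pi> x a) \<in> borel_measurable M"
    and d: "\<And>a. (\<lambda>x. d x a) \<in> borel_measurable M"
  shows "v \<in> Nof \<rho> \<Longrightarrow> (\<lambda>x. psi T eps (\<pi> x) \<rho> (d x) v) \<in> borel_measurable M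
    \<and> (\<lambda>x. omega T eps (\<pi> x) \<rho> (d x) v) \<in> borel_measurable M"
proof (induction v rule: wf_induct_rule[OF wf_trancl[OF wf_childR]])
  case (1 v)
  note bC = RS_choice(2)[OF \<rho> 1(2)]
  have "(\<lambda>x. psi T eps (\<pi> x) \<rho> (d x) u) \<in> borel_measurable M" if "u \<in> C (the (\<rho> v)) \<inter> Nset" for u
  proof -
    have "(u, v) \<in> childR\<^sup>+"
      using that bC by (meson IntD1 childR_iff trancl.r_into_trancl trancl.trancl_into_trancl)
    moreover have "u \<in> Nof \<rho>"
      using that choice_in_Aof[OF \<rho> 1(2)] Nof_iff[OF \<rho>, of u] by (auto simp: C_iff)
    ultimately show ?thesis using 1 by blast
  qed
  then have om: "(\<lambda>x. omega T eps (\<pi> x) \<rho> (d x) v) \<in> borel_measurable M"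
    unfolding omega_choice[OF \<rho> 1(2)] den_def reach_def xarg_def
    by (intro borel_measurable_times borel_measurable_prod measurable_compose[OF _ borel_measurable_exp]
        borel_measurable_uminus borel_measurable_divide borel_measurable_add borel_measurable_const \<pi> d)
  then show ?case
    unfolding psi_rec[OF \<rho> 1(2)] using \<pi> by auto
qed

lemma measurable_step:
  assumes \<rho>: "\<rho> \<in> RS"
  shows "(\<lambda>(s, \<phi>). step lam T eps \<mu> \<rho> s \<phi>) \<in> measurable (state_space \<Otimes>\<^sub>M noise eps (Aof \<rho>)) state_space"
proof -
  let ?M = "state_space \<Otimes>\<^sub>M noise eps (Aof \<rho>)"
  have \<pi>: "(\<lambda>x. snd (fst x) a) \<in> borel_measurable ?M" for a
    by (rule measurable_state_snd) simp
  have "(\<lambda>x. snd x a) \<in> borel_measurable (state_space \<Otimes>\<^sub>M (\<Pi>\<^sub>M a\<in>Aof \<rho>. (borel :: real measure)))" for a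
    by (rule measurable_compose[OF measurable_snd measurable_apply_PiM])
  then have \<phi>: "(\<lambda>x. snd x a) \<in> borel_measurable ?M" for a
    by (subst measurable_cong_sets[OF sets_pair_measure_cong[OF refl sets_noise] refl])
  then have d: "(\<lambda>x. dvec lam \<rho> \<mu> (snd x) a) \<in> borel_measurable ?M" for a
    unfolding dvec_def by simp
  have fst': "(\<lambda>x. fst (fst x) + Loss lam \<rho> \<mu>) \<in> borel_measurable ?M"
    by (intro borel_measurable_add measurable_compose[OF measurable_fst measurable_state_fst] borel_measurable_const)
  have "(\<lambda>x. update T eps (snd (fst x)) \<rho> (dvec lam \<rho> \<mu> (snd x))) \<in> measurable ?M (\<Pi>\<^sub>M a\<in>Aset. borel)"
    unfolding update_def
  proof (rule measurable_restrict)
    fix a assume "a \<in> Aset"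
    show "(\<lambda>x. if par a \<in> Nof \<rho> then (if a = the (\<rho> (par a))
          then omega T eps (snd (fst x)) \<rho> (dvec lam \<rho> \<mu> (snd x)) (par a) * snd (fst x) a
          else snd (fst x) a) / psi T eps (snd (fst x)) \<rho> (dvec lam \<rho> \<mu> (snd x)) (par a)
        else snd (fst x) a) \<in> borel_measurable ?M"
    proof (cases "par a \<in> Nof \<rho>")
      case True
      note ps = measurable_psi[where \<pi> = "\<lambda>x. snd (fst x)" and d = "\<lambda>x. dvec lam \<rho> \<mu> (snd x)", OF \<rho> \<pi> d True]
      show ?thesis using ps[THEN conjunct1, of T eps] ps[THEN conjunct2, of T eps] \<pi>
        by (cases "a = the (\<rho> (par a))") (auto simp: True)
    qed (simp add: \<pi>)
  qed
  from measurable_Pair[OF fst' this] show ?thesis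
    unfolding step_def split_beta' state_space_def .
qed

lemma measurable_step_noise:
  "\<rho> \<in> RS \<Longrightarrow> s \<in> space state_space \<Longrightarrow>
    step lam T eps \<mu> \<rho> s \<in> measurable (noise eps (Aof \<rho>)) state_space"
  using measurable_compose[OF measurable_Pair1' measurable_step[of \<rho> lam T eps \<mu>], of s] by simp

context
  fixes lam :: "'v \<Rightarrow> real" and T :: nat and eps :: real
  assumes eps: "0 < eps"
begin

lemma trial_alt:
  assumes s: "s \<in> space state_space"
  shows "trial lam T eps \<mu> s = sample_strategy (snd s) \<bind>
      (\<lambda>\<rho>. distr (noise eps (Aof \<rho>)) state_space (step lam T eps \<mu> \<rho> s))"
proof -
  have "noise eps (Aof \<rho>) \<bind> (\<lambda>\<phi>. return state_space (fst s + Loss lam \<rho> \<mu>,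
      update T eps (snd s) \<rho> (dvec lam \<rho> \<mu> \<phi>)))
      = distr (noise eps (Aof \<rho>)) state_space (step lam T eps \<mu> \<rho> s)" if "\<rho> \<in> RS" for \<rho>
    using bind_return_distr'[OF prob_space.not_empty[OF prob_space_noise[OF eps]] measurable_step_noise[OF that s]]
    by (simp add: step_def)
  then show ?thesis
    unfolding trial_def split_beta
    by (intro bind_cong refl) (auto simp: sample_strategy_def)
qed

lemma measurable_step_kernel:
  assumes s: "s \<in> space state_space"
  shows "(\<lambda>\<rho>. distr (noise eps (Aof \<rho>)) state_space (step lam T eps \<mu> \<rho> s))
    \<in> measurable (sample_strategy \<pi>) (subprob_algebra state_space)"
proof -
  have "distr (noise eps (Aof \<rho>)) state_space (step lam T eps \<mu> \<rho> s) \<in> space (subprob_algebra state_space)"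
    if "\<rho> \<in> RS" for \<rho>
    using prob_space.prob_space_distr[OF prob_space_noise[OF eps] measurable_step_noise[OF that s]]
    by (auto simp: space_subprob_algebra intro: prob_space_imp_subprob_space)
  then show ?thesis by (auto simp: sample_strategy_def)
qed

lemma space_sample_strategy: "space (sample_strategy \<pi>) = RS"
  by (simp add: sample_strategy_def)

lemma sets_trial:
  assumes "s \<in> space state_space" shows "sets (trial lam T eps \<mu> s) = sets state_space"
  unfolding trial_alt[OF assms] using RS_nonempty by (intro sets_bind) (auto simp: space_sample_strategy)

text \<open>Because it holds at every state, including policies whose weights do not sum to 1, this
  formula also yields measurability in \<open>s\<close> on the whole state space.\<close>

lemma nn_integral_trial:
  assumes s: "s \<in> space state_space" and F: "F \<in> borel_measurable state_space"
  shows "(\<integral>\<^sup>+x. F x \<partial>trial lam T eps \<mu> s)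
    = (\<Sum>\<rho>\<in>RS. ennreal (weight (snd s) \<rho>) * (\<integral>\<^sup>+\<phi>. F (step lam T eps \<mu> \<rho> s \<phi>) \<partial>noise eps (Aof \<rho>)))"
proof -
  have "(\<integral>\<^sup>+x. F x \<partial>trial lam T eps \<mu> s) = (\<integral>\<^sup>+\<rho>. \<integral>\<^sup>+x. F x
      \<partial>distr (noise eps (Aof \<rho>)) state_space (step lam T eps \<mu> \<rho> s) \<partial>sample_strategy (snd s))"
    unfolding trial_alt[OF s] by (rule nn_integral_bind[OF F measurable_step_kernel[OF s]])
  also have "\<dots> = (\<integral>\<^sup>+\<rho>. \<integral>\<^sup>+\<phi>. F (step lam T eps \<mu> \<rho> s \<phi>) \<partial>noise eps (Aof \<rho>) \<partial>sample_strategy (snd s))"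
    using F by (intro nn_integral_cong nn_integral_distr measurable_step_noise s)
      (auto simp: space_sample_strategy)
  finally show ?thesis
    unfolding sample_strategy_def weight_def
    by (simp add: nn_integral_density nn_integral_count_space_finite[OF finite_RS])
qed

lemma emeasure_trial_space:
  assumes s: "s \<in> space state_space"
  shows "emeasure (trial lam T eps \<mu> s) (space state_space) = (\<Sum>\<rho>\<in>RS. ennreal (weight (snd s) \<rho>))"
proof -
  have sp: "space (trial lam T eps \<mu> s) = space state_space"
    using sets_trial[OF s] by (rule sets_eq_imp_space_eq)
  have "emeasure (trial lam T eps \<mu> s) (space state_space) = (\<integral>\<^sup>+x. 1 \<partial>trial lam T eps \<mu> s)"
    by (simp add: sp[symmetric])
  also have "\<dots> = (\<Sum>\<rho>\<in>RS. ennreal (weight (snd s) \<rho>))"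
    unfolding nn_integral_trial[OF s borel_measurable_const]
    using prob_space.emeasure_space_1[OF prob_space_noise[OF eps]] by simp
  finally show ?thesis .
qed

lemma measurable_nn_integral_trial:
  assumes F: "F \<in> borel_measurable state_space"
  shows "(\<lambda>s. \<integral>\<^sup>+x. F x \<partial>trial lam T eps \<mu> s) \<in> borel_measurable state_space"
proof -
  have "(\<lambda>s. \<integral>\<^sup>+\<phi>. F (step lam T eps \<mu> \<rho> s \<phi>) \<partial>noise eps (Aof \<rho>)) \<in> borel_measurable state_space"
    if "\<rho> \<in> RS" for \<rho>
  proof -
    interpret prob_space "noise eps (Aof \<rho>)" by (rule prob_space_noise[OF eps])
    have "(\<lambda>(s, \<phi>). F (step lam T eps \<mu> \<rho> s \<phi>)) \<in> borel_measurable (state_space \<Otimes>\<^sub>M noise eps (Aof \<rho>))"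
      using measurable_compose[OF measurable_step[OF that] F] by (simp add: split_beta')
    then show ?thesis by (rule borel_measurable_nn_integral)
  qed
  then have "(\<lambda>s. \<Sum>\<rho>\<in>RS. ennreal (weight (snd s) \<rho>) *
      (\<integral>\<^sup>+\<phi>. F (step lam T eps \<mu> \<rho> s \<phi>) \<partial>noise eps (Aof \<rho>))) \<in> borel_measurable state_space"
    by (intro borel_measurable_sum borel_measurable_times_ennreal) auto
  then show ?thesis
    by (subst measurable_cong[OF nn_integral_trial[OF _ F]]) auto
qed

text \<open>For junk policies with total weight above 1, \<^const>\<open>trial\<close> leaves the space of
  subprobability measures and is therefore not a kernel; the truncated variant is one, and the
  process never visits the states where they differ.\<close>

definition trial_trunc :: "('v \<Rightarrow> 'v) \<Rightarrow> real \<times> ('v \<Rightarrow> real) \<Rightarrow> (real \<times> ('v \<Rightarrow> real)) measure" where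
  "trial_trunc \<mu> s = (if (\<Sum>\<rho>\<in>RS. ennreal (weight (snd s) \<rho>)) \<le> 1 then trial lam T eps \<mu> s
    else null_measure state_space)"

lemma space_state_space_ne: "space state_space \<noteq> {}"
  by (simp add: state_space_def space_pair_measure space_PiM PiE_eq_empty_iff)

lemma measurable_trial_trunc:
  "trial_trunc \<mu> \<in> measurable state_space (subprob_algebra state_space)"
proof (rule measurable_subprob_algebra)
  fix s assume s: "s \<in> space state_space"
  show "sets (trial_trunc \<mu> s) = sets state_space"
    using sets_trial[OF s] by (simp add: trial_trunc_def)
  have sp: "space (trial lam T eps \<mu> s) = space state_space"
    using sets_trial[OF s] by (rule sets_eq_imp_space_eq)
  show "subprob_space (trial_trunc \<mu> s)"
    using space_state_space_ne emeasure_trial_space[OF s, of \<mu>]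
    by (auto simp: trial_trunc_def sp intro!: subprob_spaceI subprob_space_null_measure)
next
  fix A assume A: "A \<in> sets state_space"
  have "(\<lambda>s. if (\<Sum>\<rho>\<in>RS. ennreal (weight (snd s) \<rho>)) \<le> 1
      then \<integral>\<^sup>+x. indicator A x \<partial>trial lam T eps \<mu> s else 0) \<in> borel_measurable state_space"
    using A by (intro measurable_If measurable_nn_integral_trial) auto
  moreover have "emeasure (trial_trunc \<mu> s) A = (if (\<Sum>\<rho>\<in>RS. ennreal (weight (snd s) \<rho>)) \<le> 1
      then \<integral>\<^sup>+x. indicator A x \<partial>trial lam T eps \<mu> s else 0)" if "s \<in> space state_space" for s
    using sets_trial[OF that] A by (simp add: trial_trunc_def)
  ultimately show "(\<lambda>s. emeasure (trial_trunc \<mu> s) A) \<in> borel_measurable state_space"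
    by (subst measurable_cong) auto
qed

section \<open>Valid states, and integrals over a whole run\<close>

definition valid :: "real \<times> ('v \<Rightarrow> real) \<Rightarrow> bool" where
  "valid s \<longleftrightarrow> policy (snd s) \<and> 0 \<le> fst s"

lemma measurable_valid [measurable]: "Measurable.pred state_space valid"
proof -
  have [measurable]: "(\<lambda>s. snd s a) \<in> borel_measurable state_space" for a
    by (rule measurable_state_snd) simp
  show ?thesis
    unfolding valid_def policy_def
    by (intro pred_intros_logic pred_intros_finite finite_Nset finite_Aset) measurable
qed

lemma trial_trunc_valid:
  assumes "valid s" shows "trial_trunc \<mu> s = trial lam T eps \<mu> s"
proof -
  have p: "policy (snd s)" using assms by (simp add: valid_def)
  have "(\<Sum>\<rho>\<in>RS. ennreal (weight (snd s) \<rho>)) = ennreal (\<Sum>\<rho>\<in>RS. weight (snd s) \<rho>)"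
    using weight_pos[OF p] by (intro sum_ennreal) (auto simp: less_imp_le)
  then show ?thesis using sum_weight[OF p] by (simp add: trial_trunc_def)
qed

context
  fixes \<mu> :: "nat \<Rightarrow> 'v \<Rightarrow> 'v"
  assumes lam: "\<forall>u\<in>leaves. 0 \<le> lam u \<and> lam u \<le> 1" and \<mu>: "\<forall>t\<in>{1..T}. environment (\<mu> t)"
begin

lemma AE_trial_valid:
  assumes s: "s \<in> space state_space" "valid s" and env: "environment \<nu>"
  shows "AE x in trial lam T eps \<nu> s. valid x"
proof -
  have v: "valid (step lam T eps \<nu> \<rho> s \<phi>)" if "\<rho> \<in> RS" for \<rho> \<phi>
    using s(2) that policy_update[of "snd s" \<rho>] Loss_bounds(1)[OF lam env that]
    by (simp add: valid_def step_def)
  let ?E = "{x \<in> space state_space. \<not> valid x}"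
  have E: "?E \<in> sets state_space" by measurable
  have sp: "space (trial lam T eps \<nu> s) = space state_space"
    using sets_trial[OF s(1)] by (rule sets_eq_imp_space_eq)
  have "emeasure (trial lam T eps \<nu> s) ?E = (\<integral>\<^sup>+x. indicator ?E x \<partial>trial lam T eps \<nu> s)"
    using E sets_trial[OF s(1)] by simp
  also have "\<dots> = 0"
    using E v by (subst nn_integral_trial[OF s(1)]) auto
  finally show ?thesis
    using E sets_trial[OF s(1)] by (subst AE_iff_measurable[of ?E]) (auto simp: sp)
qed

lemma initial_state: "(0, pi1) \<in> space state_space" "valid (0, pi1)"
  using policy_pi1 by (auto simp: valid_def state_space_def space_pair_measure space_PiM pi1_def)

text \<open>Validity almost everywhere at stage k permits replacing \<open>trial\<close> by the
  kernel \<open>trial_trunc\<close> under \<open>bind\<close>; the facts about binding with kernels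
  then give all claims at stage k + 1.\<close>

lemma run_invariant:
  assumes "k \<le> T"
  shows "sets (run lam T eps \<mu> k) = sets state_space" "subprob_space (run lam T eps \<mu> k)"
    "AE s in run lam T eps \<mu> k. valid s"
    "k < T \<Longrightarrow> run lam T eps \<mu> (Suc k) = run lam T eps \<mu> k \<bind> trial_trunc (\<mu> (Suc k))"
proof -
  have bind: "M \<bind> trial lam T eps \<nu> = M \<bind> trial_trunc \<nu>"
    if M: "sets M = sets state_space" and AE: "AE s in M. valid s" for M \<nu>
  \<comment> \<open>The exceptional set consists of the states whose total weight exceeds 1. Valid
    states have total weight exactly 1, and on the exceptional set \<open>trial\<close> has mass
    above 1, hence is no subprobability measure.\<close>
  proof (rule bind_cong_null_set[where E = "{s \<in> space state_space. \<not> (\<Sum>\<rho>\<in>RS. ennreal (weight (snd s) \<rho>)) \<le> 1}"])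
    let ?E = "{s \<in> space state_space. \<not> (\<Sum>\<rho>\<in>RS. ennreal (weight (snd s) \<rho>)) \<le> 1}"
    have sp: "space M = space state_space" using M by (rule sets_eq_imp_space_eq)
    show "trial_trunc \<nu> \<in> measurable M (subprob_algebra state_space)"
      using measurable_trial_trunc by (simp add: measurable_cong_sets[OF M refl])
    have E: "?E \<in> sets state_space" by measurable
    have "AE s in M. (\<Sum>\<rho>\<in>RS. ennreal (weight (snd s) \<rho>)) \<le> 1"
      using AE
    proof eventually_elim
      case (elim s)
      then have p: "policy (snd s)" by (simp add: valid_def)
      have "(\<Sum>\<rho>\<in>RS. ennreal (weight (snd s) \<rho>)) = ennreal (\<Sum>\<rho>\<in>RS. weight (snd s) \<rho>)"
        using weight_pos[OF p] by (intro sum_ennreal) (auto simp: less_imp_le)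
      then show ?case using sum_weight[OF p] by simp
    qed
    then have "emeasure M ?E = 0"
      using E M by (subst (asm) AE_iff_measurable[of ?E]) (auto simp: sp)
    then show "?E \<in> null_sets M" using E M by auto
    show "trial lam T eps \<nu> s = trial_trunc \<nu> s" if "s \<in> space M - ?E" for s
      using that by (auto simp: trial_trunc_def sp)
    show "sets (trial lam T eps \<nu> s) = sets state_space" if "s \<in> space M" for s
      using that sets_trial by (simp add: sp)
    show "trial lam T eps \<nu> s \<notin> space (subprob_algebra state_space)" if "s \<in> ?E" for s
    proof
      assume "trial lam T eps \<nu> s \<in> space (subprob_algebra state_space)"
      then have "emeasure (trial lam T eps \<nu> s) (space state_space) \<le> 1"
        by (auto simp: space_subprob_algebra intro: subprob_space.subprob_emeasure_le_1)
      then show False using that emeasure_trial_space[of s \<nu>] by simp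
    qed
  qed
  have "sets (run lam T eps \<mu> k) = sets state_space \<and> subprob_space (run lam T eps \<mu> k)
      \<and> (AE s in run lam T eps \<mu> k. valid s)"
    using assms
  proof (induction k)
    case 0
    then show ?case unfolding run.simps(1)
      using initial_state AE_return[OF initial_state(1) measurable_valid] subprob_space_return[OF initial_state(1)]
      by simp
  next
    case (Suc k)
    let ?M = "run lam T eps \<mu> k"
    have IH: "sets ?M = sets state_space" "subprob_space ?M" "AE s in ?M. valid s"
      using Suc by auto
    have sp: "space ?M = space state_space" using IH(1) by (rule sets_eq_imp_space_eq)
    have K: "trial_trunc (\<mu> (Suc k)) \<in> measurable ?M (subprob_algebra state_space)"
      using measurable_trial_trunc by (simp add: measurable_cong_sets[OF IH(1) refl])
    have eq: "run lam T eps \<mu> (Suc k) = ?M \<bind> trial_trunc (\<mu> (Suc k))"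
      using bind[OF IH(1,3)] by simp
    have env: "environment (\<mu> (Suc k))" using \<mu> Suc.prems by auto
    have "AE s in ?M. AE x in trial_trunc (\<mu> (Suc k)) s. valid x"
      using IH(3) AE_space
    proof eventually_elim
      case (elim s)
      then show ?case
        unfolding trial_trunc_valid[OF elim(1)] using AE_trial_valid[of s, OF _ _ env] by (simp add: sp)
    qed
    then have "AE s in ?M \<bind> trial_trunc (\<mu> (Suc k)). valid s"
      by (subst AE_bind[OF K measurable_valid])
    moreover have "sets (?M \<bind> trial_trunc (\<mu> (Suc k))) = sets state_space"
      using sets_bind_measurable[OF K] space_state_space_ne by (simp add: sp)
    moreover have "subprob_space (?M \<bind> trial_trunc (\<mu> (Suc k)))"
      by (rule subprob_space_bind[OF IH(2) K])
    ultimately show ?case unfolding eq by blast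
  qed
  then show "sets (run lam T eps \<mu> k) = sets state_space" "subprob_space (run lam T eps \<mu> k)"
    "AE s in run lam T eps \<mu> k. valid s"
    "k < T \<Longrightarrow> run lam T eps \<mu> (Suc k) = run lam T eps \<mu> k \<bind> trial_trunc (\<mu> (Suc k))"
    using bind by auto
qed

text \<open>A drift argument: if each trial raises the conditional expectation of F by at most c t,
  then the run raises it by at most their sum. It is applied to the accumulated loss and to the
  potential.\<close>

lemma nn_integral_run_le:
  assumes F: "F \<in> borel_measurable state_space"
    and step: "\<And>t s. t \<in> {1..T} \<Longrightarrow> s \<in> space state_space \<Longrightarrow> valid s \<Longrightarrow>
      (\<Sum>\<rho>\<in>RS. ennreal (weight (snd s) \<rho>) * (\<integral>\<^sup>+\<phi>. F (step lam T eps (\<mu> t) \<rho> s \<phi>) \<partial>noise eps (Aof \<rho>)))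
        \<le> F s + c t"
  shows "k \<le> T \<Longrightarrow> (\<integral>\<^sup>+s. F s \<partial>run lam T eps \<mu> k) \<le> F (0, pi1) + (\<Sum>t=1..k. c t)"
proof (induction k)
  case 0
  then show ?case using nn_integral_return[OF initial_state(1) F] by simp
next
  case (Suc k)
  let ?M = "run lam T eps \<mu> k"
  have k: "k \<le> T" "k < T" using Suc by auto
  note inv = run_invariant[OF k(1)]
  have sp: "space ?M = space state_space" using inv(1) by (rule sets_eq_imp_space_eq)
  have K: "trial_trunc (\<mu> (Suc k)) \<in> measurable ?M (subprob_algebra state_space)"
    using measurable_trial_trunc by (simp add: measurable_cong_sets[OF inv(1) refl])
  have F': "F \<in> borel_measurable ?M" using F by (simp add: measurable_cong_sets[OF inv(1) refl])
  have "(\<integral>\<^sup>+s. F s \<partial>run lam T eps \<mu> (Suc k)) = (\<integral>\<^sup>+s. \<integral>\<^sup>+x. F x \<partial>trial_trunc (\<mu> (Suc k)) s \<partial>?M)"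
    unfolding inv(4)[OF k(2)] by (rule nn_integral_bind[OF F K])
  also have "\<dots> \<le> (\<integral>\<^sup>+s. F s + c (Suc k) \<partial>?M)"
  proof (rule nn_integral_mono_AE)
    show "AE s in ?M. (\<integral>\<^sup>+x. F x \<partial>trial_trunc (\<mu> (Suc k)) s) \<le> F s + c (Suc k)"
      using inv(3) AE_space
    proof eventually_elim
      case (elim s)
      then show ?case
        using step[of "Suc k" s] k by (simp add: trial_trunc_valid nn_integral_trial[OF _ F] sp)
    qed
  qed
  also have "\<dots> = (\<integral>\<^sup>+s. F s \<partial>?M) + c (Suc k) * emeasure ?M (space ?M)"
    using F' by (simp add: nn_integral_add)
  also have "\<dots> \<le> (F (0, pi1) + (\<Sum>t=1..k. c t)) + c (Suc k) * 1"
    using Suc.IH[OF k(1)] subprob_space.emeasure_space_le_1[OF inv(2)]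
    by (intro add_mono mult_left_mono) auto
  finally show ?case by (simp add: add.assoc)
qed

text \<open>The accumulated loss is nonnegative almost everywhere, so its Bochner integral can be
  read off the extended nonnegative one.\<close>

lemma expected_total_loss_le:
  assumes "(\<integral>\<^sup>+s. ennreal (fst s) \<partial>run lam T eps \<mu> T) \<le> ennreal b" "0 \<le> b"
  shows "expected_total_loss lam T eps \<mu> \<le> b"
proof -
  note inv = run_invariant[OF order_refl]
  have "fst \<in> borel_measurable (run lam T eps \<mu> T)"
    using measurable_state_fst by (simp add: measurable_cong_sets[OF inv(1) refl])
  moreover have "AE s in run lam T eps \<mu> T. 0 \<le> fst s"
    using inv(3) by eventually_elim (simp add: valid_def)
  ultimately have "expected_total_loss lam T eps \<mu> = enn2real (\<integral>\<^sup>+s. ennreal (fst s) \<partial>run lam T eps \<mu> T)"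
    unfolding expected_total_loss_def by (rule integral_eq_nn_integral)
  also have "\<dots> \<le> enn2real (ennreal b)" using assms(1) by (intro enn2real_mono) auto
  finally show ?thesis using assms(2) by simp
qed

lemma expected_total_loss_le_T: "expected_total_loss lam T eps \<mu> \<le> real T"
proof (rule expected_total_loss_le)
  have "(\<integral>\<^sup>+s. ennreal (fst s) \<partial>run lam T eps \<mu> T) \<le> ennreal (fst (0, pi1)) + (\<Sum>t=1..T. 1)"
  proof (rule nn_integral_run_le[OF _ _ order_refl])
    fix t s assume t: "t \<in> {1..T}" and s: "s \<in> space state_space" "valid s"
    have env: "environment (\<mu> t)" using \<mu> t by blast
    have p: "policy (snd s)" "0 \<le> fst s" using s by (auto simp: valid_def)
    have "(\<Sum>\<rho>\<in>RS. ennreal (weight (snd s) \<rho>)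
          * (\<integral>\<^sup>+\<phi>. ennreal (fst (step lam T eps (\<mu> t) \<rho> s \<phi>)) \<partial>noise eps (Aof \<rho>)))
        \<le> (\<Sum>\<rho>\<in>RS. ennreal (weight (snd s) \<rho>) * ennreal (fst s + 1))"
    proof (intro sum_mono mult_left_mono)
      fix \<rho> assume "\<rho> \<in> RS"
      then have "(\<integral>\<^sup>+\<phi>. ennreal (fst (step lam T eps (\<mu> t) \<rho> s \<phi>)) \<partial>noise eps (Aof \<rho>))
          \<le> (\<integral>\<^sup>+\<phi>. ennreal (fst s + 1) \<partial>noise eps (Aof \<rho>))"
        using Loss_bounds(2)[OF lam env] by (intro nn_integral_mono ennreal_leI) (auto simp: step_def)
      then show "(\<integral>\<^sup>+\<phi>. ennreal (fst (step lam T eps (\<mu> t) \<rho> s \<phi>)) \<partial>noise eps (Aof \<rho>)) \<le> ennreal (fst s + 1)"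
        using prob_space.emeasure_space_1[OF prob_space_noise[OF eps]] by simp
    qed simp
    also have "\<dots> = ennreal (\<Sum>\<rho>\<in>RS. weight (snd s) \<rho>) * ennreal (fst s + 1)"
      using weight_pos[OF p(1)] by (simp add: sum_distrib_right[symmetric] sum_ennreal less_imp_le)
    also have "\<dots> = ennreal (fst s) + 1" using sum_weight[OF p(1)] p by simp
    finally show "(\<Sum>\<rho>\<in>RS. ennreal (weight (snd s) \<rho>)
        * (\<integral>\<^sup>+\<phi>. ennreal (fst (step lam T eps (\<mu> t) \<rho> s \<phi>)) \<partial>noise eps (Aof \<rho>))) \<le> ennreal (fst s) + 1" .
  qed simp
  then show "(\<integral>\<^sup>+s. ennreal (fst s) \<partial>run lam T eps \<mu> T) \<le> ennreal (real T)"
    by (simp add: ennreal_of_nat_eq_real_of_nat)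
qed simp

lemma expected_total_loss_regret:
  assumes T: "2 \<le> T" and eps1: "eps < 1" and \<sigma>: "\<sigma> \<in> RS"
  shows "expected_total_loss lam T eps \<mu> \<le> (\<Sum>t=1..T. Loss lam \<sigma> (\<mu> t)) + ln (real (n r)) / eta T eps
    + real T * ((gamma T eps + (exp 1 - 2) * 9 / eps\<^sup>2 * eta T eps) * real (card Aset))"
proof -
  define K where "K = (gamma T eps + (exp 1 - 2) * 9 / eps\<^sup>2 * eta T eps) * real (card Aset)"
  let ?G = "\<lambda>s. fst s - ln (weight (snd s) \<sigma>) / eta T eps"
  have eta: "0 < eta T eps" using eta_pos T eps by simp
  have K: "0 \<le> K"
    using eta gamma_nonneg[of T eps] T eps exp_1_gt_2
    unfolding K_def by (intro mult_nonneg_nonneg add_nonneg_nonneg) auto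
  have Loss0: "0 \<le> Loss lam \<sigma> (\<mu> t)" if "t \<in> {1..T}" for t
    using Loss_bounds(1)[OF lam _ \<sigma>] \<mu> that by blast
  have ln: "ln (weight (snd s) \<sigma>) / eta T eps \<le> 0" if "valid s" for s
  proof -
    have p: "policy (snd s)" using that by (simp add: valid_def)
    have "ln (weight (snd s) \<sigma>) \<le> 0" using weight_le_1[OF p \<sigma>] weight_pos[OF p \<sigma>] by simp
    then show ?thesis using eta by (simp add: divide_nonpos_pos)
  qed
  have "(\<integral>\<^sup>+s. ennreal (?G s) \<partial>run lam T eps \<mu> T)
      \<le> ennreal (?G (0, pi1)) + (\<Sum>t=1..T. ennreal (Loss lam \<sigma> (\<mu> t) + K))"
  proof (rule nn_integral_run_le[OF _ _ order_refl])
    show "(\<lambda>s. ennreal (?G s)) \<in> borel_measurable state_space" by measurable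
    fix t s assume t: "t \<in> {1..T}" and s: "s \<in> space state_space" "valid s"
    have env: "environment (\<mu> t)" using \<mu> t by blast
    have p: "policy (snd s)" "0 \<le> fst s" using s by (auto simp: valid_def)
    have "(\<Sum>\<rho>\<in>RS. ennreal (weight (snd s) \<rho>)
        * (\<integral>\<^sup>+\<phi>. ennreal (?G (step lam T eps (\<mu> t) \<rho> s \<phi>)) \<partial>noise eps (Aof \<rho>)))
        \<le> ennreal (?G s + (Loss lam \<sigma> (\<mu> t) + K))"
      using potential_step[OF lam env T eps eps1 p(1) \<sigma> p(2)] by (simp add: step_def K_def)
    also have "\<dots> = ennreal (?G s) + ennreal (Loss lam \<sigma> (\<mu> t) + K)"
      using ln[OF s(2)] p Loss0[OF t] K by (intro ennreal_plus) auto
    finally show "(\<Sum>\<rho>\<in>RS. ennreal (weight (snd s) \<rho>)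
        * (\<integral>\<^sup>+\<phi>. ennreal (?G (step lam T eps (\<mu> t) \<rho> s \<phi>)) \<partial>noise eps (Aof \<rho>)))
        \<le> ennreal (?G s) + ennreal (Loss lam \<sigma> (\<mu> t) + K)" .
  qed
  also have "(\<Sum>t=1..T. ennreal (Loss lam \<sigma> (\<mu> t) + K)) = ennreal (\<Sum>t=1..T. Loss lam \<sigma> (\<mu> t) + K)"
    using Loss0 K by (intro sum_ennreal) auto
  \<comment> \<open>The uniform initial weights \<open>1 / n r\<close> give the usual ln N / eta of
    multiplicative weights.\<close>
  also have "?G (0, pi1) = ln (real (n r)) / eta T eps"
    using n_root_ge_2 by (simp add: weight_pi1[OF \<sigma>] ln_div)
  also have "ennreal (ln (real (n r)) / eta T eps) + ennreal (\<Sum>t=1..T. Loss lam \<sigma> (\<mu> t) + K)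
      = ennreal (ln (real (n r)) / eta T eps + (\<Sum>t=1..T. Loss lam \<sigma> (\<mu> t) + K))"
    using ln_n_root_pos eta Loss0 K by (intro ennreal_plus[symmetric] sum_nonneg) auto
  finally have G: "(\<integral>\<^sup>+s. ennreal (?G s) \<partial>run lam T eps \<mu> T)
      \<le> ennreal (ln (real (n r)) / eta T eps + (\<Sum>t=1..T. Loss lam \<sigma> (\<mu> t) + K))" .
  \<comment> \<open>Weights are at most 1, so the potential dominates the accumulated loss.\<close>
  have "(\<integral>\<^sup>+s. ennreal (fst s) \<partial>run lam T eps \<mu> T) \<le> (\<integral>\<^sup>+s. ennreal (?G s) \<partial>run lam T eps \<mu> T)"
  proof (rule nn_integral_mono_AE)
    show "AE s in run lam T eps \<mu> T. ennreal (fst s) \<le> ennreal (?G s)"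
      using run_invariant(3)[OF order_refl] by eventually_elim (use ln in \<open>auto intro!: ennreal_leI\<close>)
  qed
  moreover have "0 \<le> ln (real (n r)) / eta T eps + (\<Sum>t=1..T. Loss lam \<sigma> (\<mu> t) + K)"
    using ln_n_root_pos eta Loss0 K by (intro add_nonneg_nonneg sum_nonneg) auto
  ultimately have "expected_total_loss lam T eps \<mu>
      \<le> ln (real (n r)) / eta T eps + (\<Sum>t=1..T. Loss lam \<sigma> (\<mu> t) + K)"
    using expected_total_loss_le[OF order_trans[OF _ G]] by blast
  then show ?thesis unfolding K_def[symmetric] by (simp add: sum.distrib)
qed

end
end

text \<open>With eta = 1 / sqrt Z and l = ln (n r), both the starting potential and the total drift
  equal l * sqrt Z. The choice of eta balances them, hence the factor 2.\<close>

lemma parameter_tuning: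
  assumes T: "1 \<le> T" and eps: "0 < eps"
  shows "ln (real (n r)) / eta T eps
      + real T * ((gamma T eps + (exp 1 - 2) * 9 / eps\<^sup>2 * eta T eps) * real (card Aset))
    = 2 * sqrt ((6 * ln (real T) / eps + 9 * (exp 1 - 2) / eps\<^sup>2)
        * real (card Aset) * ln (real (n r)) * real T)"
proof -
  define Q where "Q = 6 * ln (real T) / eps + 9 * (exp 1 - 2) / eps\<^sup>2"
  define l where "l = ln (real (n r))"
  define Z where "Z = Q * real (card Aset) * real T / l"
  have Q: "0 < Q" unfolding Q_def using assms exp_1_gt_2 by (intro add_nonneg_pos) auto
  have l: "0 < l" unfolding l_def by (rule ln_n_root_pos)
  have Z: "0 < Z" unfolding Z_def using Q l T card_Aset_pos by simp
  have eta: "eta T eps = 1 / sqrt Z" unfolding eta_def Z_def Q_def l_def by (simp add: m_root)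
  have "gamma T eps + (exp 1 - 2) * 9 / eps\<^sup>2 * eta T eps = Q * eta T eps"
    unfolding gamma_def Q_def by (simp add: algebra_simps)
  then have "real T * ((gamma T eps + (exp 1 - 2) * 9 / eps\<^sup>2 * eta T eps) * real (card Aset)) = l * (Z / sqrt Z)"
    using l by (simp add: eta Z_def)
  also have "Z / sqrt Z = sqrt Z" using Z by (simp add: real_div_sqrt)
  finally have "ln (real (n r)) / eta T eps
      + real T * ((gamma T eps + (exp 1 - 2) * 9 / eps\<^sup>2 * eta T eps) * real (card Aset)) = 2 * (l * sqrt Z)"
    by (simp add: eta l_def)
  also have "l * sqrt Z = sqrt (l\<^sup>2 * Z)" using l by (simp add: real_sqrt_mult)
  also have "l\<^sup>2 * Z = Q * real (card Aset) * l * real T"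
    using l by (simp add: Z_def power2_eq_square)
  finally show ?thesis unfolding Q_def l_def .
qed

end

theorem theorem1:
  fixes V :: "'v set" and r :: 'v and par :: "'v \<Rightarrow> 'v"
    and Nset Aset :: "'v set" and lam :: "'v \<Rightarrow> real"
    and T :: nat and eps :: real and \<mu> :: "nat \<Rightarrow> 'v \<Rightarrow> 'v"
  assumes "game_tree V r par Nset Aset"
    and "\<forall>u \<in> game_tree.leaves V r par. 0 \<le> lam u \<and> lam u \<le> 1"
    and "T \<ge> 1" and "0 < eps" and "eps < 1"
    and "\<forall>t \<in> {1..T}. game_tree.environment V r par Aset (\<mu> t)"
  shows "game_tree.expected_total_loss V r par Nset Aset lam T eps \<mu>
           - (MIN \<sigma> \<in> game_tree.RS V r par Nset Aset.
                 \<Sum>t = 1..T. game_tree.Loss V r par Nset Aset lam \<sigma> (\<mu> t))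
         \<le> 1 + 2 * sqrt ((6 * ln (real T) / eps + 9 * (exp 1 - 2) / eps\<^sup>2)
                 * real (card Aset) * ln (real (card (game_tree.RS V r par Nset Aset))) * real T)"
proof -
  interpret game_tree V r par Nset Aset by fact
  let ?f = "\<lambda>\<sigma>. \<Sum>t = 1..T. Loss lam \<sigma> (\<mu> t)"
  let ?R = "(6 * ln (real T) / eps + 9 * (exp 1 - 2) / eps\<^sup>2)
      * real (card Aset) * ln (real (card RS)) * real T"
  have "Min (?f ` RS) \<in> ?f ` RS" using finite_RS RS_nonempty by (intro Min_in) auto
  then obtain \<sigma> where \<sigma>: "\<sigma> \<in> RS" "Min (?f ` RS) = ?f \<sigma>" by auto
  have "expected_total_loss lam T eps \<mu> - ?f \<sigma> \<le> 1 + 2 * sqrt ?R"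
  proof (cases "T = 1")
    \<comment> \<open>Here ln T = 0, so gamma vanishes and the noise scale is no longer controlled.
      The additive 1 in the bound pays for the only trial.\<close>
    case True
    have "0 \<le> ?f \<sigma>" using Loss_bounds(1)[OF assms(2) _ \<sigma>(1)] assms(6) by (intro sum_nonneg) blast
    moreover have "expected_total_loss lam T eps \<mu> \<le> 1"
      using expected_total_loss_le_T[OF assms(4,2,6)] True by simp
    moreover have "0 \<le> ?R" using assms(3,4) exp_1_gt_2 ln_n_root_pos
      by (intro mult_nonneg_nonneg add_nonneg_nonneg) (auto simp: card_RS)
    ultimately show ?thesis using real_sqrt_ge_zero[of ?R] by linarith
  next
    case False
    then have "2 \<le> T" using assms(3) by simp
    from expected_total_loss_regret[OF assms(4,2,6) this assms(5) \<sigma>(1)]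
    show ?thesis using parameter_tuning[OF assms(3,4)] by (simp add: card_RS)
  qed
  then show ?thesis using \<sigma>(2) by simp
qed

end
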